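(* Let $M$ be an atomic von Neumann algebra with predual $M_*$, and let $A\subset M_*$ be a nonempty bounded set. Then $$\omega(A)=\operatorname{wk}_{M_*}(A)=\operatorname{wck}_{M_*}(A).$$ Moreover, let $(p_\alpha)_{\alpha\in\Lambda}$ and $(q_j)_{j\in J}$ be two families (possibly but not necessarily the same) of pairwise orthogonal atomic projections in $M$, both with sum $1$. Then all these measures of weak non-compactness of $A$ are equal to $$\inf\left\{\sup_{\varphi\in A}\Big\|\Big(1-\sum_{\alpha\in C}p_\alpha\Big)\varphi\Big(1-\sum_{j\in D}q_j\Big)\Big\| : C\subset\Lambda,\ D\subset J\text{ finite}\right\}.$$
   Context: A von Neumann algebra is a $*$-subalgebra $M\subset L(H)$ of the bounded linear operators on a complex Hilbert space $H$ that equals its double commutant. A projection in $M$ is an element $p\in M$ with $p^*=p=p^2$. A projection $p\in M$ is atomic if the subalgebra $pMp$ has dimension one (equivalently, $p$ is an atom of the projection lattice of $M$). $M$ is atomic if its unit $1$ is the sum of atomic projections (sums of pairwise orthogonal projections are taken in the strong operator topology). $M_*$ is the predual of $M$, i.e. the Banach space of normal (weak$^*$-continuous) functionals on $M$. For $a,b\in M$ and $\varphi\in M_*$, the functional $a\varphi b\in M_*$ is given by $(a\varphi b)(x)=\varphi(bxa)$, $x\in M$; the norm is that of $M_*$. Measures of weak non-compactness: for nonempty subsets $A,B$ of a Banach space put $\widehat{\operatorname{d}}(A,B)=\sup\{\operatorname{dist}(a,B): a\in A\}$. For a nonempty bounded set $A$ in a Banach space $X$ (canonically embedded in $X^{**}$),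 define: - $\omega(A)=\inf\{\widehat{\operatorname{d}}(A,K): K\subset X\text{ weakly compact}\}$; - $\operatorname{wk}_X(A)=\widehat{\operatorname{d}}(\overline{A}^{w^*},X)$, where $\overline{A}^{w^*}$ is the closure of $A$ in $(X^{**},w^* )$ and distances are taken in $X^{**}$; - $\operatorname{wck}_X(A)=\sup\{\operatorname{dist}(\operatorname{clust}_{w^*}(x_n),X): (x_n)\text{ a sequence in }A\}$, where $\operatorname{clust}_{w^*}(x_n)$ is the set of all weak$^*$ cluster points of $(x_n)$ in $X^{**}$, and $\operatorname{dist}(S,X)=\inf\{\|s-x\|: s\in S,\ x\in X\}$. Here they are applied with $X=M_*$. *)

theory Defs
  imports "HOL-Analysis.Analysis" "HOL-Library.Function_Algebras"
begin

class complex_vector = ab_group_add +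
  fixes scaleC :: "complex \<Rightarrow> 'a \<Rightarrow> 'a"  (infixr \<open>*\<^sub>C\<close> 75)
  assumes scaleC_add_right: "c *\<^sub>C (x + y) = c *\<^sub>C x + c *\<^sub>C y"
    and scaleC_add_left: "(c + d) *\<^sub>C x = c *\<^sub>C x + d *\<^sub>C x"
    and scaleC_scaleC: "c *\<^sub>C d *\<^sub>C x = (c * d) *\<^sub>C x"
    and scaleC_one: "1 *\<^sub>C x = x"

global_interpretation complex_vector: vector_space "scaleC :: complex \<Rightarrow> 'a \<Rightarrow> 'a::complex_vector"
  by unfold_locales
    (simp_all add: scaleC_add_right scaleC_add_left scaleC_scaleC scaleC_one)

class complex_normed_vector = real_normed_vector + complex_vector +
  assumes scaleC_of_real: "complex_of_real r *\<^sub>C x = r *\<^sub>R x"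
    and norm_scaleC: "norm (c *\<^sub>C x) = cmod c * norm x"

text \<open>The inner product is linear in its first argument.\<close>

class complex_hilbert_space = complex_normed_vector + complete_space +
  fixes cinner :: "'a \<Rightarrow> 'a \<Rightarrow> complex"
  assumes cinner_add_left: "cinner (x + y) z = cinner x z + cinner y z"
    and cinner_scaleC_left: "cinner (c *\<^sub>C x) y = c * cinner x y"
    and cinner_commute: "cinner x y = cnj (cinner y x)"
    and cinner_self: "cinner x x = complex_of_real ((norm x)\<^sup>2)"

instantiation complex :: complex_hilbert_space
begin
definition scaleC_complex :: "complex \<Rightarrow> complex \<Rightarrow> complex" where
  "scaleC_complex c x = c * x"
definition cinner_complex :: "complex \<Rightarrow> complex \<Rightarrow> complex" where
  "cinner_complex x y = x * cnj y"
instance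
  by standard
    (auto simp: scaleC_complex_def cinner_complex_def algebra_simps norm_mult
        scaleR_conv_of_real complex_mult_cnj cmod_power2)
end

instantiation "fun" :: (type, complex_vector) complex_vector
begin
definition scaleC_fun :: "complex \<Rightarrow> ('a \<Rightarrow> 'b) \<Rightarrow> 'a \<Rightarrow> 'b" where
  "scaleC_fun c f = (\<lambda>x. c *\<^sub>C f x)"
instance
  by standard
    (auto simp: scaleC_fun_def fun_eq_iff scaleC_add_right scaleC_add_left scaleC_scaleC scaleC_one)
end

instantiation blinfun :: (real_normed_vector, complex_normed_vector) complex_vector
begin
lift_definition scaleC_blinfun :: "complex \<Rightarrow> ('a \<Rightarrow>\<^sub>L 'b) \<Rightarrow> ('a \<Rightarrow>\<^sub>L 'b)"
  is "\<lambda>c f x. c *\<^sub>C f x"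
proof -
  fix c :: complex and f :: "'a \<Rightarrow> 'b"
  assume "bounded_linear f"
  moreover have "bounded_linear (\<lambda>y::'b. c *\<^sub>C y)"
  proof (rule bounded_linear_intro[where K = "cmod c"])
    show "c *\<^sub>C (x + y) = c *\<^sub>C x + c *\<^sub>C y" for x y :: 'b
      by (rule scaleC_add_right)
    show "c *\<^sub>C (r *\<^sub>R x) = r *\<^sub>R (c *\<^sub>C x)" for r and x :: 'b
      by (metis mult.commute scaleC_of_real scaleC_scaleC)
    show "norm (c *\<^sub>C x) \<le> norm x * cmod c" for x :: 'b
      by (simp add: norm_scaleC)
  qed
  ultimately show "bounded_linear (\<lambda>x. c *\<^sub>C f x)"
    by (rule bounded_linear_compose[rotated])
qed
instance
  by standard
    (transfer; auto simp: fun_eq_iff scaleC_add_right scaleC_add_left scaleC_scaleC scaleC_one)+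
end


section \<open>Von Neumann algebras\<close>

text \<open>Elements of \<^typ>\<open>'h \<Rightarrow>\<^sub>L 'h\<close> are only real-linear, so \<open>L(H)\<close> is cut out as a
  subset of this type.  Its norm is the operator norm.\<close>

definition bounded_ops :: "('h::complex_hilbert_space \<Rightarrow>\<^sub>L 'h) set" where
  "bounded_ops = {a :: 'h \<Rightarrow>\<^sub>L 'h. \<forall>c x. a (c *\<^sub>C x) = c *\<^sub>C a x}"

text \<open>\<open>is_adjoint a b\<close> says \<open>a* = b\<close>; the adjoint is uniquely determined by this relation.\<close>

definition is_adjoint :: "('h::complex_hilbert_space \<Rightarrow>\<^sub>L 'h) \<Rightarrow> ('h \<Rightarrow>\<^sub>L 'h) \<Rightarrow> bool" where
  "is_adjoint a b \<longleftrightarrow> (\<forall>x y. cinner (a x) y = cinner x (b y))"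

definition commutant :: "('h::complex_hilbert_space \<Rightarrow>\<^sub>L 'h) set \<Rightarrow> ('h \<Rightarrow>\<^sub>L 'h) set" where
  "commutant S = {a \<in> bounded_ops. \<forall>b\<in>S. a o\<^sub>L b = b o\<^sub>L a}"

definition von_neumann_algebra :: "('h::complex_hilbert_space \<Rightarrow>\<^sub>L 'h) set \<Rightarrow> bool" where
  "von_neumann_algebra M \<longleftrightarrow>
     M \<subseteq> bounded_ops \<and>
     complex_vector.subspace M \<and>
     (\<forall>a\<in>M. \<forall>b\<in>M. a o\<^sub>L b \<in> M) \<and>
     (\<forall>a\<in>M. \<exists>b\<in>M. is_adjoint a b) \<and>
     commutant (commutant M) = M"

definition projection_in :: "('h::complex_hilbert_space \<Rightarrow>\<^sub>L 'h) set \<Rightarrow> ('h \<Rightarrow>\<^sub>L 'h) \<Rightarrow> bool" where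
  "projection_in M p \<longleftrightarrow> p \<in> M \<and> is_adjoint p p \<and> p o\<^sub>L p = p"

definition atomic_projection :: "('h::complex_hilbert_space \<Rightarrow>\<^sub>L 'h) set \<Rightarrow> ('h \<Rightarrow>\<^sub>L 'h) \<Rightarrow> bool" where
  "atomic_projection M p \<longleftrightarrow>
     projection_in M p \<and> complex_vector.dim ((\<lambda>x. p o\<^sub>L x o\<^sub>L p) ` M) = 1"

text \<open>Strong operator convergence of the net of finite partial sums is pointwise
  unconditional convergence.\<close>

definition sot_has_sum ::
    "('i \<Rightarrow> ('h::complex_hilbert_space \<Rightarrow>\<^sub>L 'h)) \<Rightarrow> 'i set \<Rightarrow> ('h \<Rightarrow>\<^sub>L 'h) \<Rightarrow> bool" where
  "sot_has_sum p I s \<longleftrightarrow> (\<forall>x. ((\<lambda>i. p i x) has_sum s x) I)"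

definition atomic_resolution ::
    "('h::complex_hilbert_space \<Rightarrow>\<^sub>L 'h) set \<Rightarrow> 'i set \<Rightarrow> ('i \<Rightarrow> ('h \<Rightarrow>\<^sub>L 'h)) \<Rightarrow> bool" where
  "atomic_resolution M I p \<longleftrightarrow>
     (\<forall>i\<in>I. atomic_projection M (p i)) \<and>
     (\<forall>i\<in>I. \<forall>j\<in>I. i \<noteq> j \<longrightarrow> p i o\<^sub>L p j = 0) \<and>
     sot_has_sum p I id_blinfun"

text \<open>Pairwise orthogonal atomic projections are distinct, so a family of them may be
  indexed by itself.\<close>

definition atomic_algebra :: "('h::complex_hilbert_space \<Rightarrow>\<^sub>L 'h) set \<Rightarrow> bool" where
  "atomic_algebra M \<longleftrightarrow> (\<exists>P. atomic_resolution M P (\<lambda>p. p))"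


section \<open>Duals, weak and weak* topologies\<close>

text \<open>A normed space is a complex subspace \<open>X\<close> of some type together with a function \<open>N\<close>
  that restricts to a norm on \<open>X\<close>.  Functionals on \<open>X\<close> are represented by functions that
  vanish outside \<open>X\<close>.\<close>

definition clinear_on :: "'a::complex_vector set \<Rightarrow> ('a \<Rightarrow> complex) \<Rightarrow> bool" where
  "clinear_on X f \<longleftrightarrow>
     (\<forall>x\<in>X. \<forall>y\<in>X. f (x + y) = f x + f y) \<and> (\<forall>c. \<forall>x\<in>X. f (c *\<^sub>C x) = c * f x)"

definition cdual :: "'a::complex_vector set \<Rightarrow> ('a \<Rightarrow> real) \<Rightarrow> ('a \<Rightarrow> complex) set" where
  "cdual X N = {f. clinear_on X f \<and> (\<exists>B. \<forall>x\<in>X. cmod (f x) \<le> B * N x) \<and> (\<forall>x. x \<notin> X \<longrightarrow> f x = 0)}"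

definition dual_norm :: "'a::complex_vector set \<Rightarrow> ('a \<Rightarrow> real) \<Rightarrow> ('a \<Rightarrow> complex) \<Rightarrow> real" where
  "dual_norm X N f = (SUP x\<in>{x\<in>X. N x \<le> 1}. cmod (f x))"

definition weak_topology :: "'a::complex_vector set \<Rightarrow> ('a \<Rightarrow> real) \<Rightarrow> 'a topology" where
  "weak_topology X N = topology_generated_by {{x\<in>X. f x \<in> U} |f U. f \<in> cdual X N \<and> open U}"

definition weak_star_topology ::
    "'a::complex_vector set \<Rightarrow> ('a \<Rightarrow> real) \<Rightarrow> ('a \<Rightarrow> complex) topology" where
  "weak_star_topology X N = topology_generated_by {{f\<in>cdual X N. f x \<in> U} |x U. x \<in> X \<and> open U}"

definition bidual :: "'a::complex_vector set \<Rightarrow> ('a \<Rightarrow> real) \<Rightarrow> (('a \<Rightarrow> complex) \<Rightarrow> complex) set" where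
  "bidual X N = cdual (cdual X N) (dual_norm X N)"

definition bidual_norm ::
    "'a::complex_vector set \<Rightarrow> ('a \<Rightarrow> real) \<Rightarrow> (('a \<Rightarrow> complex) \<Rightarrow> complex) \<Rightarrow> real" where
  "bidual_norm X N = dual_norm (cdual X N) (dual_norm X N)"

definition bidual_weak_star ::
    "'a::complex_vector set \<Rightarrow> ('a \<Rightarrow> real) \<Rightarrow> (('a \<Rightarrow> complex) \<Rightarrow> complex) topology" where
  "bidual_weak_star X N = weak_star_topology (cdual X N) (dual_norm X N)"

definition canonical_embedding ::
    "'a::complex_vector set \<Rightarrow> ('a \<Rightarrow> real) \<Rightarrow> 'a \<Rightarrow> (('a \<Rightarrow> complex) \<Rightarrow> complex)" where
  "canonical_embedding X N x = (\<lambda>f. if f \<in> cdual X N then f x else 0)"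


section \<open>Measures of weak non-compactness\<close>

definition dhat :: "('a::ab_group_add \<Rightarrow> real) \<Rightarrow> 'a set \<Rightarrow> 'a set \<Rightarrow> real" where
  "dhat N A B = (SUP a\<in>A. INF b\<in>B. N (a - b))"

definition norm_setdist :: "('a::ab_group_add \<Rightarrow> real) \<Rightarrow> 'a set \<Rightarrow> 'a set \<Rightarrow> real" where
  "norm_setdist N S T = (INF (s, t)\<in>S \<times> T. N (s - t))"

definition cluster_points :: "'a topology \<Rightarrow> (nat \<Rightarrow> 'a) \<Rightarrow> 'a set" where
  "cluster_points T x =
     {y \<in> topspace T. \<forall>U. openin T U \<and> y \<in> U \<longrightarrow> (\<exists>\<^sub>F n in sequentially. x n \<in> U)}"

definition omega_measure :: "'a::complex_vector set \<Rightarrow> ('a \<Rightarrow> real) \<Rightarrow> 'a set \<Rightarrow> real" where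
  "omega_measure X N A = (INF K\<in>{K. K \<noteq> {} \<and> compactin (weak_topology X N) K}. dhat N A K)"

definition wk_measure :: "'a::complex_vector set \<Rightarrow> ('a \<Rightarrow> real) \<Rightarrow> 'a set \<Rightarrow> real" where
  "wk_measure X N A =
     dhat (bidual_norm X N)
       (bidual_weak_star X N closure_of (canonical_embedding X N ` A))
       (canonical_embedding X N ` X)"

definition wck_measure :: "'a::complex_vector set \<Rightarrow> ('a \<Rightarrow> real) \<Rightarrow> 'a set \<Rightarrow> real" where
  "wck_measure X N A =
     (SUP x\<in>{x :: nat \<Rightarrow> 'a. range x \<subseteq> A}.
        norm_setdist (bidual_norm X N)
          (cluster_points (bidual_weak_star X N) (\<lambda>n. canonical_embedding X N (x n)))
          (canonical_embedding X N ` X))"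


section \<open>The predual\<close>

text \<open>The weak* topology of a von Neumann algebra is its ultraweak (sigma-weak) topology,
  the initial topology of the functionals \<open>x \<mapsto> \<Sum>n. \<langle>x (\<xi> n), \<eta> n\<rangle>\<close> with square-summable
  sequences \<open>\<xi>\<close>, \<open>\<eta>\<close> in \<open>H\<close>.\<close>

definition ultraweak_topology ::
    "('h::complex_hilbert_space \<Rightarrow>\<^sub>L 'h) set \<Rightarrow> ('h \<Rightarrow>\<^sub>L 'h) topology" where
  "ultraweak_topology M =
     topology_generated_by
       {{x\<in>M. (\<Sum>n. cinner (blinfun_apply x (\<xi> n)) (\<eta> n)) \<in> U} |(\<xi> :: nat \<Rightarrow> 'h) (\<eta> :: nat \<Rightarrow> 'h) U.
          summable (\<lambda>n. (norm (\<xi> n))\<^sup>2) \<and> summable (\<lambda>n. (norm (\<eta> n))\<^sup>2) \<and> open U}"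

definition predual ::
    "('h::complex_hilbert_space \<Rightarrow>\<^sub>L 'h) set \<Rightarrow> (('h \<Rightarrow>\<^sub>L 'h) \<Rightarrow> complex) set" where
  "predual M = {\<phi> \<in> cdual M norm. continuous_map (ultraweak_topology M) euclidean \<phi>}"

definition predual_norm ::
    "('h::complex_hilbert_space \<Rightarrow>\<^sub>L 'h) set \<Rightarrow> (('h \<Rightarrow>\<^sub>L 'h) \<Rightarrow> complex) \<Rightarrow> real" where
  "predual_norm M = dual_norm M norm"

definition bimodule_action ::
    "('h::complex_hilbert_space \<Rightarrow>\<^sub>L 'h) set \<Rightarrow> ('h \<Rightarrow>\<^sub>L 'h) \<Rightarrow>
     (('h \<Rightarrow>\<^sub>L 'h) \<Rightarrow> complex) \<Rightarrow> ('h \<Rightarrow>\<^sub>L 'h) \<Rightarrow> (('h \<Rightarrow>\<^sub>L 'h) \<Rightarrow> complex)" where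
  "bimodule_action M a \<phi> b = (\<lambda>x. if x \<in> M then \<phi> (b o\<^sub>L x o\<^sub>L a) else 0)"

end

theory Submission
  imports Defs "HOL-Complex_Analysis.Great_Picard"
begin

text \<open>
  The inequalities \<open>wck \<le> wk \<le> \<omega>\<close> hold in every space, so with \<open>r\<close> the infimum of the corner norms it
  remains to see that \<open>\<omega> \<le> r \<le> wck\<close>.

  If \<open>p\<close> is an atomic projection and \<open>e\<close> a unit vector in its range, then
  \<open>\<parallel>x p\<parallel> = \<parallel>x e\<parallel>\<close> for \<open>x \<in> M\<close>. So \<open>M p\<close> is a subspace of a Hilbert space, and \<open>x \<mapsto> \<phi> (x p)\<close> is a vector
  functional \<open>x \<mapsto> \<langle>x e, \<eta>\<rangle>\<close> with \<open>\<parallel>\<eta>\<parallel> \<le> \<parallel>\<phi>\<parallel>\<close>; likewise \<open>x \<mapsto> \<phi> (p x)\<close> by taking adjoints.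
  Hence \<open>\<phi> - (1 - P) \<phi> (1 - Q)\<close> stays in a weakly compact set when \<open>\<phi>\<close> ranges over a bounded set and
  \<open>P\<close>, \<open>Q\<close> are finite sums of atomic projections.

  If all corners have supremum above \<open>t\<close>, normality gives inductively \<open>\<phi> n \<in> A\<close> and contractions \<open>x n\<close> living
  in successive disjoint blocks with \<open>\<phi> n (x n) > t\<close>. All sums of the \<open>x n\<close> over subsets of the index set
  are contractions in \<open>M\<close>, which turns the \<open>\<phi> n\<close> into a bounded sequence in \<open>\<ell>\<^sup>1\<close> with large
  diagonal, and a gliding hump argument applies to its weak* cluster points.
\<close>

section \<open>Seminormed spaces, duals and weak topologies\<close>

text \<open>Both sides have to be cut. For \<open>M\<close> all of L(H), the functionals
  \<open>\<lambda>x. cinner (x e) \<eta>\<close> with \<open>e\<close> fixed and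
  \<open>\<eta>\<close> in a ball form a weakly compact set, yet cutting them on the side of
  \<open>\<eta>\<close> alone does not make them uniformly small in infinite dimension; cutting on
  the side of \<open>e\<close> does. In the other direction, \<open>n\<close> contractions with
  orthogonal ranges but a common initial space may have a sum of norm sqrt n. Only when ranges and
  initial spaces are both orthogonal is the sum again a contraction, and this is why
  \<open>r \<le> wck\<close> holds without a constant.

  In \<open>wck\<close> the supremum runs over all sequences in \<open>A\<close>, so passing to a
  subsequence is free, but the lower bound must then hold for every cluster point and every normal
  functional at once. Testing on tails of the blocks achieves both: tails annihilate a normal
  functional in the limit, while the diagonal entries survive along the sequence.

  Suprema and infima are real-valued and so carry information only for nonempty bounded sets; each
  comparison is accompanied by a proof that the sets involved are of this kind.\<close>

definition seminorm_on :: "'a::complex_vector set \<Rightarrow> ('a \<Rightarrow> real) \<Rightarrow> bool" where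
  "seminorm_on X N \<longleftrightarrow> complex_vector.subspace X \<and>
     (\<forall>x\<in>X. \<forall>y\<in>X. N (x + y) \<le> N x + N y) \<and> (\<forall>c. \<forall>x\<in>X. N (c *\<^sub>C x) = cmod c * N x)"

lemma scaleC_minus_one: "(-1) *\<^sub>C x = - (x::'a::complex_vector)"
  using complex_vector.scale_minus_left[of 1 x] by simp

lemma seminorm_on_subspace: "seminorm_on X N \<Longrightarrow> complex_vector.subspace X"
  by (simp add: seminorm_on_def)

lemma
  assumes "seminorm_on X N"
  shows seminorm_on_triangle: "x \<in> X \<Longrightarrow> y \<in> X \<Longrightarrow> N (x + y) \<le> N x + N y"
    and seminorm_on_scale: "x \<in> X \<Longrightarrow> N (c *\<^sub>C x) = cmod c * N x"
    and seminorm_on_zero: "N 0 = 0"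
    and seminorm_on_minus: "x \<in> X \<Longrightarrow> N (- x) = N x"
    and seminorm_on_nonneg: "x \<in> X \<Longrightarrow> 0 \<le> N x"
proof -
  show tri: "x \<in> X \<Longrightarrow> y \<in> X \<Longrightarrow> N (x + y) \<le> N x + N y" for x y
    using assms by (simp add: seminorm_on_def)
  show scal: "x \<in> X \<Longrightarrow> N (c *\<^sub>C x) = cmod c * N x" for c x
    using assms by (simp add: seminorm_on_def)
  have X: "complex_vector.subspace X"
    using assms by (simp add: seminorm_on_def)
  show zero: "N 0 = 0"
    using scal[of 0 0] complex_vector.subspace_0[OF X] by simp
  show minus: "x \<in> X \<Longrightarrow> N (- x) = N x" for x
    using scal[of x "-1"] by (simp add: scaleC_minus_one)
  show "x \<in> X \<Longrightarrow> 0 \<le> N x"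
    using tri[of x "-x"] zero minus[of x] complex_vector.subspace_neg[OF X] by fastforce
qed

lemma seminorm_on_diff:
  assumes "seminorm_on X N" "x \<in> X" "y \<in> X"
  shows "N (x - y) \<le> N x + N y"
  using seminorm_on_triangle[OF assms(1,2), of "-y"] seminorm_on_minus[OF assms(1,3)]
    complex_vector.subspace_neg[OF seminorm_on_subspace[OF assms(1)] assms(3)] by simp

lemma seminorm_on_mono:
  assumes "seminorm_on X N" "Y \<subseteq> X" "complex_vector.subspace Y"
  shows "seminorm_on Y N"
  using assms unfolding seminorm_on_def by blast

lemma seminorm_on_norm:
  "complex_vector.subspace X \<Longrightarrow> seminorm_on X (norm :: 'a::complex_normed_vector \<Rightarrow> real)"
  by (simp add: seminorm_on_def norm_triangle_ineq norm_scaleC)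

lemma
  assumes "f \<in> cdual X N"
  shows cdual_add: "x \<in> X \<Longrightarrow> y \<in> X \<Longrightarrow> f (x + y) = f x + f y"
    and cdual_scale: "x \<in> X \<Longrightarrow> f (c *\<^sub>C x) = c * f x"
    and cdual_outside: "x \<notin> X \<Longrightarrow> f x = 0"
  using assms by (auto simp: cdual_def clinear_on_def)

lemma cdual_diff:
  assumes "f \<in> cdual X N" "complex_vector.subspace X" "x \<in> X" "y \<in> X"
  shows "f (x - y) = f x - f y"
  using cdual_add[OF assms(1,3), of "-y"] cdual_scale[OF assms(1,4), of "-1"]
    complex_vector.subspace_neg[OF assms(2,4)] by (simp add: scaleC_minus_one)

lemma cdual_zero:
  assumes "f \<in> cdual X N"
  shows "f 0 = 0"
proof (cases "0 \<in> X")
  case True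
  then show ?thesis using cdual_scale[OF assms True, of 0] by simp
qed (rule cdual_outside[OF assms])

lemma cdual_sum:
  assumes f: "f \<in> cdual X N" and X: "complex_vector.subspace X" and "\<And>i. i \<in> I \<Longrightarrow> x i \<in> X"
  shows "f (\<Sum>i\<in>I. x i) = (\<Sum>i\<in>I. f (x i))"
  using assms(3)
proof (induction I rule: infinite_finite_induct)
  case (insert i I)
  then show ?case
    using cdual_add[OF f, of "x i" "\<Sum>i\<in>I. x i"] complex_vector.subspace_sum[OF X, of I x] by simp
qed (simp_all add: cdual_zero[OF f])

lemma cdualI:
  assumes "\<And>x y. x \<in> X \<Longrightarrow> y \<in> X \<Longrightarrow> f (x + y) = f x + f y"
    and "\<And>c x. x \<in> X \<Longrightarrow> f (c *\<^sub>C x) = c * f x"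
    and "\<And>x. x \<in> X \<Longrightarrow> cmod (f x) \<le> B * N x"
    and "\<And>x. x \<notin> X \<Longrightarrow> f x = 0"
  shows "f \<in> cdual X N"
  unfolding cdual_def clinear_on_def using assms by blast

lemma cdual_bounded:
  assumes "seminorm_on X N" "f \<in> cdual X N"
  obtains B where "B \<ge> 0" "\<And>x. x \<in> X \<Longrightarrow> cmod (f x) \<le> B * N x"
proof -
  obtain B where B: "\<And>x. x \<in> X \<Longrightarrow> cmod (f x) \<le> B * N x"
    using assms(2) by (auto simp: cdual_def)
  have "cmod (f x) \<le> max B 0 * N x" if "x \<in> X" for x
    using B[OF that] mult_right_mono[of B "max B 0" "N x"] seminorm_on_nonneg[OF assms(1) that]
    by linarith
  then show thesis
    using that[of "max B 0"] by simp
qed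

lemma subspace_cdual:
  assumes "seminorm_on X N"
  shows "complex_vector.subspace (cdual X N)"
proof (rule complex_vector.subspaceI)
  show "0 \<in> cdual X N"
    by (rule cdualI[where B = 0]) auto
next
  fix f g assume fg: "f \<in> cdual X N" "g \<in> cdual X N"
  obtain B1 where B1: "\<And>x. x \<in> X \<Longrightarrow> cmod (f x) \<le> B1 * N x"
    using cdual_bounded[OF assms fg(1)] by blast
  obtain B2 where B2: "\<And>x. x \<in> X \<Longrightarrow> cmod (g x) \<le> B2 * N x"
    using cdual_bounded[OF assms fg(2)] by blast
  show "f + g \<in> cdual X N"
  proof (rule cdualI[where B = "B1 + B2"])
    fix x assume "x \<in> X"
    then show "cmod ((f + g) x) \<le> (B1 + B2) * N x"
      using B1[of x] B2[of x] norm_triangle_ineq[of "f x" "g x"] by (simp add: algebra_simps)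
  qed (use fg in \<open>auto simp: cdual_add cdual_scale cdual_outside algebra_simps\<close>)
next
  fix c f assume f: "f \<in> cdual X N"
  obtain B where B: "\<And>x. x \<in> X \<Longrightarrow> cmod (f x) \<le> B * N x"
    using cdual_bounded[OF assms f] by blast
  show "c *\<^sub>C f \<in> cdual X N"
  proof (rule cdualI[where B = "cmod c * B"])
    fix x assume "x \<in> X"
    then show "cmod ((c *\<^sub>C f) x) \<le> cmod c * B * N x"
      using B[of x] by (simp add: scaleC_fun_def scaleC_complex_def norm_mult mult_left_mono mult.assoc)
  qed (use f in \<open>auto simp: cdual_add cdual_scale cdual_outside scaleC_fun_def scaleC_complex_def
        algebra_simps\<close>)
qed

lemma dual_norm_bdd_above:
  assumes "seminorm_on X N" "f \<in> cdual X N"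
  shows "bdd_above ((\<lambda>x. cmod (f x)) ` {x\<in>X. N x \<le> 1})"
proof -
  obtain B where B: "B \<ge> 0" "\<And>x. x \<in> X \<Longrightarrow> cmod (f x) \<le> B * N x"
    using cdual_bounded[OF assms] by blast
  have "cmod (f x) \<le> B" if "x \<in> X" "N x \<le> 1" for x
    using B(2)[OF that(1)] mult_left_mono[OF that(2) B(1)] by simp
  then show ?thesis
    by (intro bdd_aboveI2[where M = B]) auto
qed

lemma dual_norm_upper:
  assumes "seminorm_on X N" "f \<in> cdual X N" "x \<in> X" "N x \<le> 1"
  shows "cmod (f x) \<le> dual_norm X N f"
  unfolding dual_norm_def
  by (rule cSUP_upper[OF _ dual_norm_bdd_above[OF assms(1,2)]]) (use assms in auto)

lemma dual_norm_least:
  assumes "seminorm_on X N" "\<And>x. x \<in> X \<Longrightarrow> N x \<le> 1 \<Longrightarrow> cmod (f x) \<le> B"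
  shows "dual_norm X N f \<le> B"
  unfolding dual_norm_def
proof (rule cSUP_least)
  show "{x \<in> X. N x \<le> 1} \<noteq> {}"
    using complex_vector.subspace_0[OF seminorm_on_subspace[OF assms(1)]] seminorm_on_zero[OF assms(1)]
    by force
qed (use assms in auto)

lemma less_dual_normE:
  assumes "seminorm_on X N" "t < dual_norm X N f"
  obtains x where "x \<in> X" "N x \<le> 1" "t < cmod (f x)"
  using dual_norm_least[OF assms(1), of f t] assms(2) by force

lemma dual_norm_nonneg:
  assumes "seminorm_on X N" "f \<in> cdual X N"
  shows "0 \<le> dual_norm X N f"
  using dual_norm_upper[OF assms, of 0] complex_vector.subspace_0[OF seminorm_on_subspace[OF assms(1)]]
    seminorm_on_zero[OF assms(1)] norm_ge_zero[of "f 0"] by linarith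

lemma dual_norm_bound:
  assumes "seminorm_on X N" "f \<in> cdual X N" "x \<in> X"
  shows "cmod (f x) \<le> dual_norm X N f * N x"
proof (cases "N x = 0")
  \<comment> \<open>Such a vector cannot be normalised; the mere existence of some bound for
    \<open>f\<close> relative to \<open>N\<close> forces \<open>f x = 0\<close>.\<close>
  case True
  obtain B where "cmod (f x) \<le> B * N x"
    using cdual_bounded[OF assms(1,2)] assms(3) by blast
  with True show ?thesis by simp
next
  case False
  with seminorm_on_nonneg[OF assms(1,3)] have pos: "N x > 0" by simp
  let ?y = "complex_of_real (inverse (N x)) *\<^sub>C x"
  have y: "?y \<in> X"
    using complex_vector.subspace_scale[OF seminorm_on_subspace[OF assms(1)] assms(3)] .
  have "N ?y \<le> 1"
    using pos by (simp add: seminorm_on_scale[OF assms(1,3)] norm_inverse)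
  from dual_norm_upper[OF assms(1,2) y this]
  have "inverse (N x) * cmod (f x) \<le> dual_norm X N f"
    using pos by (simp add: cdual_scale[OF assms(2,3)] norm_mult norm_inverse)
  then show ?thesis
    using pos by (simp add: field_simps)
qed

text \<open>Norms are plain functions on carrier sets, so this lemma applies to its own result: used
  twice it gives the bidual norm, and on \<open>M\<close> it gives the norm whose restriction is
  \<open>predual_norm\<close>.\<close>

lemma seminorm_on_dual:
  assumes "seminorm_on X N"
  shows "seminorm_on (cdual X N) (dual_norm X N)"
  unfolding seminorm_on_def
proof (intro conjI ballI allI)
  show "complex_vector.subspace (cdual X N)"
    by (rule subspace_cdual[OF assms])
next
  fix f g assume fg: "f \<in> cdual X N" "g \<in> cdual X N"
  show "dual_norm X N (f + g) \<le> dual_norm X N f + dual_norm X N g"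
  proof (rule dual_norm_least[OF assms])
    fix x assume x: "x \<in> X" "N x \<le> 1"
    show "cmod ((f + g) x) \<le> dual_norm X N f + dual_norm X N g"
      using dual_norm_upper[OF assms fg(1) x] dual_norm_upper[OF assms fg(2) x]
        norm_triangle_ineq[of "f x" "g x"] by simp
  qed
next
  fix c f assume f: "f \<in> cdual X N"
  have le: "dual_norm X N (c *\<^sub>C f) \<le> cmod c * dual_norm X N f" if "f \<in> cdual X N" for c f
  proof (rule dual_norm_least[OF assms])
    fix x assume x: "x \<in> X" "N x \<le> 1"
    show "cmod ((c *\<^sub>C f) x) \<le> cmod c * dual_norm X N f"
      using dual_norm_upper[OF assms that x]
      by (simp add: scaleC_fun_def scaleC_complex_def norm_mult mult_left_mono)
  qed
  show "dual_norm X N (c *\<^sub>C f) = cmod c * dual_norm X N f"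
  proof (cases "c = 0")
    case True
    then show ?thesis
      using le[OF f, of 0] dual_norm_nonneg[OF assms, of 0]
        complex_vector.subspace_0[OF subspace_cdual[OF assms]] by simp
  next
    case False
    \<comment> \<open>The reverse inequality is \<open>le\<close> itself, for the scalar
      \<open>inverse c\<close> and the functional \<open>c *\<^sub>C f\<close>.\<close>
    have "dual_norm X N (inverse c *\<^sub>C c *\<^sub>C f) \<le> cmod (inverse c) * dual_norm X N (c *\<^sub>C f)"
      by (rule le[OF complex_vector.subspace_scale[OF subspace_cdual[OF assms] f]])
    then have "cmod c * dual_norm X N f \<le> dual_norm X N (c *\<^sub>C f)"
      using False by (simp add: norm_divide field_simps)
    with le[OF f, of c] show ?thesis by simp
  qed
qed

lemma canonical_embedding_bidual:
  assumes "seminorm_on X N" "x \<in> X"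
  shows "canonical_embedding X N x \<in> bidual X N"
    and "bidual_norm X N (canonical_embedding X N x) \<le> N x"
proof -
  have sub: "f + g \<in> cdual X N" "c *\<^sub>C f \<in> cdual X N"
    if "f \<in> cdual X N" "g \<in> cdual X N" for f g c
    using that subspace_cdual[OF assms(1)]
    by (auto intro: complex_vector.subspace_add complex_vector.subspace_scale)
  show "canonical_embedding X N x \<in> bidual X N"
    unfolding bidual_def canonical_embedding_def
    by (rule cdualI[where B = "N x"])
      (use sub dual_norm_bound[OF assms(1) _ assms(2)]
        in \<open>auto simp: scaleC_fun_def scaleC_complex_def mult.commute\<close>)
  show "bidual_norm X N (canonical_embedding X N x) \<le> N x"
    unfolding bidual_norm_def
  proof (rule dual_norm_least[OF seminorm_on_dual[OF assms(1)]])
    fix f assume f: "f \<in> cdual X N" "dual_norm X N f \<le> 1"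
    show "cmod (canonical_embedding X N x f) \<le> N x"
      using dual_norm_bound[OF assms(1) f(1) assms(2)]
        mult_right_mono[OF f(2) seminorm_on_nonneg[OF assms]] f(1)
      by (simp add: canonical_embedding_def)
  qed
qed

lemma seminorm_on_bidual: "seminorm_on X N \<Longrightarrow> seminorm_on (bidual X N) (bidual_norm X N)"
  unfolding bidual_def bidual_norm_def by (intro seminorm_on_dual)

section \<open>Weak and weak* topologies, and compactness of dual balls\<close>

lemma topspace_weak_topology: "topspace (weak_topology X N) = X"
proof -
  \<comment> \<open>The zero functional with \<open>U = UNIV\<close> makes \<open>X\<close> itself
    one of the generating sets.\<close>
  have "0 \<in> cdual X N"
    by (rule cdualI[where B = 0]) auto
  then have "{x\<in>X. (0 :: _ \<Rightarrow> complex) x \<in> UNIV} \<in> {{x\<in>X. f x \<in> U} |f U. f \<in> cdual X N \<and> open U}"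
    by blast
  then show ?thesis
    unfolding weak_topology_def topology_generated_by_topspace by auto
qed

lemma topspace_weak_star_topology:
  assumes "X \<noteq> {}"
  shows "topspace (weak_star_topology X N) = cdual X N"
proof -
  obtain x where "x \<in> X" using assms by blast
  then have "{f\<in>cdual X N. f x \<in> UNIV} \<in> {{f\<in>cdual X N. f x \<in> U} |x U. x \<in> X \<and> open U}"
    by blast
  then show ?thesis
    unfolding weak_star_topology_def topology_generated_by_topspace by auto
qed

lemma topspace_bidual_weak_star:
  assumes "seminorm_on X N"
  shows "topspace (bidual_weak_star X N) = bidual X N"
  unfolding bidual_weak_star_def bidual_def
  by (rule topspace_weak_star_topology)
    (use complex_vector.subspace_0[OF subspace_cdual[OF assms]] in blast)

lemma openin_weak_topology:
  "f \<in> cdual X N \<Longrightarrow> open U \<Longrightarrow> openin (weak_topology X N) {x\<in>X. f x \<in> U}"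
  unfolding weak_topology_def by (rule topology_generated_by_Basis) blast

lemma openin_weak_star_topology:
  "x \<in> X \<Longrightarrow> open U \<Longrightarrow> openin (weak_star_topology X N) {f\<in>cdual X N. f x \<in> U}"
  unfolding weak_star_topology_def by (rule topology_generated_by_Basis) blast

lemma continuous_map_weak_topology_functional:
  assumes "f \<in> cdual X N"
  shows "continuous_map (weak_topology X N) euclidean f"
  unfolding continuous_map_def
  using openin_weak_topology[OF assms] by (auto simp: topspace_weak_topology)

text \<open>The weak topology is the initial topology of \<open>cdual X N\<close>, so continuity
  into it can be tested one functional at a time.\<close>

lemma continuous_map_weak_topologyI:
  assumes "\<And>t. t \<in> topspace T \<Longrightarrow> F t \<in> X"
    and "\<And>f. f \<in> cdual X N \<Longrightarrow> continuous_map T euclidean (\<lambda>t. f (F t))"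
  shows "continuous_map T (weak_topology X N) F"
  unfolding weak_topology_def
proof (rule continuous_on_generated_topo)
  fix U assume "U \<in> {{x \<in> X. f x \<in> U} |f U. f \<in> cdual X N \<and> open U}"
  then obtain f V where fV: "U = {x\<in>X. f x \<in> V}" "f \<in> cdual X N" "open V" by blast
  have "F -` U \<inter> topspace T = {t \<in> topspace T. f (F t) \<in> V}"
    using assms(1) fV(1) by auto
  also have "openin T \<dots>"
    using openin_continuous_map_preimage[OF assms(2)[OF fV(2)], of V] fV(3) by simp
  finally show "openin T (F -` U \<inter> topspace T)" .
next
  show "F ` topspace T \<subseteq> \<Union> {{x \<in> X. f x \<in> U} |f U. f \<in> cdual X N \<and> open U}"
    using assms(1) topspace_weak_topology[of X N]
    unfolding weak_topology_def topology_generated_by_topspace by auto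
qed

lemma continuous_map_cmult:
  fixes g :: "'a \<Rightarrow> complex"
  shows "continuous_map T euclidean g \<Longrightarrow> continuous_map T euclidean (\<lambda>x. c * g x)"
  by (simp add: continuous_map_atin tendsto_mult)

text \<open>The Banach-Alaoglu argument: by Tychonoff a product of discs is compact, and additivity
  and homogeneity cut out a closed subset, each single instance being an equation between finitely
  many coordinates.\<close>

lemma compactin_dual_ball:
  fixes X :: "'a::complex_vector set"
  assumes "seminorm_on X N"
  shows "compactin (weak_star_topology X N) {f\<in>cdual X N. \<forall>x\<in>X. cmod (f x) \<le> R * N x}"
    (is "compactin ?W ?K")
proof -
  let ?P = "product_topology (\<lambda>_. euclidean :: complex topology) (UNIV :: 'a set)"
  \<comment> \<open>The discs of radius 0 off \<open>X\<close> encode the convention that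
    functionals vanish outside their carrier.\<close>
  let ?B = "PiE UNIV (\<lambda>x::'a. cball (0::complex) (if x \<in> X then R * N x else 0))"
  have B: "compactin ?P ?B"
    by (subst compactin_PiE) (simp add: compactin_euclidean_iff)
  have ev: "continuous_map ?P euclidean (\<lambda>f. f x)" for x :: 'a
    by (rule continuous_map_product_projection) simp
  let ?E = "\<lambda>g. {f \<in> topspace ?P. g f \<in> {0::complex}}"
  have cl: "closedin ?P (?E g)" if "continuous_map ?P euclidean g" for g
    by (rule closedin_continuous_map_preimage[OF that]) simp
  have cont: "continuous_map ?P euclidean (\<lambda>f. f (x + y) - f x - f y)"
    "continuous_map ?P euclidean (\<lambda>f. f (c *\<^sub>C x) - c * f x)" for x y :: 'a and c
    using ev by (auto intro!: continuous_intros continuous_map_cmult)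
  let ?L = "(\<Inter>x\<in>X. \<Inter>y\<in>X. ?E (\<lambda>f. f (x + y) - f x - f y)) \<inter>
     (\<Inter>c. \<Inter>x\<in>X. ?E (\<lambda>f. f (c *\<^sub>C x) - c * f x))"
  have Xne: "X \<noteq> {}"
    using complex_vector.subspace_0[OF seminorm_on_subspace[OF assms]] by blast
  have clL: "closedin ?P ?L"
    by (intro closedin_Int closedin_INT Xne cl cont) auto
  have K: "?K = ?L \<inter> ?B"
  proof (intro set_eqI iffI)
    fix f assume "f \<in> ?K"
    then show "f \<in> ?L \<inter> ?B"
      by (auto simp: cdual_add cdual_scale cdual_outside)
  next
    fix f assume f: "f \<in> ?L \<inter> ?B"
    have B: "cmod (f x) \<le> (if x \<in> X then R * N x else 0)" for x
      using f by (auto simp: PiE_iff)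
    have "f (x + y) - f x - f y = 0" "f (c *\<^sub>C x) - c * f x = 0" if "x \<in> X" "y \<in> X" for x y c
      using f that by blast+
    moreover have le: "cmod (f x) \<le> R * N x" if "x \<in> X" for x
      using B[of x] that by simp
    moreover have "f x = 0" if "x \<notin> X" for x
      using B[of x] that by simp
    ultimately have "f \<in> cdual X N"
      by (intro cdualI[where B = R]) (auto simp: algebra_simps)
    with le show "f \<in> ?K" by blast
  qed
  have "compactin ?P ?K"
    unfolding K by (rule closed_Int_compactin[OF clL B])
  \<comment> \<open>Compactness is carried over from the product topology by the identity map: weak*
    generating sets are conditions on a single coordinate.\<close>
  moreover have "continuous_map (subtopology ?P ?K) ?W (\<lambda>f. f)"
    unfolding weak_star_topology_def
  proof (rule continuous_on_generated_topo)
    fix U assume "U \<in> {{f \<in> cdual X N. f x \<in> U} |x U. x \<in> X \<and> open U}"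
    then obtain x V where U: "U = {f\<in>cdual X N. f x \<in> V}" "x \<in> X" "open V" by blast
    have "(\<lambda>f. f) -` U \<inter> topspace (subtopology ?P ?K) = {f \<in> topspace (subtopology ?P ?K). f x \<in> V}"
      using U by auto
    also have "openin (subtopology ?P ?K) \<dots>"
      by (rule openin_continuous_map_preimage[OF continuous_map_from_subtopology[OF ev]]) (simp add: U)
    finally show "openin (subtopology ?P ?K) ((\<lambda>f. f) -` U \<inter> topspace (subtopology ?P ?K))" .
  next
    have "topspace (subtopology ?P ?K) \<subseteq> cdual X N" by auto
    then show "(\<lambda>f. f) ` topspace (subtopology ?P ?K)
        \<subseteq> \<Union> {{f \<in> cdual X N. f x \<in> U} |x U. x \<in> X \<and> open U}"
      using topspace_weak_star_topology[OF Xne, of N]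
      unfolding weak_star_topology_def topology_generated_by_topspace by auto
  qed
  ultimately have "compactin ?W ((\<lambda>f. f) ` ?K)"
    by (intro image_compactin[of "subtopology ?P ?K"]) (auto simp: compactin_subtopology)
  then show ?thesis by simp
qed

lemma compactin_bidual_ball:
  assumes "seminorm_on X N" "R \<ge> 0"
  shows "compactin (bidual_weak_star X N) {F\<in>bidual X N. bidual_norm X N F \<le> R}"
proof -
  note D = seminorm_on_dual[OF assms(1)]
  have "{F\<in>bidual X N. bidual_norm X N F \<le> R} = {F\<in>cdual (cdual X N) (dual_norm X N).
      \<forall>f\<in>cdual X N. cmod (F f) \<le> R * dual_norm X N f}" (is "?A = ?B")
  proof (intro set_eqI iffI)
    fix F assume "F \<in> ?A"
    then have F: "F \<in> cdual (cdual X N) (dual_norm X N)" "bidual_norm X N F \<le> R"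
      by (auto simp: bidual_def)
    have "cmod (F f) \<le> R * dual_norm X N f" if "f \<in> cdual X N" for f
      using dual_norm_bound[OF D F(1) that]
        mult_right_mono[OF F(2)[unfolded bidual_norm_def] dual_norm_nonneg[OF assms(1) that]]
      by linarith
    with F show "F \<in> ?B" by blast
  next
    fix F assume F: "F \<in> ?B"
    have "bidual_norm X N F \<le> R"
      unfolding bidual_norm_def
    proof (rule dual_norm_least[OF D])
      fix f assume f: "f \<in> cdual X N" "dual_norm X N f \<le> 1"
      have "cmod (F f) \<le> R * dual_norm X N f" using F f(1) by blast
      also have "\<dots> \<le> R" using mult_left_mono[OF f(2) assms(2)] by simp
      finally show "cmod (F f) \<le> R" .
    qed
    with F show "F \<in> ?A" by (auto simp: bidual_def)
  qed
  then show ?thesis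
    unfolding bidual_weak_star_def by (simp add: compactin_dual_ball[OF D])
qed

section \<open>Comparison of the measures in a general space\<close>

text \<open>Otherwise each point of \<open>K\<close> has a neighbourhood that the sequence
  eventually avoids; finitely many of these cover \<open>K\<close>, and a late term of the sequence
  lies in none of them.\<close>

lemma cluster_points_nonempty:
  assumes "compactin T K" "range x \<subseteq> K"
  shows "cluster_points T x \<noteq> {}"
proof
  assume empty: "cluster_points T x = {}"
  have "\<exists>U. openin T U \<and> y \<in> U \<and> eventually (\<lambda>n. x n \<notin> U) sequentially" if "y \<in> K" for y
  proof -
    have "y \<in> topspace T" using compactin_subset_topspace[OF assms(1)] that by blast
    then show ?thesis
      using empty unfolding cluster_points_def frequently_def by blast
  qed
  then obtain U where U: "\<And>y. y \<in> K \<Longrightarrow> openin T (U y) \<and> y \<in> U y \<and> eventually (\<lambda>n. x n \<notin> U y) sequentially"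
    by metis
  obtain \<F> where \<F>: "finite \<F>" "\<F> \<subseteq> U ` K" "K \<subseteq> \<Union>\<F>"
    using compactinD[OF assms(1), of "U ` K"] U by blast
  have "eventually (\<lambda>n. \<forall>V\<in>\<F>. x n \<notin> V) sequentially"
  proof (rule eventually_ball_finite[OF \<F>(1)], rule ballI)
    fix V assume "V \<in> \<F>"
    with \<F>(2) have "V \<in> U ` K" by (rule subsetD)
    then obtain y where "V = U y" "y \<in> K" by (rule imageE)
    with U[of y] show "eventually (\<lambda>n. x n \<notin> V) sequentially" by simp
  qed
  then obtain n where "\<forall>V\<in>\<F>. x n \<notin> V"
    by (rule eventually_happens'[OF sequentially_bot, THEN exE])
  with \<F>(3) assms(2) show False by blast
qed

lemma cluster_points_subset_closure_of:
  assumes "range x \<subseteq> S"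
  shows "cluster_points T x \<subseteq> T closure_of S"
proof
  fix y assume y: "y \<in> cluster_points T x"
  have "\<exists>z\<in>S. z \<in> U" if "y \<in> U" "openin T U" for U
  proof -
    have "\<exists>\<^sub>F n in sequentially. x n \<in> U"
      using y that by (auto simp: cluster_points_def)
    then show ?thesis using assms frequently_ex by blast
  qed
  with y show "y \<in> T closure_of S"
    by (auto simp: in_closure_of cluster_points_def)
qed

lemma in_closure_of_openE:
  assumes "x \<in> T closure_of S" "openin T U" "x \<in> U"
  obtains y where "y \<in> S" "y \<in> U"
  using assms unfolding in_closure_of by blast

lemma openin_bidual_weak_star:
  "f \<in> cdual X N \<Longrightarrow> open U \<Longrightarrow> openin (bidual_weak_star X N) {F\<in>bidual X N. F f \<in> U}"
  unfolding bidual_weak_star_def bidual_def by (rule openin_weak_star_topology)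

text \<open>Norm balls of the bidual are weak* closed: a functional \<open>f\<close> of norm at most
  1 with \<open>cmod (F f) > B\<close> would give a weak* neighbourhood of \<open>F\<close> that
  misses the embedded \<open>A\<close>.\<close>

lemma bidual_closure_norm_le:
  assumes X: "seminorm_on X N" and A: "A \<subseteq> X" "\<And>a. a \<in> A \<Longrightarrow> N a \<le> B"
    and F: "F \<in> bidual_weak_star X N closure_of (canonical_embedding X N ` A)"
  shows "F \<in> bidual X N" "bidual_norm X N F \<le> B"
proof -
  show bd: "F \<in> bidual X N"
    using subsetD[OF closure_of_subset_topspace F] topspace_bidual_weak_star[OF X] by simp
  show "bidual_norm X N F \<le> B"
    unfolding bidual_norm_def
  proof (rule dual_norm_least[OF seminorm_on_dual[OF X]], rule ccontr)
    fix f assume f: "f \<in> cdual X N" "dual_norm X N f \<le> 1" and "\<not> cmod (F f) \<le> B"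
    then have "F \<in> {F\<in>bidual X N. F f \<in> - cball 0 B}" using bd by simp
    moreover have "openin (bidual_weak_star X N) {F\<in>bidual X N. F f \<in> - cball 0 B}"
      by (rule openin_bidual_weak_star[OF f(1)]) (simp add: open_Compl)
    ultimately obtain G where "G \<in> canonical_embedding X N ` A" "G \<in> {F\<in>bidual X N. F f \<in> - cball 0 B}"
      by (elim in_closure_of_openE[OF F])
    then obtain a where a: "a \<in> A" "cmod (canonical_embedding X N a f) > B"
      by auto
    moreover have "cmod (f a) \<le> N a"
    proof -
      have aX: "a \<in> X" using a(1) A(1) by blast
      have "cmod (f a) \<le> dual_norm X N f * N a" by (rule dual_norm_bound[OF X f(1) aX])
      also have "\<dots> \<le> N a"
        using mult_right_mono[OF f(2) seminorm_on_nonneg[OF X aX]] by simp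
      finally show ?thesis .
    qed
    ultimately show False using A(2)[of a] f(1) by (simp add: canonical_embedding_def)
  qed
qed

lemma bidual_dist_nonneg:
  assumes "seminorm_on X N" "F \<in> bidual X N" "x \<in> X"
  shows "0 \<le> bidual_norm X N (F - canonical_embedding X N x)"
  using seminorm_on_nonneg[OF seminorm_on_bidual[OF assms(1)]]
    complex_vector.subspace_diff[OF seminorm_on_subspace[OF seminorm_on_bidual[OF assms(1)]] assms(2)
      canonical_embedding_bidual(1)[OF assms(1,3)]] by simp

lemma bidual_dist_bdd_below:
  assumes "seminorm_on X N" "F \<in> bidual X N"
  shows "bdd_below ((\<lambda>y. bidual_norm X N (F - y)) ` canonical_embedding X N ` X)"
  using bidual_dist_nonneg[OF assms] by (intro bdd_belowI2[where m = 0]) auto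

lemma norm_setdist_le:
  assumes X: "seminorm_on X N" and S: "S \<subseteq> bidual X N" "F \<in> S"
  shows "norm_setdist (bidual_norm X N) S (canonical_embedding X N ` X)
    \<le> (INF y\<in>canonical_embedding X N ` X. bidual_norm X N (F - y))"
proof (rule cINF_greatest)
  show "canonical_embedding X N ` X \<noteq> {}"
    using complex_vector.subspace_0[OF seminorm_on_subspace[OF X]] by blast
next
  fix y assume y: "y \<in> canonical_embedding X N ` X"
  have "bdd_below ((\<lambda>(s, t). bidual_norm X N (s - t)) ` (S \<times> canonical_embedding X N ` X))"
    using bidual_dist_nonneg[OF X] S by (intro bdd_belowI2[where m = 0]) auto
  from cINF_lower[OF this, of "(F, y)"] y S(2)
  show "norm_setdist (bidual_norm X N) S (canonical_embedding X N ` X) \<le> bidual_norm X N (F - y)"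
    unfolding norm_setdist_def by simp
qed

text \<open>The supremum defining \<open>wk_measure\<close> bounds its terms because it is finite:
  every point of the closure has distance at most \<open>B\<close> from the embedded 0.\<close>

lemma wk_measure_upper:
  assumes X: "seminorm_on X N" and A: "A \<subseteq> X" "\<And>a. a \<in> A \<Longrightarrow> N a \<le> B"
    and F: "F \<in> bidual_weak_star X N closure_of (canonical_embedding X N ` A)"
  shows "(INF y\<in>canonical_embedding X N ` X. bidual_norm X N (F - y)) \<le> wk_measure X N A"
  unfolding wk_measure_def dhat_def
proof (rule cSUP_upper[OF F], rule bdd_aboveI2[where M = B])
  fix G assume G: "G \<in> bidual_weak_star X N closure_of canonical_embedding X N ` A"
  note bd = bidual_closure_norm_le[OF X A this]
  have zero: "(0 :: 'a) \<in> X"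
    using complex_vector.subspace_0[OF seminorm_on_subspace[OF X]] .
  have emb0: "canonical_embedding X N 0 = 0"
    by (auto simp: canonical_embedding_def fun_eq_iff cdual_zero)
  have "(INF y\<in>canonical_embedding X N ` X. bidual_norm X N (G - y))
      \<le> bidual_norm X N (G - canonical_embedding X N 0)"
    using zero by (intro cINF_lower bidual_dist_bdd_below[OF X bd(1)]) auto
  also have "\<dots> \<le> B" using bd(2) by (simp add: emb0)
  finally show "(INF y\<in>canonical_embedding X N ` X. bidual_norm X N (G - y)) \<le> B" .
qed

text \<open>This keeps \<open>norm_setdist\<close> in the definition of \<open>wck_measure\<close>
  from being an infimum over the empty set.\<close>

lemma cluster_points_bounded_nonempty:
  assumes X: "seminorm_on X N" and A: "A \<subseteq> X" "\<And>a. a \<in> A \<Longrightarrow> N a \<le> B"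
    and x: "range x \<subseteq> A"
  shows "cluster_points (bidual_weak_star X N) (\<lambda>n. canonical_embedding X N (x n)) \<noteq> {}"
proof (rule cluster_points_nonempty[OF compactin_bidual_ball[OF X, of B]])
  have mem: "x n \<in> X" "N (x n) \<le> B" for n
    using x A by (auto simp: range_subsetD)
  show "0 \<le> B"
    using seminorm_on_nonneg[OF X mem(1)[of 0]] mem(2)[of 0] by linarith
  show "range (\<lambda>n. canonical_embedding X N (x n)) \<subseteq> {F \<in> bidual X N. bidual_norm X N F \<le> B}"
    using canonical_embedding_bidual[OF X mem(1)] order_trans[OF canonical_embedding_bidual(2)[OF X mem(1)] mem(2)]
    by blast
qed

text \<open>The distance of a set from \<open>X\<close> is at most that of any one of its points,
  and a cluster point of a sequence in \<open>A\<close> lies in the weak* closure of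
  \<open>A\<close>.\<close>

lemma norm_setdist_cluster_points_le_wk:
  assumes X: "seminorm_on X N" and A: "A \<subseteq> X" "\<And>a. a \<in> A \<Longrightarrow> N a \<le> B"
    and x: "range x \<subseteq> A"
  shows "norm_setdist (bidual_norm X N)
      (cluster_points (bidual_weak_star X N) (\<lambda>n. canonical_embedding X N (x n)))
      (canonical_embedding X N ` X) \<le> wk_measure X N A" (is "norm_setdist _ ?S _ \<le> _")
proof -
  obtain F where F: "F \<in> ?S"
    using cluster_points_bounded_nonempty[OF X A x] by blast
  have sub: "?S \<subseteq> bidual_weak_star X N closure_of (canonical_embedding X N ` A)"
    by (rule cluster_points_subset_closure_of) (use x in auto)
  have "?S \<subseteq> bidual X N"
    using bidual_closure_norm_le(1)[OF X A] sub by (intro subsetI) (drule subsetD, assumption)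
  from norm_setdist_le[OF X this F] wk_measure_upper[OF X A subsetD[OF sub F]]
  show ?thesis by (rule order_trans)
qed

lemma wck_le_wk:
  assumes X: "seminorm_on X N" and A: "A \<subseteq> X" "A \<noteq> {}" "\<And>a. a \<in> A \<Longrightarrow> N a \<le> B"
  shows "wck_measure X N A \<le> wk_measure X N A"
  unfolding wck_measure_def
proof (rule cSUP_least)
  obtain a where "a \<in> A" using A(2) by blast
  then have "(\<lambda>_::nat. a) \<in> {x. range x \<subseteq> A}" by auto
  then show "{x :: nat \<Rightarrow> 'a. range x \<subseteq> A} \<noteq> {}" by blast
qed (rule norm_setdist_cluster_points_le_wk[OF X A(1,3)], simp_all)

lemma wck_measure_upper:
  assumes X: "seminorm_on X N" and A: "A \<subseteq> X" "\<And>a. a \<in> A \<Longrightarrow> N a \<le> B"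
    and x: "range x \<subseteq> A"
  shows "norm_setdist (bidual_norm X N)
      (cluster_points (bidual_weak_star X N) (\<lambda>n. canonical_embedding X N (x n)))
      (canonical_embedding X N ` X) \<le> wck_measure X N A"
  unfolding wck_measure_def
proof (rule cSUP_upper)
  show "bdd_above ((\<lambda>x. norm_setdist (bidual_norm X N)
      (cluster_points (bidual_weak_star X N) (\<lambda>n. canonical_embedding X N (x n)))
      (canonical_embedding X N ` X)) ` {x. range x \<subseteq> A})"
    by (rule bdd_aboveI2, rule norm_setdist_cluster_points_le_wk[OF X A]) simp_all
qed (use x in simp)

lemma dhat_bounded:
  assumes X: "seminorm_on X N" and A: "A \<subseteq> X" "\<And>a. a \<in> A \<Longrightarrow> N a \<le> B"
    and K: "K \<subseteq> X" "k \<in> K"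
  shows "bdd_above ((\<lambda>a. INF b\<in>K. N (a - b)) ` A)"
    and "a \<in> A \<Longrightarrow> bdd_below ((\<lambda>b. N (a - b)) ` K)"
    and "a \<in> A \<Longrightarrow> (INF b\<in>K. N (a - b)) \<le> dhat N A K"
proof -
  have nonneg: "0 \<le> N (a - b)" if "a \<in> A" "b \<in> K" for a b
  proof -
    have "a \<in> X" "b \<in> X" using that A(1) K(1) by auto
    then show ?thesis
      by (intro seminorm_on_nonneg[OF X] complex_vector.subspace_diff[OF seminorm_on_subspace[OF X]])
  qed
  show below: "bdd_below ((\<lambda>b. N (a - b)) ` K)" if "a \<in> A" for a
    using nonneg[OF that] by (intro bdd_belowI2)
  have "(INF b\<in>K. N (a - b)) \<le> B + N k" if "a \<in> A" for a
  proof -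
    have "(INF b\<in>K. N (a - b)) \<le> N (a - k)"
      by (rule cINF_lower[OF below[OF that] K(2)])
    also have "\<dots> \<le> N a + N k"
      using that A(1) K by (intro seminorm_on_diff[OF X]) auto
    finally show ?thesis using A(2)[OF that] by simp
  qed
  then show bdd: "bdd_above ((\<lambda>a. INF b\<in>K. N (a - b)) ` A)"
    by (intro bdd_aboveI2)
  show "(INF b\<in>K. N (a - b)) \<le> dhat N A K" if "a \<in> A"
    unfolding dhat_def by (rule cSUP_upper[OF that bdd])
qed

text \<open>For finitely many functionals, weak* closure gives \<open>a \<in> A\<close> close to
  \<open>F\<close> on all of them, and then some \<open>k \<in> K\<close> is close to
  \<open>a\<close> in norm. The conditions that this puts on \<open>k\<close> are weakly closed, so
  compactness of \<open>K\<close> yields one \<open>k\<close> that serves the whole dual unit ball,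
  which is a norm estimate for \<open>F\<close> minus the embedded \<open>k\<close>.\<close>

lemma closure_dist_le_dhat:
  assumes X: "seminorm_on X N" and A: "A \<subseteq> X" "\<And>a. a \<in> A \<Longrightarrow> N a \<le> B"
    and K: "compactin (weak_topology X N) K" "K \<noteq> {}"
    and F: "F \<in> bidual_weak_star X N closure_of (canonical_embedding X N ` A)"
  shows "(INF y\<in>canonical_embedding X N ` X. bidual_norm X N (F - y)) \<le> dhat N A K"
proof (rule field_le_epsilon)
  fix e :: real assume e: "e > 0"
  let ?d = "dhat N A K"
  let ?C = "\<lambda>f. {k\<in>X. F f - f k \<in> cball 0 (?d + e)}"
  let ?\<Phi> = "{f\<in>cdual X N. dual_norm X N f \<le> 1}"
  have KX: "K \<subseteq> X"
    using compactin_subset_topspace[OF K(1)] by (simp add: topspace_weak_topology)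
  obtain k0 where k0: "k0 \<in> K" using K(2) by blast
  note Fbd = bidual_closure_norm_le[OF X A F]
  have "closedin (weak_topology X N) {k \<in> topspace (weak_topology X N). F f - f k \<in> cball 0 (?d + e)}"
    if "f \<in> ?\<Phi>" for f
  proof (rule closedin_continuous_map_preimage[of _ euclidean])
    show "continuous_map (weak_topology X N) euclidean (\<lambda>k. F f - f k)"
      by (intro continuous_intros continuous_map_weak_topology_functional) (use that in auto)
  qed auto
  then have closed: "closedin (weak_topology X N) (?C f)" if "f \<in> ?\<Phi>" for f
    using that by (simp add: topspace_weak_topology)
  have fin: "K \<inter> \<Inter>\<F> \<noteq> {}" if \<F>: "finite \<F>" "\<F> \<subseteq> ?C ` ?\<Phi>" for \<F>
  proof -
    obtain \<Psi> where \<Psi>: "finite \<Psi>" "\<Psi> \<subseteq> ?\<Phi>" "\<F> = ?C ` \<Psi>"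
      using finite_subset_image[OF \<F>] by blast
    \<comment> \<open>Half of \<open>e\<close> is spent on approximating \<open>F\<close> by
      \<open>a\<close>, the other half on a nearly optimal \<open>k\<close> for this
      \<open>a\<close>.\<close>
    let ?U = "(\<Inter>f\<in>\<Psi>. {G\<in>bidual X N. G f \<in> ball (F f) (e/2)}) \<inter> topspace (bidual_weak_star X N)"
    have "openin (bidual_weak_star X N) ?U"
      by (rule openin_INT[OF \<Psi>(1)], rule openin_bidual_weak_star) (use \<Psi> in auto)
    moreover have "F \<in> ?U"
      using Fbd e topspace_bidual_weak_star[OF X] by auto
    ultimately obtain G where "G \<in> canonical_embedding X N ` A" "G \<in> ?U"
      by (elim in_closure_of_openE[OF F])
    then obtain a where a: "a \<in> A" "\<And>f. f \<in> \<Psi> \<Longrightarrow> canonical_embedding X N a f \<in> ball (F f) (e/2)"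
      by blast
    have "(INF b\<in>K. N (a - b)) < ?d + e/2"
      using dhat_bounded(3)[OF X A KX k0 a(1)] e by linarith
    then obtain k where k: "k \<in> K" "N (a - k) < ?d + e/2"
      using cINF_less_iff[OF K(2) dhat_bounded(2)[OF X A KX k0 a(1)]] by blast
    have "k \<in> ?C f" if f: "f \<in> \<Psi>" for f
    proof -
      have f': "f \<in> cdual X N" "dual_norm X N f \<le> 1" using f \<Psi>(2) by auto
      have ak: "a \<in> X" "k \<in> X" using a(1) A(1) k(1) KX by auto
      then have diff: "a - k \<in> X"
        by (rule complex_vector.subspace_diff[OF seminorm_on_subspace[OF X]])
      have "cmod (f a - f k) \<le> N (a - k)"
        using dual_norm_bound[OF X f'(1) diff] mult_right_mono[OF f'(2) seminorm_on_nonneg[OF X diff]]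
          cdual_diff[OF f'(1) seminorm_on_subspace[OF X] ak] by simp
      moreover have "cmod (F f - f a) < e/2"
        using a(2)[OF f] f'(1) by (simp add: canonical_embedding_def dist_norm)
      ultimately have "cmod (F f - f k) \<le> ?d + e"
        using norm_triangle_ineq[of "F f - f a" "f a - f k"] k(2) by simp
      then show ?thesis using ak by simp
    qed
    then have "k \<in> \<Inter>\<F>" unfolding \<Psi>(3) by (rule INT_I)
    with k(1) have "k \<in> K \<inter> \<Inter>\<F>" by (rule IntI)
    then show ?thesis unfolding ex_in_conv[symmetric] by (rule exI)
  qed
  have "K \<inter> \<Inter>(?C ` ?\<Phi>) \<noteq> {}"
  proof (rule compactin_fip[THEN iffD1, OF K(1), THEN conjunct2, rule_format], intro conjI ballI allI impI)
    show "closedin (weak_topology X N) C" if "C \<in> ?C ` ?\<Phi>" for C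
    proof -
      from that obtain f where f: "C = ?C f" "f \<in> ?\<Phi>" by (rule imageE)
      show ?thesis unfolding f(1) by (rule closed[OF f(2)])
    qed
    show "K \<inter> \<Inter>\<F> \<noteq> {}" if "finite \<F> \<and> \<F> \<subseteq> ?C ` ?\<Phi>" for \<F>
      using that by (elim conjE) (rule fin)
  qed
  then obtain k where "k \<in> K \<inter> \<Inter>(?C ` ?\<Phi>)"
    unfolding ex_in_conv[symmetric] by (rule exE)
  then have k1: "k \<in> K" "k \<in> \<Inter>(?C ` ?\<Phi>)"
    by (rule IntD1, rule IntD2)
  have k2: "cmod (F f - f k) \<le> ?d + e" if "f \<in> ?\<Phi>" for f
    using INT_D[OF k1(2) that] by simp
  have "(INF y\<in>canonical_embedding X N ` X. bidual_norm X N (F - y))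
      \<le> bidual_norm X N (F - canonical_embedding X N k)"
    using k1(1) KX by (intro cINF_lower bidual_dist_bdd_below[OF X Fbd(1)]) auto
  also have "\<dots> \<le> ?d + e"
    unfolding bidual_norm_def
  proof (rule dual_norm_least[OF seminorm_on_dual[OF X]])
    fix f assume "f \<in> cdual X N" "dual_norm X N f \<le> 1"
    then show "cmod ((F - canonical_embedding X N k) f) \<le> ?d + e"
      using k2[of f] by (simp add: canonical_embedding_def)
  qed
  finally show "(INF y\<in>canonical_embedding X N ` X. bidual_norm X N (F - y)) \<le> ?d + e" .
qed

lemma wk_le_omega:
  assumes X: "seminorm_on X N" and A: "A \<subseteq> X" "A \<noteq> {}" "\<And>a. a \<in> A \<Longrightarrow> N a \<le> B"
  shows "wk_measure X N A \<le> omega_measure X N A"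
  unfolding omega_measure_def
proof (rule cINF_greatest)
  \<comment> \<open>The family of competing compact sets must be nonempty for the infimum to be
    bounded from below termwise.\<close>
  have "compactin (weak_topology X N) {0}"
    using complex_vector.subspace_0[OF seminorm_on_subspace[OF X]]
    by (simp add: topspace_weak_topology)
  then show "{K. K \<noteq> {} \<and> compactin (weak_topology X N) K} \<noteq> {}" by blast
next
  fix K assume "K \<in> {K. K \<noteq> {} \<and> compactin (weak_topology X N) K}"
  then have K: "compactin (weak_topology X N) K" "K \<noteq> {}" by auto
  show "wk_measure X N A \<le> dhat N A K"
    unfolding wk_measure_def dhat_def[of "bidual_norm X N"]
  proof (rule cSUP_least)
    have "canonical_embedding X N ` A \<subseteq> topspace (bidual_weak_star X N)"
      using canonical_embedding_bidual(1)[OF X] A(1) by (auto simp: topspace_bidual_weak_star[OF X])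
    from closure_of_subset[OF this] A(2)
    show "bidual_weak_star X N closure_of canonical_embedding X N ` A \<noteq> {}" by blast
  qed (rule closure_dist_le_dhat[OF X A(1,3) K])
qed

lemma omega_le:
  assumes X: "seminorm_on X N" and A: "A \<subseteq> X" "A \<noteq> {}" "\<And>a. a \<in> A \<Longrightarrow> N a \<le> B"
    and K: "compactin (weak_topology X N) K" "\<And>a. a \<in> A \<Longrightarrow> \<exists>k\<in>K. N (a - k) \<le> d"
  shows "omega_measure X N A \<le> d"
proof -
  have KX: "K \<subseteq> X" if "compactin (weak_topology X N) K" for K
    using compactin_subset_topspace[OF that] by (simp add: topspace_weak_topology)
  obtain a where a: "a \<in> A" using A(2) by blast
  \<comment> \<open>All competing values are nonnegative, so the infimum really lies below the value
    at the given \<open>K\<close>.\<close>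
  have "0 \<le> dhat N A L" if L: "L \<noteq> {}" "compactin (weak_topology X N) L" for L
  proof -
    obtain l where l: "l \<in> L" using L(1) by blast
    have "0 \<le> (INF b\<in>L. N (a - b))"
    proof (rule cINF_greatest[OF L(1)])
      fix b assume "b \<in> L"
      then have "a \<in> X" "b \<in> X" using a A(1) KX[OF L(2)] by auto
      then show "0 \<le> N (a - b)"
        by (intro seminorm_on_nonneg[OF X] complex_vector.subspace_diff[OF seminorm_on_subspace[OF X]])
    qed
    also have "\<dots> \<le> dhat N A L"
      by (rule dhat_bounded(3)[OF X A(1,3) KX[OF L(2)] l a])
    finally show ?thesis .
  qed
  then have bdd: "bdd_below (dhat N A ` {K. K \<noteq> {} \<and> compactin (weak_topology X N) K})"
    by (intro bdd_belowI2[where m = 0]) auto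
  have Kne: "K \<noteq> {}" using K(2) a by blast
  then obtain k0 where k0: "k0 \<in> K" by blast
  have "omega_measure X N A \<le> dhat N A K"
    unfolding omega_measure_def by (rule cINF_lower[OF bdd]) (use Kne K(1) in blast)
  also have "\<dots> \<le> d"
    unfolding dhat_def
  proof (rule cSUP_least[OF A(2)])
    fix b assume b: "b \<in> A"
    then obtain k where k: "k \<in> K" "N (b - k) \<le> d" using K(2) by blast
    have "(INF c\<in>K. N (b - c)) \<le> N (b - k)"
      by (rule cINF_lower[OF dhat_bounded(2)[OF X A(1,3) KX[OF K(1)] k0 b] k(1)])
    with k(2) show "(INF c\<in>K. N (b - c)) \<le> d" by simp
  qed
  finally show ?thesis .
qed

section \<open>Hilbert spaces\<close>

lemma scaleR_eq_scaleC: "r *\<^sub>R x = complex_of_real r *\<^sub>C (x :: 'a::complex_normed_vector)"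
  by (simp add: scaleC_of_real)

lemma cinner_add_right: "cinner x (y + z) = cinner x y + cinner x (z::'h::complex_hilbert_space)"
  by (metis cinner_add_left cinner_commute complex_cnj_add)

lemma cinner_scaleC_right: "cinner x (c *\<^sub>C y) = cnj c * cinner x (y::'h::complex_hilbert_space)"
  by (metis cinner_scaleC_left cinner_commute complex_cnj_mult)

lemma cinner_minus_right: "cinner x (- y) = - cinner x (y::'h::complex_hilbert_space)"
  using cinner_scaleC_right[of x "-1" y] by (simp add: scaleC_minus_one)

lemma norm_add_squared:
  "(norm (x + y))\<^sup>2 = (norm x)\<^sup>2 + (norm y)\<^sup>2 + 2 * Re (cinner x (y::'h::complex_hilbert_space))"
proof -
  have "complex_of_real ((norm (x + y))\<^sup>2)
      = of_real ((norm x)\<^sup>2) + of_real ((norm y)\<^sup>2) + (cinner x y + cnj (cinner x y))"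
    unfolding cinner_self[symmetric]
    by (simp add: cinner_add_left cinner_add_right cinner_commute[of y x])
  also have "\<dots> = of_real ((norm x)\<^sup>2 + (norm y)\<^sup>2 + 2 * Re (cinner x y))"
    by (simp add: complex_add_cnj)
  finally show ?thesis using of_real_eq_iff by blast
qed

lemma norm_diff_squared:
  "(norm (x - y))\<^sup>2 = (norm x)\<^sup>2 + (norm y)\<^sup>2 - 2 * Re (cinner x (y::'h::complex_hilbert_space))"
  using norm_add_squared[of x "-y"] by (simp add: cinner_minus_right)

lemma parallelogram_law:
  "(norm (x + y))\<^sup>2 + (norm (x - y))\<^sup>2 = 2 * (norm x)\<^sup>2 + 2 * (norm (y::'h::complex_hilbert_space))\<^sup>2"
  by (simp add: norm_add_squared norm_diff_squared)

lemma cinner_Cauchy_Schwarz: "cmod (cinner x y) \<le> norm x * norm (y::'h::complex_hilbert_space)"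
proof (cases "norm y = 0")
  case True
  then have "y = 0 *\<^sub>C 0" by simp
  then have "cinner x y = 0" by (simp only: cinner_scaleC_right) simp
  then show ?thesis by simp
next
  case False
  then have pos: "(norm y)\<^sup>2 > 0" by simp
  \<comment> \<open>With this choice \<open>c *\<^sub>C y\<close> is the orthogonal projection of
    \<open>x\<close> onto the line of \<open>y\<close>; the inequality is the nonnegativity of the
    squared length of the remainder.\<close>
  define c where "c = cinner x y / of_real ((norm y)\<^sup>2)"
  have "cnj c * cinner x y = of_real ((cmod (cinner x y))\<^sup>2 / (norm y)\<^sup>2)"
    by (simp add: c_def complex_norm_square[symmetric] mult.commute[of "cnj _"] flip: of_real_power)
  then have re: "Re (cinner x (c *\<^sub>C y)) = (cmod (cinner x y))\<^sup>2 / (norm y)\<^sup>2"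
    by (simp add: cinner_scaleC_right)
  have nc: "(norm (c *\<^sub>C y))\<^sup>2 = (cmod (cinner x y))\<^sup>2 / (norm y)\<^sup>2"
    using pos unfolding c_def norm_scaleC norm_divide norm_of_real
    by (simp add: power_mult_distrib power_divide) (simp add: power2_eq_square power4_eq_xxxx)
  have "0 \<le> (norm (x - c *\<^sub>C y))\<^sup>2" by simp
  then have "(cmod (cinner x y))\<^sup>2 / (norm y)\<^sup>2 \<le> (norm x)\<^sup>2"
    unfolding norm_diff_squared re nc by simp
  then have "(cmod (cinner x y))\<^sup>2 \<le> (norm x * norm y)\<^sup>2"
    using pos by (simp add: divide_le_eq power_mult_distrib)
  then show ?thesis by (rule power2_le_imp_le) simp
qed

text \<open>Conjugate-linearity in the second argument is still real linearity, so the limit, sum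
  and difference rules for bounded bilinear maps become available for \<open>cinner\<close>.\<close>

interpretation cinner: bounded_bilinear "cinner :: 'h::complex_hilbert_space \<Rightarrow> 'h \<Rightarrow> complex"
proof
  show "\<exists>K. \<forall>a b::'h. cmod (cinner a b) \<le> norm a * norm b * K"
    by (rule exI[of _ 1]) (simp add: cinner_Cauchy_Schwarz)
qed (simp_all add: cinner_add_left cinner_add_right scaleR_eq_scaleC cinner_scaleC_left
    cinner_scaleC_right scaleR_conv_of_real scaleC_complex_def)

text \<open>The subspace \<open>Y\<close> need not be closed; the representing vector is the limit of a minimising
  sequence of \<open>\<parallel>y\<parallel>\<^sup>2 - 2 Re (g y)\<close> in \<open>Y\<close>.\<close>

theorem Riesz_representation:
  fixes Y :: "'h::complex_hilbert_space set"
  assumes Y: "complex_vector.subspace Y"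
    and add: "\<And>x y. x \<in> Y \<Longrightarrow> y \<in> Y \<Longrightarrow> g (x + y) = g x + g y"
    and scale: "\<And>c x. x \<in> Y \<Longrightarrow> g (c *\<^sub>C x) = c * g x"
    and bound: "\<And>x. x \<in> Y \<Longrightarrow> cmod (g x) \<le> R * norm x"
  obtains \<eta> where "norm \<eta> \<le> R \<or> \<eta> = 0" "\<And>x. x \<in> Y \<Longrightarrow> g x = cinner x \<eta>"
proof -
  define J where "J y = (norm y)\<^sup>2 - 2 * Re (g y)" for y
  have Yadd: "x + y \<in> Y" if "x \<in> Y" "y \<in> Y" for x y
    using complex_vector.subspace_add[OF Y that] .
  have Yscale: "c *\<^sub>C x \<in> Y" if "x \<in> Y" for c x
    using complex_vector.subspace_scale[OF Y that] .
  have Y0: "0 \<in> Y" using complex_vector.subspace_0[OF Y] .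
  have Jbound: "- R\<^sup>2 \<le> J y" if "y \<in> Y" for y
  proof -
    have "Re (g y) \<le> R * norm y"
      using bound[OF that] complex_Re_le_cmod order_trans by blast
    moreover have "0 \<le> (norm y - R)\<^sup>2" by simp
    ultimately show ?thesis unfolding J_def by (simp add: power2_diff algebra_simps)
  qed
  define m where "m = (INF y\<in>Y. J y)"
  have bdd: "bdd_below (J ` Y)" using Jbound by (intro bdd_belowI2)
  have m_le: "m \<le> J y" if "y \<in> Y" for y
    unfolding m_def by (rule cINF_lower[OF bdd that])
  have "\<exists>y\<in>Y. J y < m + inverse (real (Suc n))" for n
    using cINF_less_iff[OF _ bdd, of "m + inverse (real (Suc n))"] Y0 by (auto simp: m_def)
  then obtain y where y: "\<And>n. y n \<in> Y" "\<And>n. J (y n) < m + inverse (real (Suc n))" by metis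
  \<comment> \<open>The parallelogram law at the midpoint, where \<open>J\<close> is at least
    \<open>m\<close>, shows that almost minimal points are close to each other; hence the minimising
    sequence is Cauchy.\<close>
  have midpoint: "(norm (a - b))\<^sup>2 \<le> 2 * (J a - m) + 2 * (J b - m)" if ab: "a \<in> Y" "b \<in> Y" for a b
  proof -
    let ?c = "complex_of_real (1/2) *\<^sub>C (a + b)"
    have half: "Re (g ?c) = (Re (g a) + Re (g b)) / 2"
      unfolding scale[OF Yadd[OF ab]] add[OF ab] by simp
    have "m \<le> J ?c" by (rule m_le[OF Yscale[OF Yadd[OF ab]]])
    also have "J ?c = (norm (a + b))\<^sup>2 / 4 - (Re (g a) + Re (g b))"
      unfolding J_def half norm_scaleC norm_of_real by (simp add: power_mult_distrib power_divide)
        (simp add: field_simps)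
    finally show ?thesis using parallelogram_law[of a b] by (simp add: J_def)
  qed
  have lim0: "(\<lambda>n. inverse (real (Suc n))) \<longlonglongrightarrow> 0" by (rule LIMSEQ_inverse_real_of_nat)
  have "Cauchy y"
  proof (rule metric_CauchyI)
    fix e :: real assume e: "e > 0"
    then have "e\<^sup>2 / 4 > 0" by simp
    then obtain k where k: "inverse (real (Suc k)) < e\<^sup>2 / 4" using reals_Archimedean by blast
    have close: "J (y n) - m < e\<^sup>2 / 4" if "n \<ge> k" for n
    proof -
      have "inverse (real (Suc n)) \<le> inverse (real (Suc k))" using that by (intro le_imp_inverse_le) auto
      then show ?thesis using y(2)[of n] k by linarith
    qed
    have "dist (y i) (y j) < e" if "i \<ge> k" "j \<ge> k" for i j
    proof -
      have "4 * (e\<^sup>2 / 4) = e\<^sup>2" by simp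
      then have "(norm (y i - y j))\<^sup>2 < e\<^sup>2"
        using midpoint[OF y(1)[of i] y(1)[of j]] close[OF that(1)] close[OF that(2)]
        unfolding right_diff_distrib by argo
      then show ?thesis using e by (simp add: dist_norm power2_less_imp_less)
    qed
    then show "\<exists>k. \<forall>i\<ge>k. \<forall>j\<ge>k. dist (y i) (y j) < e" by blast
  qed
  then obtain \<eta> where \<eta>: "y \<longlonglongrightarrow> \<eta>" using Cauchy_convergent_iff convergent_def by blast
  have Jlim: "(\<lambda>n. J (y n)) \<longlonglongrightarrow> m"
  proof (rule tendsto_sandwich[of "\<lambda>_. m"])
    show "(\<lambda>n. m + inverse (real (Suc n))) \<longlonglongrightarrow> m"
      using tendsto_add[OF tendsto_const lim0, of m] by simp
  qed (intro always_eventually allI m_le[OF y(1)] less_imp_le[OF y(2)] tendsto_const)+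
  \<comment> \<open>First variation of \<open>J\<close> in direction \<open>z\<close>. The limit
    \<open>\<eta>\<close> may lie outside \<open>Y\<close>, so the variation is taken at
    \<open>y n\<close> and only then passed to the limit.\<close>
  have re: "Re (cinner z \<eta>) = Re (g z)" if z: "z \<in> Y" for z
  proof -
    let ?d = "Re (cinner \<eta> z) - Re (g z)"
    have ineq: "0 \<le> 2 * t * ?d + t\<^sup>2 * (norm z)\<^sup>2" for t :: real
    proof -
      have "m \<le> J (y n) + 2 * t * (Re (cinner (y n) z) - Re (g z)) + t\<^sup>2 * (norm z)\<^sup>2" for n
      proof -
        have "m \<le> J (y n + of_real t *\<^sub>C z)"
          by (rule m_le[OF Yadd[OF y(1) Yscale[OF z]]])
        also have "\<dots> = J (y n) + 2 * t * (Re (cinner (y n) z) - Re (g z)) + t\<^sup>2 * (norm z)\<^sup>2"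
          unfolding J_def norm_add_squared add[OF y(1) Yscale[OF z]] scale[OF z]
          by (simp add: cinner_scaleC_right norm_scaleC power_mult_distrib algebra_simps)
        finally show ?thesis .
      qed
      moreover have "(\<lambda>n. J (y n) + 2 * t * (Re (cinner (y n) z) - Re (g z)) + t\<^sup>2 * (norm z)\<^sup>2)
          \<longlonglongrightarrow> m + 2 * t * ?d + t\<^sup>2 * (norm z)\<^sup>2"
        by (intro tendsto_intros Jlim cinner.tendsto \<eta>)
      ultimately have "m \<le> m + 2 * t * ?d + t\<^sup>2 * (norm z)\<^sup>2"
        by (intro LIMSEQ_le_const) auto
      then show ?thesis by simp
    qed
    have "?d = 0"
    proof (rule ccontr)
      assume d: "?d \<noteq> 0"
      \<comment> \<open>The step \<open>- ?d / s\<close> makes the quadratic in \<open>t\<close>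
        negative if \<open>?d\<close> is nonzero; adding 1 keeps the denominator positive also for
        \<open>z = 0\<close>.\<close>
      define s where "s = (norm z)\<^sup>2 + 1"
      have s: "s > 0" "(norm z)\<^sup>2 < s" unfolding s_def by (simp_all add: add_nonneg_pos)
      have "0 \<le> 2 * (- ?d / s) * ?d + (- ?d / s)\<^sup>2 * (norm z)\<^sup>2" by (rule ineq)
      also have "\<dots> \<le> 2 * (- ?d / s) * ?d + (- ?d / s)\<^sup>2 * s"
        using s by (intro add_left_mono mult_left_mono) auto
      also have "\<dots> = - (?d\<^sup>2 / s)" using s by (simp add: power2_eq_square field_simps)
      also have "\<dots> < 0" using d s by simp
      finally show False by simp
    qed
    moreover have "Re (cinner z \<eta>) = Re (cinner \<eta> z)"
      by (subst cinner_commute) simp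
    ultimately show ?thesis by simp
  qed
  have rep: "g z = cinner z \<eta>" if z: "z \<in> Y" for z
  proof (rule complex_eqI)
    show "Re (g z) = Re (cinner z \<eta>)" using re[OF z] by simp
    \<comment> \<open>The identity of real parts at \<open>\<i> *\<^sub>C z\<close> is that of
      imaginary parts at \<open>z\<close>.\<close>
    show "Im (g z) = Im (cinner z \<eta>)"
      using re[OF Yscale[OF z, of \<i>]] by (simp add: cinner_scaleC_left scale[OF z])
  qed
  have "(\<lambda>n. cmod (cinner (y n) \<eta>)) \<longlonglongrightarrow> cmod (cinner \<eta> \<eta>)"
    by (intro tendsto_intros cinner.tendsto \<eta>)
  moreover have "(\<lambda>n. R * norm (y n)) \<longlonglongrightarrow> R * norm \<eta>"
    by (intro tendsto_intros \<eta>)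
  moreover have "cmod (cinner (y n) \<eta>) \<le> R * norm (y n)" for n
    using bound[OF y(1)] rep[OF y(1)] by metis
  ultimately have "cmod (cinner \<eta> \<eta>) \<le> R * norm \<eta>"
    by (intro LIMSEQ_le) auto
  then have "norm \<eta> \<le> R \<or> \<eta> = 0"
    unfolding cinner_self norm_of_real by (auto simp: power2_eq_square mult_le_cancel_right)
  then show thesis using rep by (rule that)
qed

lemma cinner_in_cdual: "(\<lambda>x. cinner x \<eta>) \<in> cdual (UNIV :: 'h::complex_hilbert_space set) norm"
  by (rule cdualI[where B = "norm \<eta>"])
    (use cinner_Cauchy_Schwarz in \<open>auto simp: cinner_add_left cinner_scaleC_left mult.commute\<close>)

text \<open>The inverse \<open>V\<close> of the Riesz correspondence is continuous from the weak*
  topology of the dual to the weak topology of \<open>H\<close>, and it maps the compact dual ball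
  onto \<open>cball 0 R\<close>.\<close>

lemma compactin_weak_hilbert_ball:
  assumes "R \<ge> 0"
  shows "compactin (weak_topology (UNIV :: 'h::complex_hilbert_space set) norm) (cball 0 R)"
proof -
  let ?H = "UNIV :: 'h set"
  have H: "complex_vector.subspace ?H"
    by (simp add: complex_vector.subspace_def)
  note HN = seminorm_on_norm[OF H]
  let ?T = "weak_star_topology ?H norm"
  let ?K = "{f\<in>cdual ?H norm. \<forall>x\<in>?H. cmod (f x) \<le> R * norm x}"
  have rep: "\<exists>\<eta>. (norm \<eta> \<le> r \<or> \<eta> = 0) \<and> f = (\<lambda>x. cinner x \<eta>)"
    if f: "f \<in> cdual ?H norm" "\<And>x. cmod (f x) \<le> r * norm x" for f r
    by (rule Riesz_representation[OF H, of f r])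
      (use f cdual_add[OF f(1)] cdual_scale[OF f(1)] in auto)
  then have rep': "\<exists>\<eta>. f = (\<lambda>x. cinner x \<eta>)" if "f \<in> cdual ?H norm" for f
    using that cdual_bounded[OF HN that] by (metis UNIV_I)
  have uniq: "\<eta> = \<eta>'" if "(\<lambda>x. cinner x \<eta>) = (\<lambda>x. cinner x \<eta>')" for \<eta> \<eta>' :: 'h
  proof -
    have "cinner (\<eta> - \<eta>') (\<eta> - \<eta>') = 0"
      using fun_cong[OF that, of "\<eta> - \<eta>'"] by (simp add: cinner.diff_right)
    then show ?thesis by (simp add: cinner_self)
  qed
  define V where "V f = (THE \<eta>. f = (\<lambda>x. cinner x \<eta>))" for f :: "'h \<Rightarrow> complex"
  have V_cinner: "V (\<lambda>x. cinner x \<eta>) = \<eta>" for \<eta>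
    unfolding V_def by (rule the_equality) (auto dest: uniq)
  have V: "f x = cinner x (V f)" if "f \<in> cdual ?H norm" for f x
    using rep'[OF that] V_cinner by metis
  have top: "topspace ?T = cdual ?H norm" by (rule topspace_weak_star_topology) simp
  have "continuous_map ?T (weak_topology ?H norm) V"
  proof (rule continuous_map_weak_topologyI)
    fix f :: "'h \<Rightarrow> complex" assume "f \<in> cdual ?H norm"
    then obtain \<zeta> where \<zeta>: "f = (\<lambda>x. cinner x \<zeta>)" using rep' by blast
    \<comment> \<open>If \<open>\<zeta>\<close> represents \<open>f\<close>, then
      \<open>f (V g) = cnj (g \<zeta>)\<close>, so continuity of \<open>V\<close> reduces to
      evaluation at one vector.\<close>
    have "continuous_map ?T euclidean (\<lambda>g. cnj (g \<zeta>))"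
      unfolding continuous_map_def
    proof (intro conjI allI impI)
      fix U :: "complex set" assume "openin euclidean U"
      then have "open (cnj -` U)"
        by (intro open_vimage continuous_intros) auto
      from openin_weak_star_topology[OF _ this, of \<zeta> ?H norm]
      show "openin ?T {g \<in> topspace ?T. cnj (g \<zeta>) \<in> U}" by (simp add: top)
    qed auto
    then show "continuous_map ?T euclidean (\<lambda>g. f (V g))"
    proof (rule continuous_map_eq)
      fix g assume "g \<in> topspace ?T"
      then have "g \<zeta> = cinner \<zeta> (V g)" using V top by blast
      then show "cnj (g \<zeta>) = f (V g)" using cinner_commute[of "V g" \<zeta>] \<zeta> by simp
    qed
  qed simp
  from image_compactin[OF compactin_dual_ball[OF HN] this]
  have "compactin (weak_topology ?H norm) (V ` ?K)" .
  moreover have "V ` ?K = cball 0 R"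
  proof (intro equalityI subsetI)
    fix \<eta> assume "\<eta> \<in> V ` ?K"
    then obtain f where f: "f \<in> ?K" "\<eta> = V f" by blast
    then obtain \<eta>' where \<eta>': "norm \<eta>' \<le> R \<or> \<eta>' = 0" "f = (\<lambda>x. cinner x \<eta>')" using rep[of f R] by auto
    with f(2) have "\<eta> = \<eta>'" by (simp add: V_cinner)
    with \<eta>' assms show "\<eta> \<in> cball 0 R" by auto
  next
    fix \<eta> :: 'h assume "\<eta> \<in> cball 0 R"
    then have "cmod (cinner x \<eta>) \<le> R * norm x" for x
      using cinner_Cauchy_Schwarz[of x \<eta>] mult_left_mono[of "norm \<eta>" R "norm x"]
      by (simp add: mult.commute)
    then have "(\<lambda>x. cinner x \<eta>) \<in> ?K" using cinner_in_cdual by blast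
    then show "\<eta> \<in> V ` ?K" by (rule rev_image_eqI) (simp add: V_cinner)
  qed
  ultimately show ?thesis by simp
qed

lemma continuous_map_cnj:
  "continuous_map T euclidean g \<Longrightarrow> continuous_map T euclidean (\<lambda>x. cnj (g x))"
  by (simp add: continuous_map_atin tendsto_cnj)

text \<open>The disjunction admits linear and conjugate-linear parametrisations alike; the vector
  functionals occur below in both ways, according to which of the two vectors varies.\<close>

lemma compactin_weak_topology_image:
  fixes W :: "'h::complex_hilbert_space \<Rightarrow> 'a::complex_vector"
  assumes "R \<ge> 0" "\<And>\<eta>. W \<eta> \<in> X"
    and "\<And>f. f \<in> cdual X N \<Longrightarrow> (\<lambda>\<eta>. f (W \<eta>)) \<in> cdual UNIV norm \<or> (\<lambda>\<eta>. cnj (f (W \<eta>))) \<in> cdual UNIV norm"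
  shows "compactin (weak_topology X N) (W ` cball 0 R)"
proof (rule image_compactin[OF compactin_weak_hilbert_ball[OF assms(1)]],
    rule continuous_map_weak_topologyI)
  fix f assume "f \<in> cdual X N"
  from assms(3)[OF this] show "continuous_map (weak_topology UNIV norm) euclidean (\<lambda>\<eta>. f (W \<eta>))"
  proof
    assume "(\<lambda>\<eta>. cnj (f (W \<eta>))) \<in> cdual UNIV norm"
    then have "continuous_map (weak_topology UNIV norm) euclidean (\<lambda>\<eta>. cnj (f (W \<eta>)))"
      by (rule continuous_map_weak_topology_functional)
    then have "continuous_map (weak_topology UNIV norm) euclidean (\<lambda>\<eta>. cnj (cnj (f (W \<eta>))))"
      by (rule continuous_map_cnj)
    then show ?thesis by simp
  qed (rule continuous_map_weak_topology_functional)
qed (use assms(2) in simp)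

text \<open>The set is the image of a compact product under addition, which is weakly continuous
  because \<open>f (k + l) = f k + f l\<close>.\<close>

lemma compactin_weak_topology_plus:
  assumes X: "complex_vector.subspace X"
    and K: "compactin (weak_topology X N) K" "compactin (weak_topology X N) L"
  shows "compactin (weak_topology X N) ((\<lambda>(k, l). k + l) ` (K \<times> L))"
proof (rule image_compactin)
  let ?W = "weak_topology X N"
  show "compactin (prod_topology ?W ?W) (K \<times> L)"
    using K by (simp add: compactin_Times)
  show "continuous_map (prod_topology ?W ?W) ?W (\<lambda>(k, l). k + l)"
  proof (rule continuous_map_weak_topologyI)
    fix t assume "t \<in> topspace (prod_topology ?W ?W)"
    then show "(case t of (k, l) \<Rightarrow> k + l) \<in> X"
      using complex_vector.subspace_add[OF X] by (auto simp: topspace_weak_topology)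
  next
    fix f assume f: "f \<in> cdual X N"
    have "continuous_map (prod_topology ?W ?W) euclidean (\<lambda>t. f (fst t) + f (snd t))"
      by (intro continuous_map_add continuous_map_compose[OF continuous_map_fst, unfolded o_def]
          continuous_map_compose[OF continuous_map_snd, unfolded o_def]
          continuous_map_weak_topology_functional f)
    then show "continuous_map (prod_topology ?W ?W) euclidean (\<lambda>t. f (case t of (k, l) \<Rightarrow> k + l))"
      by (rule continuous_map_eq) (auto simp: topspace_weak_topology cdual_add[OF f])
  qed
qed

section \<open>Operators and the predual\<close>

lemma blinfun_scaleC_apply [simp]: "blinfun_apply (c *\<^sub>C a) x = c *\<^sub>C blinfun_apply a x"
  by (simp add: scaleC_blinfun.rep_eq)

lemma bounded_linear_scaleC: "bounded_linear (\<lambda>x::'a::complex_normed_vector. c *\<^sub>C x)"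
  by (rule bounded_linear_intro[where K = "cmod c"])
    (simp_all add: scaleC_add_right scaleR_eq_scaleC scaleC_scaleC mult.commute norm_scaleC)

lemmas tendsto_scaleC [tendsto_intros] = bounded_linear.tendsto[OF bounded_linear_scaleC]

lemma norm_scaleC_blinfun:
  "norm (c *\<^sub>C a) = cmod c * norm (a :: 'a::real_normed_vector \<Rightarrow>\<^sub>L 'b::complex_normed_vector)"
proof (cases "c = 0")
  case False
  have le: "norm (c *\<^sub>C a) \<le> cmod c * norm a" for c and a :: "'a \<Rightarrow>\<^sub>L 'b"
    by (rule norm_blinfun_bound)
      (use norm_blinfun[of a] in \<open>auto simp: norm_scaleC mult.assoc intro!: mult_left_mono\<close>)
  have "norm (inverse c *\<^sub>C c *\<^sub>C a) \<le> cmod (inverse c) * norm (c *\<^sub>C a)" by (rule le)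
  then have "cmod c * norm a \<le> norm (c *\<^sub>C a)"
    using False by (simp add: norm_divide field_simps)
  with le[of c a] show ?thesis by simp
qed simp

lemma seminorm_on_operator_norm:
  "complex_vector.subspace M \<Longrightarrow>
    seminorm_on M (norm :: ('a::real_normed_vector \<Rightarrow>\<^sub>L 'b::complex_normed_vector) \<Rightarrow> real)"
  by (simp add: seminorm_on_def norm_triangle_ineq norm_scaleC_blinfun)

definition is_projection :: "('h::complex_hilbert_space \<Rightarrow>\<^sub>L 'h) \<Rightarrow> bool" where
  "is_projection p \<longleftrightarrow> is_adjoint p p \<and> p o\<^sub>L p = p"

lemma
  assumes "is_projection p"
  shows is_projection_cinner: "cinner (p x) y = cinner x (p y)"
    and is_projection_idem: "p (p x) = p x"
    and is_projection_norm_squared: "cinner (p x) x = of_real ((norm (p x))\<^sup>2)"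
    and is_projection_norm_le: "norm (p x) \<le> norm x"
proof -
  show adj: "cinner (p x) y = cinner x (p y)" for x y
    using assms by (simp add: is_projection_def is_adjoint_def)
  show idem: "p (p x) = p x" for x
    using assms by (metis is_projection_def blinfun_apply_blinfun_compose)
  show sq: "cinner (p x) x = of_real ((norm (p x))\<^sup>2)" for x
    using adj[of x "p x"] adj[of "p x" x] idem cinner_self[of "p x"] by simp
  have "(norm (p x))\<^sup>2 \<le> norm (p x) * norm x"
    using cinner_Cauchy_Schwarz[of "p x" x] unfolding sq norm_of_real by simp
  then show "norm (p x) \<le> norm x"
    by (cases "norm (p x) = 0") (auto simp: power2_eq_square)
qed

lemma is_projection_operator_norm: "is_projection p \<Longrightarrow> norm p \<le> 1"
  by (rule norm_blinfun_bound) (simp_all add: is_projection_norm_le)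

lemma is_projection_id_minus: "is_projection p \<Longrightarrow> is_projection (id_blinfun - p)"
  unfolding is_projection_def is_adjoint_def
  by (auto intro!: blinfun_eqI simp: blinfun.diff_left blinfun.diff_right cinner.diff_left
      cinner.diff_right dest: arg_cong[where f = "\<lambda>a. blinfun_apply a _"])

lemma is_projection_sum:
  assumes "finite C" "\<And>i. i \<in> C \<Longrightarrow> is_projection (p i)"
    and "\<And>i j. i \<in> C \<Longrightarrow> j \<in> C \<Longrightarrow> i \<noteq> j \<Longrightarrow> p i o\<^sub>L p j = 0"
  shows "is_projection (\<Sum>i\<in>C. p i)"
proof -
  have orth: "p i (p j x) = (if i = j then p i x else 0)" if "i \<in> C" "j \<in> C" for i j x
    using that assms(2)[of i] assms(3)[of i j] is_projection_idem
    by (cases "i = j") (auto dest: arg_cong[where f = "\<lambda>a. blinfun_apply a x"])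
  have "is_adjoint (\<Sum>i\<in>C. p i) (\<Sum>i\<in>C. p i)"
    using assms(2) by (simp add: is_adjoint_def blinfun.sum_left cinner.sum_left cinner.sum_right
        is_projection_cinner)
  moreover have "(\<Sum>i\<in>C. p i) ((\<Sum>i\<in>C. p i) x) = (\<Sum>i\<in>C. p i) x" for x
    using assms(1) by (simp add: blinfun.sum_left blinfun.sum_right orth)
  ultimately show ?thesis
    by (auto simp: is_projection_def intro!: blinfun_eqI)
qed

lemma is_adjoint_norm_le:
  assumes "is_adjoint a b"
  shows "norm b \<le> norm a"
proof (rule norm_blinfun_bound)
  fix y
  have "(norm (b y))\<^sup>2 = cmod (cinner (b y) (b y))"
    by (simp only: cinner_self norm_of_real) simp
  also have "\<dots> = cmod (cinner (a (b y)) y)"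
    using assms by (simp add: is_adjoint_def)
  also have "\<dots> \<le> norm (a (b y)) * norm y" by (rule cinner_Cauchy_Schwarz)
  also have "\<dots> \<le> (norm a * norm (b y)) * norm y"
    by (intro mult_right_mono norm_blinfun) auto
  finally show "norm (b y) \<le> norm a * norm y"
    by (cases "norm (b y) = 0") (auto simp: power2_eq_square mult_ac)
qed simp

lemma is_adjoint_unique:
  assumes "is_adjoint a b" "is_adjoint a c"
  shows "b = c"
proof (rule blinfun_eqI)
  fix y
  have "cinner x (b y - c y) = 0" for x
    using assms by (simp add: is_adjoint_def cinner.diff_right)
  from this[of "b y - c y"] show "b y = c y" by (simp add: cinner_self)
qed

lemma is_adjoint_sym: "is_adjoint a b \<Longrightarrow> is_adjoint b a"
  unfolding is_adjoint_def by (metis cinner_commute)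

lemma is_adjoint_add: "is_adjoint a b \<Longrightarrow> is_adjoint c d \<Longrightarrow> is_adjoint (a + c) (b + d)"
  by (simp add: is_adjoint_def blinfun.add_left cinner_add_left cinner_add_right)

lemma is_adjoint_scaleC: "is_adjoint a b \<Longrightarrow> is_adjoint (c *\<^sub>C a) (cnj c *\<^sub>C b)"
  by (simp add: is_adjoint_def cinner_scaleC_left cinner_scaleC_right)

lemma is_adjoint_compose: "is_adjoint a b \<Longrightarrow> is_adjoint c d \<Longrightarrow> is_adjoint (a o\<^sub>L c) (d o\<^sub>L b)"
  by (simp add: is_adjoint_def)

lemma blinfun_compose_add_left: "(a + b) o\<^sub>L c = (a o\<^sub>L c) + (b o\<^sub>L c)"
  by (auto intro!: blinfun_eqI simp: blinfun.add_left)

lemma blinfun_compose_diff_left: "(a - b) o\<^sub>L c = (a o\<^sub>L c) - (b o\<^sub>L c)"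
  by (auto intro!: blinfun_eqI simp: blinfun.diff_left)

lemma blinfun_compose_add_right: "a o\<^sub>L (b + c) = (a o\<^sub>L b) + (a o\<^sub>L c)"
  by (auto intro!: blinfun_eqI simp: blinfun.add_left blinfun.add_right)

lemma blinfun_compose_diff_right: "a o\<^sub>L (b - c) = (a o\<^sub>L b) - (a o\<^sub>L c)"
  by (auto intro!: blinfun_eqI simp: blinfun.diff_left blinfun.diff_right)

lemma blinfun_compose_scaleC_left: "(c *\<^sub>C a) o\<^sub>L b = c *\<^sub>C (a o\<^sub>L b)"
  by (auto intro!: blinfun_eqI)

lemma norm_compose_le_1:
  "norm a \<le> 1 \<Longrightarrow> norm (a o\<^sub>L b) \<le> norm b" "norm a \<le> 1 \<Longrightarrow> norm (b o\<^sub>L a) \<le> norm b"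
  using norm_blinfun_compose[of a b] norm_blinfun_compose[of b a]
    mult_right_mono[of "norm a" 1 "norm b"] mult_left_mono[of "norm a" 1 "norm b"] by auto

section \<open>Von Neumann algebras: strong limits and normal functionals\<close>

locale von_neumann =
  fixes M :: "('h::complex_hilbert_space \<Rightarrow>\<^sub>L 'h) set"
  assumes M: "von_neumann_algebra M"
begin

lemma subspace_M: "complex_vector.subspace M"
  using M by (simp add: von_neumann_algebra_def)

lemmas add_M = complex_vector.subspace_add[OF subspace_M]
  and diff_M = complex_vector.subspace_diff[OF subspace_M]
  and scale_M = complex_vector.subspace_scale[OF subspace_M]
  and zero_M = complex_vector.subspace_0[OF subspace_M]
  and sum_M = complex_vector.subspace_sum[OF subspace_M]

lemma compose_M: "a \<in> M \<Longrightarrow> b \<in> M \<Longrightarrow> a o\<^sub>L b \<in> M"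
  using M by (simp add: von_neumann_algebra_def)

lemma scaleC_apply_M: "a \<in> M \<Longrightarrow> a (c *\<^sub>C x) = c *\<^sub>C a x"
  using M by (auto simp: von_neumann_algebra_def bounded_ops_def)

lemma compose_scaleC_right: "a \<in> M \<Longrightarrow> a o\<^sub>L (c *\<^sub>C b) = c *\<^sub>C (a o\<^sub>L b)"
  by (auto intro!: blinfun_eqI simp: scaleC_apply_M)

lemma adjoint_M: "a \<in> M \<Longrightarrow> \<exists>b\<in>M. is_adjoint a b"
  using M by (simp add: von_neumann_algebra_def)

lemma id_M: "id_blinfun \<in> M"
proof -
  have "id_blinfun \<in> commutant (commutant M)"
    by (auto simp: commutant_def bounded_ops_def intro!: blinfun_eqI)
  then show ?thesis using M by (simp add: von_neumann_algebra_def)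
qed

text \<open>By the double commutant property, membership in \<open>M\<close> means complex
  homogeneity and commutation with fixed bounded operators; both pass to pointwise limits.\<close>

lemma SOT_closed:
  fixes a :: "'i \<Rightarrow> 'h \<Rightarrow>\<^sub>L 'h" and b :: "'h \<Rightarrow>\<^sub>L 'h"
  assumes "\<And>i. a i \<in> M" "\<And>x. ((\<lambda>i. a i x) \<longlongrightarrow> b x) F" "F \<noteq> bot"
  shows "b \<in> M"
proof -
  have "b (c *\<^sub>C x) = c *\<^sub>C b x" for c x
  proof (rule tendsto_unique[OF assms(3,2)])
    have "((\<lambda>i. c *\<^sub>C a i x) \<longlongrightarrow> c *\<^sub>C b x) F"
      by (intro tendsto_intros assms)
    then show "((\<lambda>i. a i (c *\<^sub>C x)) \<longlongrightarrow> c *\<^sub>C b x) F"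
      by (simp add: scaleC_apply_M[OF assms(1)])
  qed
  moreover have "b o\<^sub>L d = d o\<^sub>L b" if d: "d \<in> commutant M" for d
  proof (rule blinfun_eqI)
    fix x
    have "d o\<^sub>L a i = a i o\<^sub>L d" for i
      using d assms(1)[of i] by (simp add: commutant_def)
    then have comm: "a i (d x) = d (a i x)" for i
      by (metis blinfun_apply_blinfun_compose)
    have "((\<lambda>i. d (a i x)) \<longlongrightarrow> d (b x)) F"
      by (intro tendsto_intros assms)
    then have "((\<lambda>i. a i (d x)) \<longlongrightarrow> d (b x)) F"
      by (simp add: comm)
    with tendsto_unique[OF assms(3,2)] show "(b o\<^sub>L d) x = (d o\<^sub>L b) x" by simp
  qed
  ultimately have "b \<in> commutant (commutant M)"
    by (simp add: commutant_def bounded_ops_def)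
  then show ?thesis using M by (simp add: von_neumann_algebra_def)
qed

lemma norm_M: "seminorm_on M norm"
  by (rule seminorm_on_operator_norm[OF subspace_M])

lemma predual_cdual: "\<phi> \<in> predual M \<Longrightarrow> \<phi> \<in> cdual M norm"
  by (simp add: predual_def)

lemma subspace_predual: "complex_vector.subspace (predual M)"
proof (rule complex_vector.subspaceI)
  note sub = subspace_cdual[OF norm_M]
  show "0 \<in> predual M"
    using complex_vector.subspace_0[OF sub] by (simp add: predual_def zero_fun_def)
  show "\<phi> + \<psi> \<in> predual M" if "\<phi> \<in> predual M" "\<psi> \<in> predual M" for \<phi> \<psi>
    using complex_vector.subspace_add[OF sub, of \<phi> \<psi>] that
    by (auto simp: predual_def plus_fun_def intro: continuous_map_add)
  show "c *\<^sub>C \<phi> \<in> predual M" if "\<phi> \<in> predual M" for c \<phi>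
    using complex_vector.subspace_scale[OF sub, of \<phi> c] that
    by (auto simp: predual_def scaleC_fun_def scaleC_complex_def intro: continuous_map_cmult)
qed

lemma norm_predual: "seminorm_on (predual M) (predual_norm M)"
  unfolding predual_norm_def
  by (rule seminorm_on_mono[OF seminorm_on_dual[OF norm_M] _ subspace_predual])
    (auto simp: predual_cdual)

lemma predual_norm_bound:
  "\<phi> \<in> cdual M norm \<Longrightarrow> x \<in> M \<Longrightarrow> cmod (\<phi> x) \<le> predual_norm M \<phi> * norm x"
  unfolding predual_norm_def by (rule dual_norm_bound[OF norm_M])

lemma topspace_ultraweak: "topspace (ultraweak_topology M) = M"
proof -
  have "M \<in> {{x\<in>M. (\<Sum>n. cinner (blinfun_apply x (\<xi> n)) (\<eta> n)) \<in> U} |(\<xi> :: nat \<Rightarrow> 'h) (\<eta> :: nat \<Rightarrow> 'h) U.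
          summable (\<lambda>n. (norm (\<xi> n))\<^sup>2) \<and> summable (\<lambda>n. (norm (\<eta> n))\<^sup>2) \<and> open U}"
    by (rule CollectI, rule exI[of _ "\<lambda>_. 0"], rule exI[of _ "\<lambda>_. 0"], rule exI[of _ UNIV]) simp
  then show ?thesis
    unfolding ultraweak_topology_def topology_generated_by_topspace by blast
qed

text \<open>On bounded families strong convergence implies ultraweak convergence: the series
  converge term by term under a summable majorant that does not depend on the index
  \<open>i\<close>.\<close>

lemma limitin_ultraweak:
  fixes a :: "'i \<Rightarrow> 'h \<Rightarrow>\<^sub>L 'h" and b :: "'h \<Rightarrow>\<^sub>L 'h"
  assumes a: "\<And>i. a i \<in> M" "b \<in> M" "\<And>i. norm (a i) \<le> B"
    and lim: "\<And>x. ((\<lambda>i. a i x) \<longlongrightarrow> b x) F" and F: "F \<noteq> bot"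
  shows "limitin (ultraweak_topology M) a b F"
  unfolding limitin_def topspace_ultraweak
proof (intro conjI allI impI)
  have series: "((\<lambda>i. \<Sum>n. cinner (a i (\<xi> n)) (\<eta> n)) \<longlongrightarrow> (\<Sum>n. cinner (b (\<xi> n)) (\<eta> n))) F"
    if s: "summable (\<lambda>n. (norm (\<xi> n))\<^sup>2)" "summable (\<lambda>n. (norm (\<eta> n))\<^sup>2)" for \<xi> \<eta> :: "nat \<Rightarrow> 'h"
  proof -
    \<comment> \<open>Majorant from Cauchy-Schwarz and the inequality between a product and the sum
      of the two squares.\<close>
    let ?m = "\<lambda>n. B * ((norm (\<xi> n))\<^sup>2 + (norm (\<eta> n))\<^sup>2)"
    have B: "B \<ge> 0" using norm_ge_zero a(3) order_trans by blast
    have "cmod (cinner (a i (\<xi> n)) (\<eta> n)) \<le> ?m n" for i n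
    proof -
      have "cmod (cinner (a i (\<xi> n)) (\<eta> n)) \<le> norm (a i (\<xi> n)) * norm (\<eta> n)"
        by (rule cinner_Cauchy_Schwarz)
      also have "\<dots> \<le> (B * norm (\<xi> n)) * norm (\<eta> n)"
        using norm_blinfun[of "a i" "\<xi> n"] mult_right_mono[OF a(3)[of i], of "norm (\<xi> n)"]
        by (intro mult_right_mono) auto
      also have "\<dots> = B * (norm (\<xi> n) * norm (\<eta> n))" by simp
      also have "\<dots> \<le> ?m n"
      proof (rule mult_left_mono[OF _ B])
        have "0 \<le> norm (\<xi> n) * norm (\<eta> n)" by simp
        then show "norm (\<xi> n) * norm (\<eta> n) \<le> (norm (\<xi> n))\<^sup>2 + (norm (\<eta> n))\<^sup>2"
          using sum_squares_bound[of "norm (\<xi> n)" "norm (\<eta> n)"] by linarith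
      qed
      finally show ?thesis .
    qed
    then have ev: "eventually (\<lambda>(n, i). cmod (cinner (a i (\<xi> n)) (\<eta> n)) \<le> ?m n) (at_top \<times>\<^sub>F F)"
      by (intro always_eventually) auto
    have summ: "summable ?m" by (intro summable_mult summable_add s)
    have terms: "((\<lambda>i. cinner (a i (\<xi> n)) (\<eta> n)) \<longlongrightarrow> cinner (b (\<xi> n)) (\<eta> n)) F" for n
      by (intro cinner.tendsto lim tendsto_const)
    show ?thesis
      using tannerys_theorem[where a = "\<lambda>n i. cinner (a i (\<xi> n)) (\<eta> n)", OF terms ev summ F] by blast
  qed
  fix U assume U: "openin (ultraweak_topology M) U \<and> b \<in> U"
  \<comment> \<open>It suffices to treat generators, since being entered eventually passes to finite
    intersections and to unions.\<close>
  then have "generate_topology_on {{x\<in>M. (\<Sum>n. cinner (blinfun_apply x (\<xi> n)) (\<eta> n)) \<in> U} |(\<xi> :: nat \<Rightarrow> 'h) (\<eta> :: nat \<Rightarrow> 'h) U.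
          summable (\<lambda>n. (norm (\<xi> n))\<^sup>2) \<and> summable (\<lambda>n. (norm (\<eta> n))\<^sup>2) \<and> open U} U"
    unfolding ultraweak_topology_def by (intro openin_topology_generated_by) blast
  moreover have "b \<in> U" using U ..
  ultimately show "\<forall>\<^sub>F i in F. a i \<in> U"
  proof (induction rule: generate_topology_on.induct)
    case (Int U V)
    then show ?case by (auto intro: eventually_conj)
  next
    case (UN \<U>)
    then obtain V where "V \<in> \<U>" "\<forall>\<^sub>F i in F. a i \<in> V" by blast
    then show ?case by (auto elim: eventually_mono)
  next
    case (Basis V)
    then obtain \<xi> \<eta> :: "nat \<Rightarrow> 'h" and U where V: "V = {x\<in>M. (\<Sum>n. cinner (x (\<xi> n)) (\<eta> n)) \<in> U}"
      and s: "summable (\<lambda>n. (norm (\<xi> n))\<^sup>2)" "summable (\<lambda>n. (norm (\<eta> n))\<^sup>2)" "open U" by blast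
    have "(\<Sum>n. cinner (b (\<xi> n)) (\<eta> n)) \<in> U" using Basis V by blast
    from topological_tendstoD[OF series[OF s(1,2)] s(3) this]
    show ?case using a(1) by (simp add: V)
  qed simp
qed (rule a(2))

text \<open>The form in which normality is used later: for cutting with finite sums of projections,
  and for evaluating functionals on infinite block sums.\<close>

lemma predual_tendsto:
  fixes a :: "'i \<Rightarrow> 'h \<Rightarrow>\<^sub>L 'h" and b :: "'h \<Rightarrow>\<^sub>L 'h"
  assumes "\<phi> \<in> predual M" "\<And>i. a i \<in> M" "b \<in> M" "\<And>i. norm (a i) \<le> B"
    and "\<And>x. ((\<lambda>i. a i x) \<longlongrightarrow> b x) F" "F \<noteq> bot"
  shows "((\<lambda>i. \<phi> (a i)) \<longlongrightarrow> \<phi> b) F"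
proof -
  have "continuous_map (ultraweak_topology M) euclidean \<phi>"
    using assms(1) by (simp add: predual_def)
  from continuous_map_limit[OF this limitin_ultraweak[OF assms(2-6)]] show ?thesis
    by (simp add: o_def)
qed

definition vector_functional :: "'h \<Rightarrow> 'h \<Rightarrow> ('h \<Rightarrow>\<^sub>L 'h) \<Rightarrow> complex" where
  "vector_functional \<xi> \<eta> = (\<lambda>x. if x \<in> M then cinner (x \<xi>) \<eta> else 0)"

lemma vector_functional_bound: "x \<in> M \<Longrightarrow> cmod (cinner (x \<xi>) \<eta>) \<le> norm \<xi> * norm \<eta> * norm x"
  using cinner_Cauchy_Schwarz[of "x \<xi>" \<eta>] mult_right_mono[OF norm_blinfun[of x \<xi>], of "norm \<eta>"]
  by (simp add: mult_ac)

lemma vector_functional_predual: "vector_functional \<xi> \<eta> \<in> predual M"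
proof -
  have "vector_functional \<xi> \<eta> \<in> cdual M norm"
    by (rule cdualI[where B = "norm \<xi> * norm \<eta>"])
      (auto simp: vector_functional_def add_M scale_M blinfun.add_left cinner_add_left
        cinner_scaleC_left vector_functional_bound)
  moreover have "continuous_map (ultraweak_topology M) euclidean (vector_functional \<xi> \<eta>)"
    unfolding continuous_map_def topspace_ultraweak
  proof (intro conjI allI impI)
    fix U :: "complex set" assume "openin euclidean U"
    then have U: "open U" by simp
    \<comment> \<open>Sequences with a single nonzero entry turn the ultraweak series into one
      term.\<close>
    let ?\<xi> = "\<lambda>n::nat. if n = 0 then \<xi> else 0" and ?\<eta> = "\<lambda>n::nat. if n = 0 then \<eta> else 0"
    have sum: "(\<Sum>n. cinner (x (?\<xi> n)) (?\<eta> n)) = cinner (x \<xi>) \<eta>" for x :: "'h \<Rightarrow>\<^sub>L 'h"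
    proof -
      have "(\<lambda>n. cinner (x (?\<xi> n)) (?\<eta> n)) = (\<lambda>n. if n = 0 then cinner (x \<xi>) \<eta> else 0)"
        by (auto simp: fun_eq_iff cinner.zero_right)
      then show ?thesis using sums_unique[OF sums_single[of 0 "\<lambda>_. cinner (x \<xi>) \<eta>"]] by simp
    qed
    have summ: "summable (\<lambda>n. (norm (if n = 0 then \<zeta> else 0))\<^sup>2)" for \<zeta> :: 'h
      by (rule summable_finite[of "{0::nat}"]) auto
    have "{x \<in> M. vector_functional \<xi> \<eta> x \<in> U} = {x\<in>M. (\<Sum>n. cinner (x (?\<xi> n)) (?\<eta> n)) \<in> U}"
      unfolding sum by (auto simp: vector_functional_def)
    also have "openin (ultraweak_topology M) \<dots>"
      unfolding ultraweak_topology_def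
      by (rule topology_generated_by_Basis, rule CollectI, rule exI[of _ ?\<xi>], rule exI[of _ ?\<eta>],
          rule exI[of _ U]) (intro conjI refl summ U)
    finally show "openin (ultraweak_topology M) {x \<in> M. vector_functional \<xi> \<eta> x \<in> U}" .
  qed auto
  ultimately show ?thesis by (simp add: predual_def)
qed

lemma vector_functional_norm: "predual_norm M (vector_functional \<xi> \<eta>) \<le> norm \<xi> * norm \<eta>"
  unfolding predual_norm_def
proof (rule dual_norm_least[OF norm_M])
  fix x :: "'h \<Rightarrow>\<^sub>L 'h" assume x: "x \<in> M" "norm x \<le> 1"
  have "norm \<xi> * norm \<eta> * norm x \<le> norm \<xi> * norm \<eta>"
    using mult_left_mono[OF x(2), of "norm \<xi> * norm \<eta>"] by simp
  then show "cmod (vector_functional \<xi> \<eta> x) \<le> norm \<xi> * norm \<eta>"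
    using vector_functional_bound[OF x(1), of \<xi> \<eta>] x(1) by (simp add: vector_functional_def)
qed

text \<open>As a function of its second vector a vector functional is bounded and conjugate-linear,
  so the weakly compact Hilbert ball has a weakly compact image.\<close>

lemma compactin_vector_functional_right:
  assumes "R \<ge> 0"
  shows "compactin (weak_topology (predual M) (predual_norm M)) (vector_functional e ` cball 0 R)"
proof (rule compactin_weak_topology_image[OF assms vector_functional_predual], rule disjI2)
  fix f assume f: "f \<in> cdual (predual M) (predual_norm M)"
  obtain B where B: "B \<ge> 0" "\<And>\<phi>. \<phi> \<in> predual M \<Longrightarrow> cmod (f \<phi>) \<le> B * predual_norm M \<phi>"
    using cdual_bounded[OF norm_predual f] by blast
  have add: "vector_functional e (\<eta> + \<eta>') = vector_functional e \<eta> + vector_functional e \<eta>'" for \<eta> \<eta>'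
    by (auto simp: vector_functional_def fun_eq_iff cinner_add_right)
  have scale: "vector_functional e (c *\<^sub>C \<eta>) = cnj c *\<^sub>C vector_functional e \<eta>" for c \<eta>
    by (auto simp: vector_functional_def fun_eq_iff cinner_scaleC_right scaleC_fun_def scaleC_complex_def)
  show "(\<lambda>\<eta>. cnj (f (vector_functional e \<eta>))) \<in> cdual UNIV norm"
  proof (rule cdualI[where B = "B * norm e"])
    fix \<eta> :: 'h
    have "cmod (f (vector_functional e \<eta>)) \<le> B * predual_norm M (vector_functional e \<eta>)"
      by (rule B(2)[OF vector_functional_predual])
    also have "\<dots> \<le> B * (norm e * norm \<eta>)"
      by (rule mult_left_mono[OF vector_functional_norm B(1)])
    finally show "cmod (cnj (f (vector_functional e \<eta>))) \<le> B * norm e * norm \<eta>" by simp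
  qed (simp_all add: add scale cdual_add[OF f] cdual_scale[OF f] vector_functional_predual)
qed

lemma compactin_vector_functional_left:
  assumes "R \<ge> 0"
  shows "compactin (weak_topology (predual M) (predual_norm M)) ((\<lambda>\<eta>. vector_functional \<eta> e) ` cball 0 R)"
proof (rule compactin_weak_topology_image[OF assms vector_functional_predual], rule disjI1)
  fix f assume f: "f \<in> cdual (predual M) (predual_norm M)"
  obtain B where B: "B \<ge> 0" "\<And>\<phi>. \<phi> \<in> predual M \<Longrightarrow> cmod (f \<phi>) \<le> B * predual_norm M \<phi>"
    using cdual_bounded[OF norm_predual f] by blast
  have add: "vector_functional (\<eta> + \<eta>') e = vector_functional \<eta> e + vector_functional \<eta>' e" for \<eta> \<eta>'
    by (auto simp: vector_functional_def fun_eq_iff cinner_add_left blinfun.add_right)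
  have scale: "vector_functional (c *\<^sub>C \<eta>) e = c *\<^sub>C vector_functional \<eta> e" for c \<eta>
    by (auto simp: vector_functional_def fun_eq_iff cinner_scaleC_left scaleC_fun_def
        scaleC_complex_def scaleC_apply_M)
  show "(\<lambda>\<eta>. f (vector_functional \<eta> e)) \<in> cdual UNIV norm"
  proof (rule cdualI[where B = "B * norm e"])
    fix \<eta> :: 'h
    have "cmod (f (vector_functional \<eta> e)) \<le> B * predual_norm M (vector_functional \<eta> e)"
      by (rule B(2)[OF vector_functional_predual])
    also have "\<dots> \<le> B * (norm \<eta> * norm e)"
      by (rule mult_left_mono[OF vector_functional_norm B(1)])
    finally show "cmod (f (vector_functional \<eta> e)) \<le> B * norm e * norm \<eta>" by (simp add: mult_ac)
  qed (simp_all add: add scale cdual_add[OF f] cdual_scale[OF f] vector_functional_predual)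
qed

end

section \<open>Atomic projections\<close>

text \<open>Dimension one means that \<open>p x p\<close> is a multiple of \<open>p\<close> for each
  \<open>x \<in> M\<close>. Applied to the product of the adjoint of \<open>x\<close> with
  \<open>x\<close>, this makes the ratio of the lengths of \<open>x (p h)\<close> and
  \<open>p h\<close> the same for all \<open>h\<close>, and a unit vector \<open>e\<close> in the
  range of \<open>p\<close> computes it.\<close>

lemma atomic_projectionE:
  assumes M: "von_neumann_algebra M" and p: "atomic_projection M p"
  obtains e where "norm e = 1" "p e = e" "\<And>x h. x \<in> M \<Longrightarrow> norm (x (p h)) = norm (x e) * norm (p h)"
proof -
  interpret von_neumann M by (unfold_locales) (rule M)
  have pM: "p \<in> M" and proj: "is_projection p"
    using p by (auto simp: atomic_projection_def projection_in_def is_projection_def)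
  let ?V = "(\<lambda>x. p o\<^sub>L x o\<^sub>L p) ` M"
  have dim: "complex_vector.dim ?V = 1" using p by (simp add: atomic_projection_def)
  obtain B where B: "B \<subseteq> ?V" "complex_vector.independent B" "?V \<subseteq> complex_vector.span B"
    using complex_vector.maximal_independent_subset by blast
  have "card B = 1"
    using complex_vector.basis_card_eq_dim[OF B(1,3,2)] dim by simp
  then obtain b where b: "B = {b}" by (rule card_1_singletonE)
  have "b \<noteq> 0" using B(2) complex_vector.dependent_zero[of B] b by auto
  obtain z where z: "b = p o\<^sub>L z o\<^sub>L p" using B(1) b by blast
  have mult: "\<exists>c. p o\<^sub>L x o\<^sub>L p = c *\<^sub>C b" if "x \<in> M" for x
    using B(3) that unfolding b complex_vector.span_singleton by blast
  have "p o\<^sub>L p o\<^sub>L p = p" using proj by (simp add: is_projection_def)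
  \<comment> \<open>Since \<open>p = p p p\<close> is a nonzero element of the one-dimensional
    space, it can replace the abstract basis vector \<open>b\<close>.\<close>
  with mult[OF pM] obtain k where k: "p = k *\<^sub>C b" by metis
  have p0: "p \<noteq> 0" using \<open>b \<noteq> 0\<close> z by auto
  then have "k \<noteq> 0" using k by auto
  then have "b = inverse k *\<^sub>C p" using k by simp
  with mult have scalar: "\<exists>c. p o\<^sub>L x o\<^sub>L p = c *\<^sub>C p" if "x \<in> M" for x
    using that by (metis scaleC_scaleC)
  obtain h0 where h0: "p h0 \<noteq> 0" using p0 by (metis blinfun_eqI zero_blinfun.rep_eq)
  define e where "e = complex_of_real (inverse (norm (p h0))) *\<^sub>C p h0"
  have e1: "norm e = 1" using h0 by (simp add: e_def norm_scaleC norm_inverse)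
  have pe: "p e = e" by (simp add: e_def scaleC_apply_M[OF pM] is_projection_idem[OF proj])
  show thesis
  proof (rule that[OF e1 pe])
    fix x h assume x: "x \<in> M"
    obtain y where y: "y \<in> M" "is_adjoint x y" using adjoint_M[OF x] by blast
    obtain c where c: "p o\<^sub>L (y o\<^sub>L x) o\<^sub>L p = c *\<^sub>C p" using scalar[OF compose_M[OF y(1) x]] by blast
    \<comment> \<open>The conjugate of \<open>c\<close> appears because \<open>cinner\<close> is
      conjugate-linear in its second argument.\<close>
    have sq: "of_real ((norm (x (p h)))\<^sup>2) = cnj c * of_real ((norm (p h))\<^sup>2)" for h
    proof -
      have "p (y (x (p h))) = c *\<^sub>C p h"
        using arg_cong[OF c, of "\<lambda>a. blinfun_apply a h"] by simp
      have "cinner (x (p h)) (x (p h)) = cinner h (p (y (x (p h))))"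
        using y(2) by (simp add: is_adjoint_def is_projection_cinner[OF proj])
      also have "\<dots> = cnj c * cinner (p h) h"
        using \<open>p (y (x (p h))) = c *\<^sub>C p h\<close>
        by (simp add: cinner_scaleC_right is_projection_cinner[OF proj])
      finally show ?thesis
        by (simp only: cinner_self is_projection_norm_squared[OF proj])
    qed
    have "cnj c = of_real ((norm (x e))\<^sup>2)" using sq[of e] e1 by (simp add: pe)
    with sq[of h] have "(norm (x (p h)))\<^sup>2 = (norm (x e) * norm (p h))\<^sup>2"
      by (simp only: power_mult_distrib of_real_mult[symmetric] of_real_eq_iff)
    then show "norm (x (p h)) = norm (x e) * norm (p h)"
      by (simp add: power2_eq_iff_nonneg)
  qed
qed

section \<open>Functionals cut by finitely many atomic projections\<close>

context von_neumann
begin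

text \<open>The norm of \<open>x p\<close> is at most that of the vector \<open>x e\<close>. Hence
  \<open>\<psi> (x p)\<close> depends only on \<open>x e\<close> and is a functional of bound
  \<open>R\<close> on a subspace of \<open>H\<close>, to which Riesz representation applies.\<close>

lemma atomic_representation_right:
  fixes p :: "'h \<Rightarrow>\<^sub>L 'h"
  assumes e: "\<And>x h. x \<in> M \<Longrightarrow> norm (x (p h)) = norm (x e) * norm (p h)"
    and p: "p \<in> M" "is_projection p"
    and \<psi>: "\<psi> \<in> cdual M norm" "\<And>x. x \<in> M \<Longrightarrow> cmod (\<psi> x) \<le> R * norm x" and R: "R \<ge> 0"
  obtains \<eta> where "norm \<eta> \<le> R" "\<And>x. x \<in> M \<Longrightarrow> \<psi> (x o\<^sub>L p) = cinner (x e) \<eta>"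
proof -
  let ?Y = "(\<lambda>x. blinfun_apply x e) ` M"
  have Y: "complex_vector.subspace ?Y"
  proof (rule complex_vector.subspaceI)
    show "0 \<in> ?Y" using zero_M by (intro image_eqI[of _ _ 0]) auto
    show "u + v \<in> ?Y" if "u \<in> ?Y" "v \<in> ?Y" for u v
      using that add_M by (auto simp: blinfun.add_left[symmetric])
    show "c *\<^sub>C u \<in> ?Y" if "u \<in> ?Y" for c u
      using that scale_M by (auto simp: blinfun_scaleC_apply[symmetric] simp del: blinfun_scaleC_apply)
  qed
  have bound: "cmod (\<psi> (x o\<^sub>L p)) \<le> R * norm (x e)" if x: "x \<in> M" for x
  proof -
    have "norm (x o\<^sub>L p) \<le> norm (x e)"
    proof (rule norm_blinfun_bound)
      show "norm ((x o\<^sub>L p) h) \<le> norm (x e) * norm h" for h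
        using e[OF x, of h] is_projection_norm_le[OF p(2), of h] by (simp add: mult_left_mono)
    qed simp
    from mult_left_mono[OF this R] \<psi>(2)[OF compose_M[OF x p(1)]] show ?thesis by linarith
  qed
  \<comment> \<open>Some preimage is chosen for each vector; \<open>bound\<close> applied to the
    difference of two preimages shows that the choice is immaterial.\<close>
  define g where "g v = \<psi> ((SOME x. x \<in> M \<and> v = x e) o\<^sub>L p)" for v
  have g: "g (x e) = \<psi> (x o\<^sub>L p)" if x: "x \<in> M" for x
  proof -
    define x' where "x' = (SOME y. y \<in> M \<and> x e = y e)"
    have "x' \<in> M \<and> x e = x' e" unfolding x'_def by (rule someI[of _ x]) (simp add: x)
    then have x': "x' \<in> M" "x e = x' e" by auto
    have "cmod (\<psi> ((x' - x) o\<^sub>L p)) \<le> R * norm ((x' - x) e)"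
      by (rule bound[OF diff_M[OF x'(1) x]])
    then have "\<psi> ((x' - x) o\<^sub>L p) = 0" using x'(2) by (simp add: blinfun.diff_left)
    then have "\<psi> (x' o\<^sub>L p) = \<psi> (x o\<^sub>L p)"
      unfolding blinfun_compose_diff_left
      using cdual_diff[OF \<psi>(1) subspace_M compose_M[OF x'(1) p(1)] compose_M[OF x p(1)]] by simp
    then show ?thesis by (simp add: g_def x'_def)
  qed
  obtain \<eta> where \<eta>: "norm \<eta> \<le> R \<or> \<eta> = 0" "\<And>v. v \<in> ?Y \<Longrightarrow> g v = cinner v \<eta>"
  proof (rule Riesz_representation[OF Y, of g R])
    fix u v assume "u \<in> ?Y" "v \<in> ?Y"
    then obtain x y where x: "x \<in> M" "u = x e" and y: "y \<in> M" "v = y e" by blast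
    have "g (u + v) = \<psi> ((x + y) o\<^sub>L p)"
      using g[OF add_M[OF x(1) y(1)]] x(2) y(2) by (simp add: blinfun.add_left)
    also have "\<dots> = \<psi> (x o\<^sub>L p) + \<psi> (y o\<^sub>L p)"
      unfolding blinfun_compose_add_left
      by (rule cdual_add[OF \<psi>(1) compose_M[OF x(1) p(1)] compose_M[OF y(1) p(1)]])
    finally show "g (u + v) = g u + g v" using g x y by simp
  next
    fix c u assume "u \<in> ?Y"
    then obtain x where x: "x \<in> M" "u = x e" by blast
    have "g (c *\<^sub>C u) = \<psi> ((c *\<^sub>C x) o\<^sub>L p)"
      using g[OF scale_M[OF x(1)], of c] x(2) by simp
    also have "\<dots> = c * \<psi> (x o\<^sub>L p)"
      unfolding blinfun_compose_scaleC_left by (rule cdual_scale[OF \<psi>(1) compose_M[OF x(1) p(1)]])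
    finally show "g (c *\<^sub>C u) = c * g u" using g x by simp
  qed (use g bound in auto)
  show thesis
    by (rule that[of \<eta>]) (use \<eta> g R in auto)
qed

text \<open>The right-hand version is applied to the functional taking \<open>x\<close> to the
  conjugate of \<open>\<psi>\<close> at the adjoint of \<open>x\<close>; the adjoint of
  \<open>p x\<close> is the adjoint of \<open>x\<close> followed on the right by
  \<open>p\<close>.\<close>

lemma atomic_representation_left:
  fixes p :: "'h \<Rightarrow>\<^sub>L 'h"
  assumes e: "\<And>x h. x \<in> M \<Longrightarrow> norm (x (p h)) = norm (x e) * norm (p h)"
    and p: "p \<in> M" "is_projection p"
    and \<psi>: "\<psi> \<in> cdual M norm" "\<And>x. x \<in> M \<Longrightarrow> cmod (\<psi> x) \<le> R * norm x" and R: "R \<ge> 0"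
  obtains \<eta> where "norm \<eta> \<le> R" "\<And>x. x \<in> M \<Longrightarrow> \<psi> (p o\<^sub>L x) = cinner (x \<eta>) e"
proof -
  obtain adj where adj: "\<And>x. x \<in> M \<Longrightarrow> adj x \<in> M" "\<And>x. x \<in> M \<Longrightarrow> is_adjoint x (adj x)"
    using adjoint_M by metis
  have adj_eq: "adj x = y" if "x \<in> M" "is_adjoint x y" for x y
    using is_adjoint_unique[OF adj(2)] that by blast
  define \<psi>' where "\<psi>' x = (if x \<in> M then cnj (\<psi> (adj x)) else 0)" for x
  have bound: "cmod (\<psi>' x) \<le> R * norm x" if x: "x \<in> M" for x
    using \<psi>(2)[OF adj(1)[OF x]] mult_left_mono[OF is_adjoint_norm_le[OF adj(2)[OF x]] R] x
    by (simp add: \<psi>'_def)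
  have \<psi>': "\<psi>' \<in> cdual M norm"
  proof (rule cdualI[where B = R])
    fix x y assume xy: "x \<in> M" "y \<in> M"
    have "adj (x + y) = adj x + adj y"
      by (rule adj_eq[OF add_M[OF xy]]) (intro is_adjoint_add adj xy)
    then show "\<psi>' (x + y) = \<psi>' x + \<psi>' y"
      using cdual_add[OF \<psi>(1) adj(1)[OF xy(1)] adj(1)[OF xy(2)]] xy by (simp add: \<psi>'_def add_M)
  next
    fix c x assume x: "x \<in> M"
    have "adj (c *\<^sub>C x) = cnj c *\<^sub>C adj x"
      by (rule adj_eq[OF scale_M[OF x]]) (intro is_adjoint_scaleC adj x)
    then show "\<psi>' (c *\<^sub>C x) = c * \<psi>' x"
      using cdual_scale[OF \<psi>(1) adj(1)[OF x]] x by (simp add: \<psi>'_def scale_M)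
  qed (use bound in \<open>auto simp: \<psi>'_def\<close>)
  obtain \<eta> where \<eta>: "norm \<eta> \<le> R" "\<And>x. x \<in> M \<Longrightarrow> \<psi>' (x o\<^sub>L p) = cinner (x e) \<eta>"
    by (rule atomic_representation_right[OF e p \<psi>' bound R]) auto
  show thesis
  proof (rule that[OF \<eta>(1)])
    fix x assume x: "x \<in> M"
    have "is_adjoint (adj x o\<^sub>L p) (p o\<^sub>L x)"
      by (rule is_adjoint_compose[OF is_adjoint_sym[OF adj(2)[OF x]]])
        (use p in \<open>simp add: is_projection_def\<close>)
    then have "adj (adj x o\<^sub>L p) = p o\<^sub>L x"
      by (rule adj_eq[OF compose_M[OF adj(1)[OF x] p(1)]])
    then have "cnj (\<psi> (p o\<^sub>L x)) = cinner (adj x e) \<eta>"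
      using \<eta>(2)[OF adj(1)[OF x]] compose_M[OF adj(1)[OF x] p(1)] by (simp add: \<psi>'_def)
    also have "\<dots> = cnj (cinner \<eta> (adj x e))" by (rule cinner_commute)
    also have "\<dots> = cnj (cinner (x \<eta>) e)" using adj(2)[OF x] by (simp add: is_adjoint_def)
    finally show "\<psi> (p o\<^sub>L x) = cinner (x \<eta>) e" by simp
  qed
qed

text \<open>One compact \<open>K\<close> has to serve all functionals of bound \<open>R\<close>. It
  is built by induction: each further projection adds a ball of vector functionals whose first
  vector is fixed by that projection.\<close>

lemma compact_set_right:
  assumes "finite C" "\<And>i. i \<in> C \<Longrightarrow> atomic_projection M (p i)" "R \<ge> 0"
  shows "\<exists>K. compactin (weak_topology (predual M) (predual_norm M)) K \<and>
    (\<forall>\<psi>\<in>cdual M norm. (\<forall>x\<in>M. cmod (\<psi> x) \<le> R * norm x) \<longrightarrow>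
      (\<lambda>x. if x \<in> M then \<psi> (x o\<^sub>L (\<Sum>i\<in>C. p i)) else 0) \<in> K)"
  using assms(1,2)
proof (induction C rule: finite_induct)
  case empty
  have "compactin (weak_topology (predual M) (predual_norm M)) {0}"
    using complex_vector.subspace_0[OF subspace_predual] by (simp add: topspace_weak_topology)
  moreover have "(\<lambda>x. if x \<in> M then \<psi> (x o\<^sub>L 0) else 0) = 0" if "\<psi> \<in> cdual M norm" for \<psi>
    using cdual_zero[OF that] by (auto simp: fun_eq_iff)
  ultimately show ?case unfolding sum.empty by (intro exI[of _ "{0}"]) auto
next
  case (insert j C)
  then obtain K where K: "compactin (weak_topology (predual M) (predual_norm M)) K"
    "\<And>\<psi>. \<psi> \<in> cdual M norm \<Longrightarrow> (\<forall>x\<in>M. cmod (\<psi> x) \<le> R * norm x) \<Longrightarrow>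
      (\<lambda>x. if x \<in> M then \<psi> (x o\<^sub>L (\<Sum>i\<in>C. p i)) else 0) \<in> K"
    by auto
  have pM: "p i \<in> M" if "i \<in> insert j C" for i
    using insert.prems that by (auto simp: atomic_projection_def projection_in_def)
  then have proj: "p j \<in> M" "is_projection (p j)"
    using insert.prems[of j] by (auto simp: atomic_projection_def projection_in_def is_projection_def)
  obtain e where e: "norm e = 1" "p j e = e" "\<And>x h. x \<in> M \<Longrightarrow> norm (x (p j h)) = norm (x e) * norm (p j h)"
    using atomic_projectionE[OF M, of "p j"] insert.prems[of j] by blast
  let ?L = "vector_functional e ` cball 0 R"
  have "compactin (weak_topology (predual M) (predual_norm M)) ((\<lambda>(k, l). k + l) ` (K \<times> ?L))"
    by (rule compactin_weak_topology_plus[OF subspace_predual K(1) compactin_vector_functional_right[OF assms(3)]])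
  moreover have "(\<lambda>x. if x \<in> M then \<psi> (x o\<^sub>L (\<Sum>i\<in>insert j C. p i)) else 0) \<in> (\<lambda>(k, l). k + l) ` (K \<times> ?L)"
    if \<psi>: "\<psi> \<in> cdual M norm" "\<forall>x\<in>M. cmod (\<psi> x) \<le> R * norm x" for \<psi>
  proof -
    obtain \<eta> where \<eta>: "norm \<eta> \<le> R" "\<And>x. x \<in> M \<Longrightarrow> \<psi> (x o\<^sub>L p j) = cinner (x e) \<eta>"
      using atomic_representation_right[OF e(3) proj \<psi>(1) _ assms(3)] \<psi>(2) by blast
    have sumM: "(\<Sum>i\<in>C. p i) \<in> M" by (rule sum_M) (use pM in auto)
    have "(\<lambda>x. if x \<in> M then \<psi> (x o\<^sub>L (\<Sum>i\<in>insert j C. p i)) else 0)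
        = (\<lambda>x. if x \<in> M then \<psi> (x o\<^sub>L (\<Sum>i\<in>C. p i)) else 0) + vector_functional e \<eta>"
      using insert.hyps cdual_add[OF \<psi>(1) compose_M[OF _ proj(1)] compose_M[OF _ sumM]] \<eta>(2)
      by (auto simp: fun_eq_iff vector_functional_def blinfun_compose_add_right)
    then show ?thesis using K(2)[OF \<psi>] \<eta>(1)
      by (intro image_eqI[of _ _ "(\<lambda>x. if x \<in> M then \<psi> (x o\<^sub>L (\<Sum>i\<in>C. p i)) else 0, vector_functional e \<eta>)"]) auto
  qed
  ultimately show ?case by blast
qed

text \<open>Mirror image of the preceding construction: now the second vector is fixed by the
  projection and the first one varies.\<close>

lemma compact_set_left:
  assumes "finite D" "\<And>i. i \<in> D \<Longrightarrow> atomic_projection M (q i)" "R \<ge> 0"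
  shows "\<exists>K. compactin (weak_topology (predual M) (predual_norm M)) K \<and>
    (\<forall>\<psi>\<in>cdual M norm. (\<forall>x\<in>M. cmod (\<psi> x) \<le> R * norm x) \<longrightarrow>
      (\<lambda>x. if x \<in> M then \<psi> ((\<Sum>i\<in>D. q i) o\<^sub>L x) else 0) \<in> K)"
  using assms(1,2)
proof (induction D rule: finite_induct)
  case empty
  have "compactin (weak_topology (predual M) (predual_norm M)) {0}"
    using complex_vector.subspace_0[OF subspace_predual] by (simp add: topspace_weak_topology)
  moreover have "(\<lambda>x. if x \<in> M then \<psi> (0 o\<^sub>L x) else 0) = 0" if "\<psi> \<in> cdual M norm" for \<psi>
    using cdual_zero[OF that] by (auto simp: fun_eq_iff)
  ultimately show ?case unfolding sum.empty by (intro exI[of _ "{0}"]) auto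
next
  case (insert j D)
  then obtain K where K: "compactin (weak_topology (predual M) (predual_norm M)) K"
    "\<And>\<psi>. \<psi> \<in> cdual M norm \<Longrightarrow> (\<forall>x\<in>M. cmod (\<psi> x) \<le> R * norm x) \<Longrightarrow>
      (\<lambda>x. if x \<in> M then \<psi> ((\<Sum>i\<in>D. q i) o\<^sub>L x) else 0) \<in> K"
    by auto
  have qM: "q i \<in> M" if "i \<in> insert j D" for i
    using insert.prems that by (auto simp: atomic_projection_def projection_in_def)
  then have proj: "q j \<in> M" "is_projection (q j)"
    using insert.prems[of j] by (auto simp: atomic_projection_def projection_in_def is_projection_def)
  obtain e where e: "norm e = 1" "q j e = e" "\<And>x h. x \<in> M \<Longrightarrow> norm (x (q j h)) = norm (x e) * norm (q j h)"
    using atomic_projectionE[OF M, of "q j"] insert.prems[of j] by blast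
  let ?L = "(\<lambda>\<eta>. vector_functional \<eta> e) ` cball 0 R"
  have "compactin (weak_topology (predual M) (predual_norm M)) ((\<lambda>(k, l). k + l) ` (K \<times> ?L))"
    by (rule compactin_weak_topology_plus[OF subspace_predual K(1) compactin_vector_functional_left[OF assms(3)]])
  moreover have "(\<lambda>x. if x \<in> M then \<psi> ((\<Sum>i\<in>insert j D. q i) o\<^sub>L x) else 0) \<in> (\<lambda>(k, l). k + l) ` (K \<times> ?L)"
    if \<psi>: "\<psi> \<in> cdual M norm" "\<forall>x\<in>M. cmod (\<psi> x) \<le> R * norm x" for \<psi>
  proof -
    obtain \<eta> where \<eta>: "norm \<eta> \<le> R" "\<And>x. x \<in> M \<Longrightarrow> \<psi> (q j o\<^sub>L x) = cinner (x \<eta>) e"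
      using atomic_representation_left[OF e(3) proj \<psi>(1) _ assms(3)] \<psi>(2) by blast
    have sumM: "(\<Sum>i\<in>D. q i) \<in> M" by (rule sum_M) (use qM in auto)
    have "(\<lambda>x. if x \<in> M then \<psi> ((\<Sum>i\<in>insert j D. q i) o\<^sub>L x) else 0)
        = (\<lambda>x. if x \<in> M then \<psi> ((\<Sum>i\<in>D. q i) o\<^sub>L x) else 0) + vector_functional \<eta> e"
      using insert.hyps cdual_add[OF \<psi>(1) compose_M[OF proj(1)] compose_M[OF sumM]] \<eta>(2)
      by (auto simp: fun_eq_iff vector_functional_def blinfun_compose_add_left)
    then show ?thesis using K(2)[OF \<psi>] \<eta>(1)
      by (intro image_eqI[of _ _ "(\<lambda>x. if x \<in> M then \<psi> ((\<Sum>i\<in>D. q i) o\<^sub>L x) else 0, vector_functional \<eta> e)"]) auto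
  qed
  ultimately show ?case by blast
qed

end

section \<open>Block diagonal sums and the gliding hump\<close>

text \<open>This opens the Cauchy criterion for series of vectors in \<open>H\<close>.\<close>

instance complex_hilbert_space \<subseteq> banach ..

lemma Pythagoras_sum:
  fixes v :: "'i \<Rightarrow> 'h::complex_hilbert_space"
  assumes "finite F" "\<And>i j. i \<in> F \<Longrightarrow> j \<in> F \<Longrightarrow> i \<noteq> j \<Longrightarrow> cinner (v i) (v j) = 0"
  shows "(norm (\<Sum>i\<in>F. v i))\<^sup>2 = (\<Sum>i\<in>F. (norm (v i))\<^sup>2)"
  using assms
proof (induction F rule: finite_induct)
  case (insert k F)
  have "cinner (v k) (\<Sum>i\<in>F. v i) = (\<Sum>i\<in>F. cinner (v k) (v i))"
    by (rule cinner.sum_right)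
  also have "\<dots> = 0"
    using insert.hyps(2) insert.prems by (intro sum.neutral) auto
  finally show ?case
    using insert by (simp add: norm_add_squared)
qed simp

context von_neumann
begin

text \<open>The partial sums converge strongly since the ranges of the summands are orthogonal and so
  are their initial spaces.\<close>

lemma block_diagonal_sums:
  fixes x r s :: "nat \<Rightarrow> 'h \<Rightarrow>\<^sub>L 'h" and c :: "nat \<Rightarrow> complex"
  assumes x: "\<And>n. x n \<in> M" "\<And>n. norm (x n) \<le> 1" "\<And>n h. x n h = s n (x n (r n h))"
    and r: "\<And>n. is_projection (r n)" "\<And>m n. m \<noteq> n \<Longrightarrow> r m o\<^sub>L r n = 0"
    and s: "\<And>n. is_projection (s n)" "\<And>m n. m \<noteq> n \<Longrightarrow> s m o\<^sub>L s n = 0"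
    and c: "\<And>n. cmod (c n) \<le> 1"
  obtains y where "y \<in> M" "norm y \<le> 1" "\<And>\<psi>. \<psi> \<in> predual M \<Longrightarrow> (\<lambda>n. c n * \<psi> (x n)) sums \<psi> y"
proof -
  \<comment> \<open>Bessel's inequality for the orthogonal projections \<open>r n\<close>.\<close>
  have r_sum: "(\<Sum>n\<in>F. (norm (r n h))\<^sup>2) \<le> (norm h)\<^sup>2" if "finite F" for F h
  proof -
    have orth: "cinner (r i h) (r j h) = 0" if "i \<noteq> j" for i j
      using is_projection_cinner[OF r(1), of i h "r j h"] arg_cong[OF r(2)[OF that], of "\<lambda>a. blinfun_apply a h"]
      by (simp add: cinner.zero_right)
    have "(\<Sum>n\<in>F. (norm (r n h))\<^sup>2) = (norm (\<Sum>n\<in>F. r n h))\<^sup>2"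
      by (rule Pythagoras_sum[symmetric]) (use that orth in auto)
    also have "(\<Sum>n\<in>F. r n h) = (\<Sum>n\<in>F. r n) h" by (simp add: blinfun.sum_left)
    also have "(norm ((\<Sum>n\<in>F. r n) h))\<^sup>2 \<le> (norm h)\<^sup>2"
      by (rule power_mono[OF is_projection_norm_le[OF is_projection_sum]]) (use that r in auto)
    finally show ?thesis .
  qed
  have x_le: "norm (c n *\<^sub>C x n h) \<le> norm (r n h)" for n h
  proof -
    have "norm (x n h) \<le> norm (x n (r n h))"
      by (subst x(3)) (rule is_projection_norm_le[OF s(1)])
    also have "\<dots> \<le> norm (x n) * norm (r n h)" by (rule norm_blinfun)
    also have "\<dots> \<le> norm (r n h)" using mult_right_mono[OF x(2)[of n], of "norm (r n h)"] by simp
    finally show ?thesis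
      using mult_mono[OF c[of n], of "norm (x n h)" "norm (r n h)"] by (simp add: norm_scaleC)
  qed
  \<comment> \<open>Orthogonality of the \<open>s n\<close> makes the summands orthogonal, and each
    is dominated by its component \<open>r n h\<close>; combined with Bessel's inequality this makes
    all partial sums contractions.\<close>
  have v_sum: "(norm (\<Sum>n\<in>F. c n *\<^sub>C x n h))\<^sup>2 \<le> (\<Sum>n\<in>F. (norm (r n h))\<^sup>2)" if "finite F" for F h
  proof -
    have orth: "cinner (c i *\<^sub>C x i h) (c j *\<^sub>C x j h) = 0" if "i \<noteq> j" for i j
    proof -
      have "cinner (x i h) (x j h) = cinner (s i (x i (r i h))) (s j (x j (r j h)))"
        using x(3) by metis
      also have "\<dots> = 0"
        using is_projection_cinner[OF s(1)] arg_cong[OF s(2)[OF that], of "\<lambda>a. blinfun_apply a (x j (r j h))"]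
        by (simp add: cinner.zero_right)
      finally show ?thesis by (simp add: cinner_scaleC_left cinner_scaleC_right)
    qed
    have "(norm (\<Sum>n\<in>F. c n *\<^sub>C x n h))\<^sup>2 = (\<Sum>n\<in>F. (norm (c n *\<^sub>C x n h))\<^sup>2)"
      by (rule Pythagoras_sum) (use that orth in auto)
    also have "\<dots> \<le> (\<Sum>n\<in>F. (norm (r n h))\<^sup>2)"
      by (intro sum_mono power_mono x_le) simp
    finally show ?thesis .
  qed
  have partial_le: "norm (\<Sum>n\<in>F. c n *\<^sub>C x n h) \<le> norm h" if "finite F" for F h
    using order_trans[OF v_sum[OF that] r_sum[OF that]] by (rule power2_le_imp_le) simp
  have summ: "summable (\<lambda>n. c n *\<^sub>C x n h)" for h
    unfolding summable_Cauchy
  proof (intro allI impI)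
    fix e :: real assume e: "e > 0"
    have "summable (\<lambda>n. (norm (r n h))\<^sup>2)"
      by (rule summableI_nonneg_bounded[where x = "(norm h)\<^sup>2"]) (use r_sum in auto)
    \<comment> \<open>Tails of the convergent series of squares control the squared norms of blocks
      of the vector series.\<close>
    then obtain N where N: "\<And>m n. m \<ge> N \<Longrightarrow> norm (\<Sum>i=m..<n. (norm (r i h))\<^sup>2) < e\<^sup>2"
      using e unfolding summable_Cauchy by (meson zero_less_power)
    have "norm (\<Sum>i=m..<n. c i *\<^sub>C x i h) < e" if "m \<ge> N" for m n
    proof (rule power2_less_imp_less[OF _ less_imp_le[OF e]])
      have "(norm (\<Sum>i=m..<n. c i *\<^sub>C x i h))\<^sup>2 \<le> (\<Sum>i=m..<n. (norm (r i h))\<^sup>2)"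
        by (rule v_sum) simp
      also have "\<dots> < e\<^sup>2" using N[OF that, of n] by (simp add: abs_of_nonneg sum_nonneg)
      finally show "(norm (\<Sum>i=m..<n. c i *\<^sub>C x i h))\<^sup>2 < e\<^sup>2" .
    qed
    then show "\<exists>N. \<forall>m\<ge>N. \<forall>n. norm (\<Sum>i=m..<n. c i *\<^sub>C x i h) < e" by blast
  qed
  define f where "f h = (\<Sum>n. c n *\<^sub>C x n h)" for h
  have f_lim: "(\<lambda>N. \<Sum>n<N. c n *\<^sub>C x n h) \<longlonglongrightarrow> f h" for h
    unfolding f_def by (rule summable_LIMSEQ[OF summ])
  have f_le: "norm (f h) \<le> norm h" for h
    by (rule LIMSEQ_le_const2[OF tendsto_norm[OF f_lim]]) (use partial_le in auto)
  have "bounded_linear f"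
  proof (rule bounded_linear_intro[where K = 1])
    show "f (g + h) = f g + f h" for g h
      unfolding f_def by (subst suminf_add[OF summ summ]) (simp add: blinfun.add_right scaleC_add_right)
    show "f (a *\<^sub>R h) = a *\<^sub>R f h" for a h
      unfolding f_def
      by (subst suminf_scaleR_right[OF summ])
        (simp add: scaleR_eq_scaleC scaleC_apply_M[OF x(1)] scaleC_scaleC mult.commute)
  qed (simp add: f_le)
  then obtain y where y: "blinfun_apply y = f" using bounded_linear_Blinfun_apply by blast
  define Y where "Y N = (\<Sum>n<N. c n *\<^sub>C x n)" for N
  have Y_apply: "Y N h = (\<Sum>n<N. c n *\<^sub>C x n h)" for N h
    by (simp add: Y_def blinfun.sum_left)
  have YM: "Y N \<in> M" for N
    unfolding Y_def by (intro sum_M scale_M x)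
  have Y_lim: "(\<lambda>N. Y N h) \<longlonglongrightarrow> y h" for h
    unfolding Y_apply y by (rule f_lim)
  have Y_norm: "norm (Y N) \<le> 1" for N
    by (rule norm_blinfun_bound) (simp_all add: Y_apply partial_le)
  have yM: "y \<in> M" by (rule SOT_closed[OF YM Y_lim]) simp
  show thesis
  proof (rule that[OF yM])
    show "norm y \<le> 1" by (rule norm_blinfun_bound) (simp_all add: y f_le)
    fix \<psi> assume \<psi>: "\<psi> \<in> predual M"
    have "(\<lambda>N. \<psi> (Y N)) \<longlonglongrightarrow> \<psi> y"
      by (rule predual_tendsto[OF \<psi> YM yM Y_norm Y_lim]) simp
    moreover have "\<psi> (Y N) = (\<Sum>n<N. c n * \<psi> (x n))" for N
      unfolding Y_def
      using cdual_sum[OF predual_cdual[OF \<psi>] subspace_M, of "{..<N}" "\<lambda>n. c n *\<^sub>C x n"] scale_M x(1)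
      by (simp add: cdual_scale[OF predual_cdual[OF \<psi>] x(1)])
    ultimately show "(\<lambda>n. c n * \<psi> (x n)) sums \<psi> y" by (simp add: sums_def)
  qed
qed

text \<open>These evaluations are the test functionals on the predual at which elements of its
  bidual are examined.\<close>

lemma evaluation_cdual:
  assumes "y \<in> M"
  defines "E \<equiv> \<lambda>\<phi>. if \<phi> \<in> predual M then \<phi> y else 0"
  shows "E \<in> cdual (predual M) (predual_norm M)"
    and "dual_norm (predual M) (predual_norm M) E \<le> norm y"
proof -
  have bound: "cmod (E \<phi>) \<le> norm y * predual_norm M \<phi>" if "\<phi> \<in> predual M" for \<phi>
    using predual_norm_bound[OF predual_cdual[OF that] assms(1)] that by (simp add: E_def mult.commute)
  show "E \<in> cdual (predual M) (predual_norm M)"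
    using complex_vector.subspace_add[OF subspace_predual] complex_vector.subspace_scale[OF subspace_predual]
    by (intro cdualI[where B = "norm y"] bound) (auto simp: E_def scaleC_fun_def scaleC_complex_def)
  show "dual_norm (predual M) (predual_norm M) E \<le> norm y"
  proof (rule dual_norm_least[OF norm_predual])
    fix \<phi> assume \<phi>: "\<phi> \<in> predual M" "predual_norm M \<phi> \<le> 1"
    show "cmod (E \<phi>) \<le> norm y"
      using bound[OF \<phi>(1)] mult_left_mono[OF \<phi>(2), of "norm y"] by simp
  qed
qed

text \<open>Passing to a subsequence makes the matrix \<open>\<phi> n (x m)\<close> nearly diagonal up to its columnwise
  limit \<open>l\<close>. Every cluster point is then at least \<open>t - 3e\<close> on the tail sums of the \<open>x m\<close>, while a
  normal functional tends to \<open>0\<close> on them.\<close>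

lemma gliding_hump:
  assumes A: "\<And>n. \<phi> n \<in> predual M" "\<And>n. predual_norm M (\<phi> n) \<le> B"
    and x: "\<And>n::nat. x n \<in> M" "\<And>n. norm (x n) \<le> 1"
    and block: "\<And>c. (\<And>n. cmod (c n) \<le> 1) \<Longrightarrow>
      \<exists>y\<in>M. norm y \<le> 1 \<and> (\<forall>\<psi>\<in>predual M. (\<lambda>n. c n * \<psi> (x n)) sums \<psi> y)"
    and t: "\<And>n. t \<le> Re (\<phi> n (x n))" and e: "e > 0"
  obtains \<tau> :: "nat \<Rightarrow> nat" where "t - 3 * e \<le> norm_setdist (bidual_norm (predual M) (predual_norm M))
      (cluster_points (bidual_weak_star (predual M) (predual_norm M))
        (\<lambda>n. canonical_embedding (predual M) (predual_norm M) (\<phi> (\<tau> n))))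
      (canonical_embedding (predual M) (predual_norm M) ` predual M)"
proof -
  let ?X = "predual M" and ?N = "predual_norm M"
  \<comment> \<open>With conjugate signs as coefficients the block sum produces the series of
    absolute values; thus \<open>\<psi>\<close> is sent contractively to a sequence in
    \<ell>1.\<close>
  have abs_bound: "summable (\<lambda>n. cmod (\<psi> (x n)))" "(\<Sum>n. cmod (\<psi> (x n))) \<le> ?N \<psi>"
    if \<psi>: "\<psi> \<in> ?X" for \<psi>
  proof -
    have "cmod (cnj (sgn z)) \<le> 1" for z by (simp add: norm_sgn)
    then obtain y where y: "y \<in> M" "norm y \<le> 1" "(\<lambda>n. cnj (sgn (\<psi> (x n))) * \<psi> (x n)) sums \<psi> y"
      using block[of "\<lambda>n. cnj (sgn (\<psi> (x n)))"] \<psi> by blast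
    have "cnj (sgn z) * z = of_real (cmod z)" for z
      by (cases "z = 0")
        (simp_all add: sgn_div_norm scaleR_conv_of_real complex_norm_square[symmetric] mult.assoc
          mult.commute[of "cnj z"] power2_eq_square)
    with y(3) have s: "(\<lambda>n. complex_of_real (cmod (\<psi> (x n)))) sums \<psi> y" by simp
    then have "(\<lambda>n. Re (complex_of_real (cmod (\<psi> (x n))))) sums Re (\<psi> y)" by (rule sums_Re)
    then have s': "(\<lambda>n. cmod (\<psi> (x n))) sums Re (\<psi> y)" by simp
    then show "summable (\<lambda>n. cmod (\<psi> (x n)))" by (rule sums_summable)
    have "Re (\<psi> y) \<le> cmod (\<psi> y)" by (rule complex_Re_le_cmod)
    also have "\<dots> \<le> ?N \<psi> * norm y" by (rule predual_norm_bound[OF predual_cdual[OF \<psi>] y(1)])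
    also have "\<dots> \<le> ?N \<psi>"
      using mult_left_mono[OF y(2) seminorm_on_nonneg[OF norm_predual \<psi>]] by simp
    finally show "(\<Sum>n. cmod (\<psi> (x n))) \<le> ?N \<psi>" using sums_unique[OF s'] by simp
  qed
  have partial: "(\<Sum>m\<in>F. cmod (\<phi> n (x m))) \<le> B" if "finite F" for F n
  proof -
    have "(\<Sum>m\<in>F. cmod (\<phi> n (x m))) \<le> (\<Sum>m. cmod (\<phi> n (x m)))"
      by (rule sum_le_suminf[OF abs_bound(1)[OF A(1)] that]) simp
    then show ?thesis using abs_bound(2)[OF A(1), of n] A(2)[of n] by linarith
  qed
  \<comment> \<open>A diagonal subsequence along which every column converges.\<close>
  obtain k where k: "strict_mono k" "\<And>m. \<exists>l. (\<lambda>n. \<phi> (k n) (x m)) \<longlonglongrightarrow> l"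
  proof (rule function_convergent_subsequence[of UNIV "\<lambda>n m. \<phi> n (x m)" B])
    show "norm (\<phi> n (x m)) \<le> B" for n m using partial[of "{m}" n] by simp
  qed auto
  then obtain l where l: "\<And>m. (\<lambda>n. \<phi> (k n) (x m)) \<longlonglongrightarrow> l m" by metis
  \<comment> \<open>The column limits need not vanish, but they lie in \<ell>1, so that beyond
    \<open>N0\<close> they contribute less than \<open>e\<close>.\<close>
  have "summable (\<lambda>m. cmod (l m))"
  proof (rule summableI_nonneg_bounded)
    fix n
    have "(\<lambda>i. \<Sum>m<n. cmod (\<phi> (k i) (x m))) \<longlonglongrightarrow> (\<Sum>m<n. cmod (l m))"
      by (intro tendsto_intros l)
    then show "(\<Sum>m<n. cmod (l m)) \<le> B"
      by (rule LIMSEQ_le_const2) (use partial in auto)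
  qed simp
  then obtain N0 where N0: "\<And>m n. m \<ge> N0 \<Longrightarrow> norm (\<Sum>i=m..<n. cmod (l i)) < e"
    using e unfolding summable_Cauchy by blast
  \<comment> \<open>\<open>near a b\<close> controls both sides of the diagonal: rows from
    \<open>k b\<close> on agree with \<open>l\<close> up to \<open>e\<close> on the columns up to
    \<open>k a\<close>, and row \<open>k a\<close> has less than \<open>e\<close> left from column
    \<open>k b\<close> on.\<close>
  define near where "near a b \<longleftrightarrow> a < b \<and> (\<forall>n\<ge>b. (\<Sum>m\<le>k a. cmod (\<phi> (k n) (x m) - l m)) < e) \<and>
      (\<forall>n. (\<Sum>m=k b..<n. cmod (\<phi> (k a) (x m))) < e)" for a b
  have k_ge: "n \<le> k n" for n by (rule strict_mono_imp_increasing[OF k(1)])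
  have "\<exists>\<sigma>. \<forall>j. N0 \<le> \<sigma> j \<and> near (\<sigma> j) (\<sigma> (Suc j))"
  proof (rule dependent_nat_choice)
    fix a j assume a: "N0 \<le> a"
    have "(\<lambda>n. \<Sum>m\<le>k a. cmod (\<phi> (k n) (x m) - l m)) \<longlonglongrightarrow> (\<Sum>m\<le>k a. cmod (l m - l m))"
      by (intro tendsto_intros l)
    then have "(\<lambda>n. \<Sum>m\<le>k a. cmod (\<phi> (k n) (x m) - l m)) \<longlonglongrightarrow> 0" by simp
    from order_tendstoD(2)[OF this e] obtain n1 where
      n1: "\<And>n. n \<ge> n1 \<Longrightarrow> (\<Sum>m\<le>k a. cmod (\<phi> (k n) (x m) - l m)) < e"
      by (auto simp: eventually_sequentially)
    obtain n2 where n2: "\<And>m n. m \<ge> n2 \<Longrightarrow> norm (\<Sum>i=m..<n. cmod (\<phi> (k a) (x i))) < e"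
      using abs_bound(1)[OF A(1), of "k a"] e unfolding summable_Cauchy by blast
    let ?b = "max (Suc a) (max n1 n2)"
    have "(\<Sum>m=k ?b..<n. cmod (\<phi> (k a) (x m))) < e" for n
    proof -
      have "n2 \<le> k ?b" using k_ge[of ?b] by simp
      from n2[OF this, of n] show ?thesis by (simp add: abs_of_nonneg sum_nonneg)
    qed
    then have "near a ?b" using n1 by (auto simp: near_def)
    then show "\<exists>b. N0 \<le> b \<and> near a b" using a by (intro exI[of _ ?b]) auto
  qed auto
  then obtain \<sigma> where \<sigma>: "\<And>j. N0 \<le> \<sigma> j" "\<And>j. near (\<sigma> j) (\<sigma> (Suc j))" by blast
  have \<sigma>_mono: "strict_mono \<sigma>" using \<sigma>(2) by (simp add: strict_mono_Suc_iff near_def)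
  define \<tau> where "\<tau> j = k (\<sigma> j)" for j
  have \<tau>_mono: "strict_mono \<tau>" unfolding \<tau>_def using k(1) \<sigma>_mono by (simp add: strict_mono_def)
  have \<tau>_less: "\<tau> a < \<tau> b \<longleftrightarrow> a < b" for a b by (rule strict_mono_less[OF \<tau>_mono])
  have \<tau>_le: "\<tau> a \<le> \<tau> b \<longleftrightarrow> a \<le> b" for a b by (rule strict_mono_less_eq[OF \<tau>_mono])
  have \<tau>_N0: "N0 \<le> \<tau> j" for j
    unfolding \<tau>_def using k_ge[of "\<sigma> j"] \<sigma>(1)[of j] by linarith
  have \<tau>_ge: "j \<le> \<tau> j" for j by (rule strict_mono_imp_increasing[OF \<tau>_mono])
  \<comment> \<open>Only columns with indices in the range of \<open>\<tau>\<close> are summed, and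
    only from \<open>\<tau> i\<close> on.\<close>
  define c where "c i m = (if m \<in> \<tau> ` {i..} then 1 else 0 :: complex)" for i m
  have "\<exists>y\<in>M. norm y \<le> 1 \<and> (\<forall>\<psi>\<in>?X. (\<lambda>n. c i n * \<psi> (x n)) sums \<psi> y)" for i
    by (rule block) (simp add: c_def)
  then obtain y where y: "\<And>i. y i \<in> M" "\<And>i. norm (y i) \<le> 1"
    "\<And>i \<psi>. \<psi> \<in> ?X \<Longrightarrow> (\<lambda>n. c i n * \<psi> (x n)) sums \<psi> (y i)" by metis
  have c_sum: "(\<Sum>m<K. c i m * u m) = (\<Sum>m\<in>{..<K} \<inter> \<tau> ` {i..}. u m)" for K i u
    by (auto simp: c_def sum.inter_restrict intro!: sum.cong)
  \<comment> \<open>Row \<open>\<tau> j\<close> is split into its diagonal entry, the later columns,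
    which cost \<open>e\<close>, and the earlier ones, which cost \<open>e\<close> for the deviation
    from \<open>l\<close> and \<open>e\<close> for \<open>l\<close> itself: in total
    \<open>3 * e\<close>.\<close>
  have large: "t - 3 * e \<le> Re (\<phi> (\<tau> j) (y i))" if ij: "i \<le> j" for i j
  proof -
    define u where "u m = \<phi> (\<tau> j) (x m)" for m
    have part: "t - 3 * e \<le> Re (\<Sum>m<K. c i m * u m)" if K: "K > \<tau> j" for K
    proof -
      let ?S = "{..<K} \<inter> \<tau> ` {i..}"
      let ?E1 = "?S \<inter> {..<\<tau> j}" and ?E2 = "?S \<inter> {\<tau> j<..}"
      have S: "?S = insert (\<tau> j) (?E1 \<union> ?E2)" using K ij by auto
      have "(\<Sum>m\<in>?S. u m) = (\<Sum>m\<in>insert (\<tau> j) (?E1 \<union> ?E2). u m)" by (simp only: S[symmetric])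
      also have "\<dots> = u (\<tau> j) + (\<Sum>m\<in>?E1 \<union> ?E2. u m)" by (rule sum.insert) auto
      also have "(\<Sum>m\<in>?E1 \<union> ?E2. u m) = (\<Sum>m\<in>?E1. u m) + (\<Sum>m\<in>?E2. u m)"
        by (rule sum.union_disjoint) auto
      finally have split: "(\<Sum>m\<in>?S. u m) = u (\<tau> j) + ((\<Sum>m\<in>?E1. u m) + (\<Sum>m\<in>?E2. u m))" .
      have "?E2 \<subseteq> {\<tau> (Suc j)..<K}"
        by (auto simp: \<tau>_less \<tau>_le)
      then have "(\<Sum>m\<in>?E2. cmod (u m)) \<le> (\<Sum>m=\<tau> (Suc j)..<K. cmod (u m))"
        by (intro sum_mono2) auto
      also have "\<dots> < e" using \<sigma>(2)[of j] by (simp add: near_def u_def \<tau>_def)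
      finally have E2: "cmod (\<Sum>m\<in>?E2. u m) \<le> e" using norm_sum[of u ?E2] by linarith
      have E1: "cmod (\<Sum>m\<in>?E1. u m) \<le> 2 * e"
      proof (cases j)
        case 0
        then have "?E1 = {}" by (auto simp: \<tau>_less)
        then show ?thesis using e by (simp del: Int_iff)
      next
        \<comment> \<open>The gaps in the range of \<open>\<tau>\<close> put all earlier columns at
          or below \<open>\<tau> j'\<close>, where \<open>near\<close> applies, and all of them lie
          beyond \<open>N0\<close>.\<close>
        case (Suc j')
        have sub: "?E1 \<subseteq> {N0..<Suc (\<tau> j')}"
          using \<tau>_N0 by (auto simp: Suc \<tau>_less \<tau>_le less_Suc_eq_le)
        have "cmod (\<Sum>m\<in>?E1. u m) \<le> (\<Sum>m\<in>?E1. cmod (u m))" by (rule norm_sum)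
        also have "\<dots> \<le> (\<Sum>m\<in>?E1. cmod (u m - l m) + cmod (l m))"
          by (intro sum_mono) (metis diff_add_cancel norm_triangle_ineq)
        also have "\<dots> = (\<Sum>m\<in>?E1. cmod (u m - l m)) + (\<Sum>m\<in>?E1. cmod (l m))"
          by (rule sum.distrib)
        also have "(\<Sum>m\<in>?E1. cmod (u m - l m)) \<le> (\<Sum>m\<le>\<tau> j'. cmod (u m - l m))"
          using sub by (intro sum_mono2) auto
        also have "(\<Sum>m\<le>\<tau> j'. cmod (u m - l m)) \<le> e"
          using \<sigma>(2)[of j'] by (auto simp: near_def u_def \<tau>_def Suc intro: less_imp_le)
        also have "(\<Sum>m\<in>?E1. cmod (l m)) \<le> (\<Sum>m=N0..<Suc (\<tau> j'). cmod (l m))"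
          using sub by (intro sum_mono2) auto
        also have "\<dots> \<le> e" using N0[of N0 "Suc (\<tau> j')"] by (simp add: abs_le_iff del: sum.op_ivl_Suc)
        finally show ?thesis by simp
      qed
      have "- cmod (\<Sum>m\<in>?E1. u m) \<le> Re (\<Sum>m\<in>?E1. u m)" "- cmod (\<Sum>m\<in>?E2. u m) \<le> Re (\<Sum>m\<in>?E2. u m)"
        using abs_Re_le_cmod abs_le_iff by (meson abs_le_D2 minus_le_iff)+
      moreover have "t \<le> Re (u (\<tau> j))" using t by (simp add: u_def)
      ultimately show ?thesis using E1 E2 unfolding c_sum split by simp
    qed
    have "(\<lambda>K. Re (\<Sum>m<K. c i m * u m)) \<longlonglongrightarrow> Re (\<phi> (\<tau> j) (y i))"
      using y(3)[OF A(1), of i "\<tau> j"] unfolding sums_def u_def by (rule tendsto_Re)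
    then show ?thesis
      by (rule LIMSEQ_le_const) (use part in \<open>auto intro!: exI[of _ "Suc (\<tau> j)"]\<close>)
  qed
  \<comment> \<open>Because \<open>a \<le> \<tau> a\<close>, the sum for \<open>y N\<close> uses
    only columns from \<open>N\<close> on, so it is dominated by a tail of an absolutely convergent
    series.\<close>
  have small: "\<exists>i. cmod (\<psi> (y i)) \<le> d" if \<psi>: "\<psi> \<in> ?X" and d: "d > 0" for \<psi> d
  proof -
    obtain N where N: "\<And>m n. m \<ge> N \<Longrightarrow> norm (\<Sum>i=m..<n. cmod (\<psi> (x i))) < d"
      using abs_bound(1)[OF \<psi>] d unfolding summable_Cauchy by blast
    have "cmod (\<Sum>m<K. c N m * \<psi> (x m)) \<le> d" for K
    proof -
      have sub: "{..<K} \<inter> \<tau> ` {N..} \<subseteq> {N..<K}"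
      proof
        fix m assume "m \<in> {..<K} \<inter> \<tau> ` {N..}"
        then obtain a where "m = \<tau> a" "N \<le> a" "m < K" by auto
        then show "m \<in> {N..<K}" using \<tau>_ge[of a] by simp
      qed
      have "cmod (\<Sum>m<K. c N m * \<psi> (x m)) \<le> (\<Sum>m\<in>{..<K} \<inter> \<tau> ` {N..}. cmod (\<psi> (x m)))"
        unfolding c_sum by (rule norm_sum)
      also have "\<dots> \<le> (\<Sum>m=N..<K. cmod (\<psi> (x m)))"
        using sub by (intro sum_mono2) auto
      also have "\<dots> \<le> d" using N[of N K] by (simp add: abs_le_iff)
      finally show ?thesis .
    qed
    moreover have "(\<lambda>K. cmod (\<Sum>m<K. c N m * \<psi> (x m))) \<longlonglongrightarrow> cmod (\<psi> (y N))"
      using y(3)[OF \<psi>, of N] unfolding sums_def by (rule tendsto_norm)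
    ultimately have "cmod (\<psi> (y N)) \<le> d" by (intro LIMSEQ_le_const2) auto
    then show ?thesis by blast
  qed
  let ?emb = "canonical_embedding ?X ?N"
  let ?clust = "cluster_points (bidual_weak_star ?X ?N) (\<lambda>n. ?emb (\<phi> (\<tau> n)))"
  have dist: "t - 3 * e \<le> bidual_norm ?X ?N (F - ?emb \<psi>)" if F: "F \<in> ?clust" and \<psi>: "\<psi> \<in> ?X" for F \<psi>
  proof (rule field_le_epsilon)
    fix d :: real assume "d > 0"
    then obtain i where i: "cmod (\<psi> (y i)) \<le> d" using small[OF \<psi>] by blast
    define E where "E = (\<lambda>\<phi>. if \<phi> \<in> ?X then \<phi> (y i) else 0)"
    have E: "E \<in> cdual ?X ?N" "dual_norm ?X ?N E \<le> 1"
      using evaluation_cdual[OF y(1)[of i]] y(2)[of i] by (simp_all add: E_def)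
    have Fb: "F \<in> bidual ?X ?N"
      using F topspace_bidual_weak_star[OF norm_predual] by (simp add: cluster_points_def)
    have "t - 3 * e \<le> Re (F E)"
    proof (rule ccontr)
      assume "\<not> ?thesis"
      then have "F \<in> {G\<in>bidual ?X ?N. G E \<in> {z. Re z < t - 3 * e}}" using Fb by simp
      moreover have "openin (bidual_weak_star ?X ?N) {G\<in>bidual ?X ?N. G E \<in> {z. Re z < t - 3 * e}}"
        by (rule openin_bidual_weak_star[OF E(1)]) (rule open_halfspace_Re_lt)
      ultimately have "\<exists>\<^sub>F n in sequentially. ?emb (\<phi> (\<tau> n)) \<in> {G\<in>bidual ?X ?N. G E \<in> {z. Re z < t - 3 * e}}"
        using F unfolding cluster_points_def by blast
      \<comment> \<open>Being visited frequently supplies an index beyond \<open>i\<close>, where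
        the lower bound \<open>large\<close> is valid.\<close>
      then obtain n where "i \<le> n" "Re (?emb (\<phi> (\<tau> n)) E) < t - 3 * e"
        unfolding frequently_sequentially by blast
      with large[of i n] show False
        using E(1) A(1) by (simp add: canonical_embedding_def E_def)
    qed
    also have "Re (F E) \<le> cmod (F E)" by (rule complex_Re_le_cmod)
    also have "\<dots> \<le> cmod ((F - ?emb \<psi>) E) + cmod (\<psi> (y i))"
      using norm_triangle_ineq[of "F E - \<psi> (y i)" "\<psi> (y i)"] E(1) \<psi>
      by (simp add: canonical_embedding_def E_def)
    also have "cmod ((F - ?emb \<psi>) E) \<le> bidual_norm ?X ?N (F - ?emb \<psi>)"
      unfolding bidual_norm_def
    proof (rule dual_norm_upper[where X = "cdual ?X ?N" and x = E])
      show "F - ?emb \<psi> \<in> cdual (cdual ?X ?N) (dual_norm ?X ?N)"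
        using complex_vector.subspace_diff[OF seminorm_on_subspace[OF seminorm_on_bidual[OF norm_predual]] Fb
            canonical_embedding_bidual(1)[OF norm_predual \<psi>]] by (simp add: bidual_def)
    qed (rule seminorm_on_dual[OF norm_predual] E)+
    finally show "t - 3 * e \<le> bidual_norm ?X ?N (F - ?emb \<psi>) + d" using i by simp
  qed
  have "t - 3 * e \<le> norm_setdist (bidual_norm ?X ?N) ?clust (?emb ` ?X)"
    unfolding norm_setdist_def
  proof (rule cINF_greatest)
    have "?clust \<noteq> {}"
      by (rule cluster_points_bounded_nonempty[OF norm_predual, of "range \<phi>" B]) (use A in auto)
    moreover have "?X \<noteq> {}"
      using complex_vector.subspace_0[OF subspace_predual] by blast
    ultimately show "?clust \<times> ?emb ` ?X \<noteq> {}" by simp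
  next
    fix st assume "st \<in> ?clust \<times> ?emb ` ?X"
    then obtain F \<psi> where "st = (F, ?emb \<psi>)" "F \<in> ?clust" "\<psi> \<in> ?X"
      by (elim SigmaE imageE) simp
    then show "t - 3 * e \<le> (case st of (s, t) \<Rightarrow> bidual_norm ?X ?N (s - t))"
      using dist by simp
  qed
  then show thesis by (rule that)
qed

end

section \<open>The norm of the corners\<close>

context von_neumann
begin

lemma atomic_resolution_facts:
  assumes "atomic_resolution M I p"
  shows "\<And>i. i \<in> I \<Longrightarrow> p i \<in> M"
    and "\<And>C. finite C \<Longrightarrow> C \<subseteq> I \<Longrightarrow> (\<Sum>i\<in>C. p i) \<in> M"
    and "\<And>C. finite C \<Longrightarrow> C \<subseteq> I \<Longrightarrow> is_projection (\<Sum>i\<in>C. p i)"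
    and "\<And>C D. finite C \<Longrightarrow> finite D \<Longrightarrow> C \<subseteq> I \<Longrightarrow> D \<subseteq> I \<Longrightarrow> C \<inter> D = {} \<Longrightarrow>
      (\<Sum>i\<in>C. p i) o\<^sub>L (\<Sum>i\<in>D. p i) = 0"
    and "\<And>h. ((\<lambda>C. (\<Sum>i\<in>C. p i) h) \<longlongrightarrow> h) (finite_subsets_at_top I)"
proof -
  show pM: "p i \<in> M" if "i \<in> I" for i
    using assms that by (simp add: atomic_resolution_def atomic_projection_def projection_in_def)
  have proj: "is_projection (p i)" if "i \<in> I" for i
    using assms that by (simp add: atomic_resolution_def atomic_projection_def projection_in_def is_projection_def)
  have orth: "p i o\<^sub>L p j = 0" if "i \<in> I" "j \<in> I" "i \<noteq> j" for i j
    using assms that by (simp add: atomic_resolution_def)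
  show "(\<Sum>i\<in>C. p i) \<in> M" if "C \<subseteq> I" for C
    using pM that by (intro sum_M) auto
  show "is_projection (\<Sum>i\<in>C. p i)" if "finite C" "C \<subseteq> I" for C
    using proj orth that by (intro is_projection_sum) auto
  show "(\<Sum>i\<in>C. p i) o\<^sub>L (\<Sum>i\<in>D. p i) = 0"
    if CD: "finite C" "finite D" "C \<subseteq> I" "D \<subseteq> I" "C \<inter> D = {}" for C D
  proof (rule blinfun_eqI)
    fix h
    have "p i (p j h) = 0" if "i \<in> C" "j \<in> D" for i j
      using arg_cong[OF orth[of i j], of "\<lambda>a. blinfun_apply a h"] that CD by auto
    then show "((\<Sum>i\<in>C. p i) o\<^sub>L (\<Sum>i\<in>D. p i)) h = blinfun_apply 0 h"
      by (simp add: blinfun.sum_left blinfun.sum_right)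
  qed
  show "((\<lambda>C. (\<Sum>i\<in>C. p i) h) \<longlongrightarrow> h) (finite_subsets_at_top I)" for h
    using assms by (simp add: atomic_resolution_def sot_has_sum_def has_sum_def blinfun.sum_left)
qed

lemma predual_finite_sums:
  assumes p: "atomic_resolution M I p" and \<phi>: "\<phi> \<in> predual M" and b: "b \<in> M"
  shows "((\<lambda>C. \<phi> (b o\<^sub>L (\<Sum>i\<in>C. p i))) \<longlongrightarrow> \<phi> b) (finite_subsets_at_top I)"
    and "((\<lambda>C. \<phi> ((\<Sum>i\<in>C. p i) o\<^sub>L b)) \<longlongrightarrow> \<phi> b) (finite_subsets_at_top I)"
proof -
  note facts = atomic_resolution_facts[OF p]
  \<comment> \<open>The value 0 off the finite subsets of \<open>I\<close> gives membership in
    \<open>M\<close> and the norm bound at every index, as \<open>predual_tendsto\<close> asks; it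
    does not affect the limit.\<close>
  define P where "P C = (if finite C \<and> C \<subseteq> I then \<Sum>i\<in>C. p i else 0)" for C
  have P: "P C \<in> M" "norm (P C) \<le> 1" for C
    using facts(2) is_projection_operator_norm[OF facts(3)] zero_M by (auto simp: P_def)
  have ev: "\<forall>\<^sub>F C in finite_subsets_at_top I. P C = (\<Sum>i\<in>C. p i)"
    by (rule eventually_finite_subsets_at_top_weakI) (simp add: P_def)
  have lim: "((\<lambda>C. P C h) \<longlongrightarrow> h) (finite_subsets_at_top I)" for h
    by (rule Lim_transform_eventually[OF facts(5)]) (use ev in \<open>auto elim: eventually_mono\<close>)
  have "((\<lambda>C. \<phi> (b o\<^sub>L P C)) \<longlongrightarrow> \<phi> b) (finite_subsets_at_top I)"
  proof (rule predual_tendsto[OF \<phi>, where B = "norm b"])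
    show "((\<lambda>C. (b o\<^sub>L P C) h) \<longlongrightarrow> b h) (finite_subsets_at_top I)" for h
      using blinfun.tendsto[OF tendsto_const lim, of b h] by simp
  qed (use P b in \<open>auto intro: compose_M norm_compose_le_1\<close>)
  then show "((\<lambda>C. \<phi> (b o\<^sub>L (\<Sum>i\<in>C. p i))) \<longlongrightarrow> \<phi> b) (finite_subsets_at_top I)"
    by (rule Lim_transform_eventually) (use ev in \<open>auto elim: eventually_mono\<close>)
  have "((\<lambda>C. \<phi> (P C o\<^sub>L b)) \<longlongrightarrow> \<phi> b) (finite_subsets_at_top I)"
    by (rule predual_tendsto[OF \<phi>, where B = "norm b"])
      (use P b lim in \<open>auto intro: compose_M norm_compose_le_1\<close>)
  then show "((\<lambda>C. \<phi> ((\<Sum>i\<in>C. p i) o\<^sub>L b)) \<longlongrightarrow> \<phi> b) (finite_subsets_at_top I)"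
    by (rule Lim_transform_eventually) (use ev in \<open>auto elim: eventually_mono\<close>)
qed

lemma bimodule_action_norm_le:
  assumes ab: "a \<in> M" "b \<in> M" "norm a \<le> 1" "norm b \<le> 1" and \<phi>: "\<phi> \<in> cdual M norm"
  shows "predual_norm M (bimodule_action M a \<phi> b) \<le> predual_norm M \<phi>"
    and "bimodule_action M a \<phi> b \<in> cdual M norm"
proof -
  have mem: "b o\<^sub>L x o\<^sub>L a \<in> M" if "x \<in> M" for x
    using that ab by (intro compose_M)
  have bound: "cmod (bimodule_action M a \<phi> b x) \<le> predual_norm M \<phi> * norm x" if x: "x \<in> M" for x
  proof -
    have "cmod (\<phi> (b o\<^sub>L x o\<^sub>L a)) \<le> predual_norm M \<phi> * norm (b o\<^sub>L x o\<^sub>L a)"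
      by (rule predual_norm_bound[OF \<phi> mem[OF x]])
    also have "norm (b o\<^sub>L x o\<^sub>L a) \<le> norm x"
      using norm_compose_le_1(2)[OF ab(3), of "b o\<^sub>L x"] norm_compose_le_1(1)[OF ab(4), of x] by linarith
    finally show ?thesis
      using x dual_norm_nonneg[OF norm_M \<phi>] by (simp add: bimodule_action_def mult_left_mono predual_norm_def)
  qed
  show "bimodule_action M a \<phi> b \<in> cdual M norm"
    by (rule cdualI[OF _ _ bound])
      (auto simp: bimodule_action_def add_M scale_M blinfun_compose_add_left blinfun_compose_add_right
        blinfun_compose_scaleC_left compose_scaleC_right[OF ab(2)] cdual_add[OF \<phi> mem mem, simplified]
        cdual_scale[OF \<phi> mem, simplified] mem)
  show "predual_norm M (bimodule_action M a \<phi> b) \<le> predual_norm M \<phi>"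
    unfolding predual_norm_def
  proof (rule dual_norm_least[OF norm_M])
    fix x :: "'h \<Rightarrow>\<^sub>L 'h" assume x: "x \<in> M" "norm x \<le> 1"
    show "cmod (bimodule_action M a \<phi> b x) \<le> dual_norm M norm \<phi>"
      using bound[OF x(1)] mult_left_mono[OF x(2) dual_norm_nonneg[OF norm_M \<phi>]]
      by (simp add: predual_norm_def)
  qed
qed

text \<open>In \<open>bimodule_action M a \<phi> b\<close> the factor \<open>a\<close> stands to the
  right of \<open>x\<close>, so the \<open>p\<close> cut the initial space of \<open>x\<close> and
  the \<open>q\<close> cut its range.\<close>

abbreviation corner :: "('i \<Rightarrow> 'h \<Rightarrow>\<^sub>L 'h) \<Rightarrow> ('j \<Rightarrow> 'h \<Rightarrow>\<^sub>L 'h) \<Rightarrow> (('h \<Rightarrow>\<^sub>L 'h) \<Rightarrow> complex) set \<Rightarrow>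
    'i set \<Rightarrow> 'j set \<Rightarrow> real" where
  "corner p q A C D \<equiv> SUP \<phi>\<in>A. predual_norm M
     (bimodule_action M (id_blinfun - (\<Sum>\<alpha>\<in>C. p \<alpha>)) \<phi> (id_blinfun - (\<Sum>j\<in>D. q j)))"

lemma complement_facts:
  assumes "atomic_resolution M I p" "finite C" "C \<subseteq> I"
  shows "id_blinfun - (\<Sum>i\<in>C. p i) \<in> M" "norm (id_blinfun - (\<Sum>i\<in>C. p i)) \<le> 1"
  using diff_M[OF id_M atomic_resolution_facts(2)[OF assms]]
    is_projection_operator_norm[OF is_projection_id_minus[OF atomic_resolution_facts(3)[OF assms]]]
  by auto

section \<open>Comparison of the measures with the corners of two fixed resolutions\<close>

context
  fixes I :: "'i set" and p :: "'i \<Rightarrow> 'h \<Rightarrow>\<^sub>L 'h" and J :: "'j set" and q :: "'j \<Rightarrow> 'h \<Rightarrow>\<^sub>L 'h"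
    and A B
  assumes p: "atomic_resolution M I p" and q: "atomic_resolution M J q"
    and A: "A \<subseteq> predual M" "A \<noteq> {}" "\<And>\<phi>. \<phi> \<in> A \<Longrightarrow> predual_norm M \<phi> \<le> B"
begin

lemma corner_bdd:
  assumes C: "finite C" "C \<subseteq> I" and D: "finite D" "D \<subseteq> J"
  shows "bdd_above ((\<lambda>\<phi>. predual_norm M
     (bimodule_action M (id_blinfun - (\<Sum>\<alpha>\<in>C. p \<alpha>)) \<phi> (id_blinfun - (\<Sum>j\<in>D. q j)))) ` A)"
proof (rule bdd_aboveI2)
  fix \<phi> assume \<phi>: "\<phi> \<in> A"
  then have "\<phi> \<in> cdual M norm" using A(1) predual_cdual by blast
  from bimodule_action_norm_le(1)[OF complement_facts(1)[OF p C] complement_facts(1)[OF q D]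
      complement_facts(2)[OF p C] complement_facts(2)[OF q D] this] A(3)[OF \<phi>]
  show "predual_norm M (bimodule_action M (id_blinfun - (\<Sum>\<alpha>\<in>C. p \<alpha>)) \<phi> (id_blinfun - (\<Sum>j\<in>D. q j))) \<le> B"
    by linarith
qed

text \<open>With \<open>P\<close>, \<open>Q\<close> the finite sums of the \<open>p i\<close>, \<open>q j\<close>, the functional \<open>\<phi> - (1 - P) \<phi> (1 - Q)\<close> is
  \<open>x \<mapsto> \<phi> (Q x) + \<phi> ((1 - Q) x P)\<close>, which ranges over a relatively weakly compact set.\<close>

lemma omega_le_corner:
  assumes C: "finite C" "C \<subseteq> I" and D: "finite D" "D \<subseteq> J"
  shows "omega_measure (predual M) (predual_norm M) A \<le> corner p q A C D"
proof -
  let ?P = "\<Sum>i\<in>C. p i" and ?Q = "\<Sum>j\<in>D. q j"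
  let ?X = "predual M" and ?N = "predual_norm M"
  note cP = complement_facts[OF p C] and cQ = complement_facts[OF q D]
  obtain \<phi>0 where \<phi>0: "\<phi>0 \<in> A" using A(2) by blast
  then have "0 \<le> ?N \<phi>0" using A(1) by (intro seminorm_on_nonneg[OF norm_predual]) blast
  then have B: "B \<ge> 0" using A(3)[OF \<phi>0] by linarith
  have pa: "atomic_projection M (p i)" if "i \<in> C" for i
    using p C(2) that by (auto simp: atomic_resolution_def)
  have qa: "atomic_projection M (q j)" if "j \<in> D" for j
    using q D(2) that by (auto simp: atomic_resolution_def)
  obtain K where K: "compactin (weak_topology ?X ?N) K"
    "\<And>\<psi>. \<psi> \<in> cdual M norm \<Longrightarrow> (\<forall>x\<in>M. cmod (\<psi> x) \<le> B * norm x) \<Longrightarrow>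
      (\<lambda>x. if x \<in> M then \<psi> (x o\<^sub>L ?P) else 0) \<in> K"
    using compact_set_right[of C p B] C(1) pa B by blast
  obtain L where L: "compactin (weak_topology ?X ?N) L"
    "\<And>\<psi>. \<psi> \<in> cdual M norm \<Longrightarrow> (\<forall>x\<in>M. cmod (\<psi> x) \<le> B * norm x) \<Longrightarrow>
      (\<lambda>x. if x \<in> M then \<psi> (?Q o\<^sub>L x) else 0) \<in> L"
    using compact_set_left[of D q B] D(1) qa B by blast
  have bounded: "cmod (\<psi> x) \<le> B * norm x" if "\<psi> \<in> cdual M norm" "?N \<psi> \<le> B" "x \<in> M" for \<psi> x
    using predual_norm_bound[OF that(1,3)] mult_right_mono[OF that(2), of "norm x"] by simp
  show ?thesis
  proof (rule omega_le[OF norm_predual A compactin_weak_topology_plus[OF subspace_predual K(1) L(1)]])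
    fix \<phi> assume \<phi>: "\<phi> \<in> A"
    then have \<phi>c: "\<phi> \<in> cdual M norm" using A(1) predual_cdual by blast
    \<comment> \<open>The left cut is made first; the functional
      \<open>x \<mapsto> \<phi> ((1 - Q) x)\<close> again has norm at most \<open>B\<close>, so the
      compact set for right cuts by \<open>P\<close> applies to it.\<close>
    let ?\<psi> = "bimodule_action M id_blinfun \<phi> (id_blinfun - ?Q)"
    have id1: "norm (id_blinfun :: 'h \<Rightarrow>\<^sub>L 'h) \<le> 1" by (rule norm_blinfun_bound) auto
    note \<psi> = bimodule_action_norm_le[OF id_M cQ(1) id1 cQ(2) \<phi>c]
    define k where "k = (\<lambda>x. if x \<in> M then ?\<psi> (x o\<^sub>L ?P) else 0)"
    define l where "l = (\<lambda>x. if x \<in> M then \<phi> (?Q o\<^sub>L x) else 0)"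
    have "k \<in> K" unfolding k_def
      using \<psi> A(3)[OF \<phi>] by (intro K(2) ballI bounded) auto
    moreover have "l \<in> L" unfolding l_def
      using \<phi>c A(3)[OF \<phi>] by (intro L(2) ballI bounded) auto
    ultimately have kl: "k + l \<in> (\<lambda>(k, l). k + l) ` (K \<times> L)" by (intro image_eqI[of _ _ "(k, l)"]) auto
    have "\<phi> - (k + l) = bimodule_action M (id_blinfun - ?P) \<phi> (id_blinfun - ?Q)"
    proof
      fix x
      show "(\<phi> - (k + l)) x = bimodule_action M (id_blinfun - ?P) \<phi> (id_blinfun - ?Q) x"
      proof (cases "x \<in> M")
        case True
        have PM: "?P \<in> M" and QM: "?Q \<in> M"
          using atomic_resolution_facts(2)[OF p C] atomic_resolution_facts(2)[OF q D] by auto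
        let ?z = "(id_blinfun - ?Q) o\<^sub>L x"
        have z: "?z \<in> M" by (rule compose_M[OF cQ(1) True])
        have "?z o\<^sub>L (id_blinfun - ?P) = ?z - (?z o\<^sub>L ?P)"
          unfolding blinfun_compose_diff_right by (intro arg_cong2[of _ _ _ _ minus] blinfun_eqI) auto
        then have "\<phi> (?z o\<^sub>L (id_blinfun - ?P)) = \<phi> ?z - \<phi> (?z o\<^sub>L ?P)"
          using cdual_diff[OF \<phi>c subspace_M z compose_M[OF z PM]] by simp
        also have "?z = x - (?Q o\<^sub>L x)"
          unfolding blinfun_compose_diff_left by (intro arg_cong2[of _ _ _ _ minus] blinfun_eqI) auto
        then have "\<phi> ?z = \<phi> x - \<phi> (?Q o\<^sub>L x)"
          using cdual_diff[OF \<phi>c subspace_M True compose_M[OF QM True]] by simp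
        finally have "bimodule_action M (id_blinfun - ?P) \<phi> (id_blinfun - ?Q) x
            = \<phi> x - \<phi> (?Q o\<^sub>L x) - \<phi> (?z o\<^sub>L ?P)"
          using True by (simp add: bimodule_action_def)
        moreover have "k x = \<phi> (?z o\<^sub>L ?P)"
        proof -
          have "(id_blinfun - ?Q) o\<^sub>L (x o\<^sub>L ?P) o\<^sub>L id_blinfun = ?z o\<^sub>L ?P"
            by (rule blinfun_eqI) simp
          then show ?thesis using True compose_M[OF True PM] by (simp add: k_def bimodule_action_def)
        qed
        ultimately show ?thesis using True by (simp add: l_def)
      next
        case False
        then show ?thesis by (simp add: k_def l_def bimodule_action_def cdual_outside[OF \<phi>c])
      qed
    qed
    then have "?N (\<phi> - (k + l)) \<le> corner p q A C D"
      using cSUP_upper[OF \<phi> corner_bdd[OF C D]] by simp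
    with kl show "\<exists>k\<in>(\<lambda>(k, l). k + l) ` (K \<times> L). ?N (\<phi> - k) \<le> corner p q A C D" by blast
  qed
qed

text \<open>Normality replaces each complement by a finite block disjoint from the projections
  already used, first on the right and then, with \<open>C'\<close> fixed, on the left. The strict
  inequality survives for sufficiently large finite index sets.\<close>

lemma corner_step:
  assumes C: "finite C" "C \<subseteq> I" and D: "finite D" "D \<subseteq> J" and t: "t < corner p q A C D"
  obtains C' D' \<phi> z where "finite C'" "C \<subseteq> C'" "C' \<subseteq> I" "finite D'" "D \<subseteq> D'" "D' \<subseteq> J"
    "\<phi> \<in> A" "z \<in> M" "norm z \<le> 1"
    "t < Re (\<phi> ((\<Sum>j\<in>D' - D. q j) o\<^sub>L z o\<^sub>L (\<Sum>i\<in>C' - C. p i)))"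
proof -
  let ?P = "\<lambda>C. \<Sum>i\<in>C. p i" and ?Q = "\<lambda>D. \<Sum>j\<in>D. q j"
  note cP = complement_facts[OF p C] and cQ = complement_facts[OF q D]
  have diff: "?P (C' - C) = ?P C' - ?P C" if "finite C'" "C \<subseteq> C'" for C'
    by (rule sum_diff[OF that])
  have diff': "?Q (D' - D) = ?Q D' - ?Q D" if "finite D'" "D \<subseteq> D'" for D'
    by (rule sum_diff[OF that])
  obtain \<phi> where \<phi>: "\<phi> \<in> A" "t < predual_norm M (bimodule_action M (id_blinfun - ?P C) \<phi> (id_blinfun - ?Q D))"
    using t less_cSUP_iff[OF A(2) corner_bdd[OF C D]] by blast
  have \<phi>p: "\<phi> \<in> predual M" using \<phi>(1) A(1) by blast
  note \<phi>c = predual_cdual[OF \<phi>p]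
  obtain z where z: "z \<in> M" "norm z \<le> 1" "t < cmod (\<phi> ((id_blinfun - ?Q D) o\<^sub>L z o\<^sub>L (id_blinfun - ?P C)))"
    using \<phi>(2) unfolding predual_norm_def
    by (rule less_dual_normE[OF norm_M]) (simp add: bimodule_action_def)
  let ?w = "(id_blinfun - ?Q D) o\<^sub>L z"
  have w: "?w \<in> M" by (rule compose_M[OF cQ(1) z(1)])
  have PM: "?P C' \<in> M" if "finite C'" "C' \<subseteq> I" for C' using atomic_resolution_facts(2)[OF p that] .
  have QM: "?Q D' \<in> M" if "finite D'" "D' \<subseteq> J" for D' using atomic_resolution_facts(2)[OF q that] .
  have idP: "?w o\<^sub>L (id_blinfun - ?P C) = ?w - (?w o\<^sub>L ?P C)"
    unfolding blinfun_compose_diff_right by (intro arg_cong2[of _ _ _ _ minus] blinfun_eqI) auto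
  have "((\<lambda>C'. \<phi> (?w o\<^sub>L ?P C') - \<phi> (?w o\<^sub>L ?P C)) \<longlongrightarrow> \<phi> ?w - \<phi> (?w o\<^sub>L ?P C)) (finite_subsets_at_top I)"
    by (intro tendsto_intros predual_finite_sums(1)[OF p \<phi>p w])
  also have "\<phi> ?w - \<phi> (?w o\<^sub>L ?P C) = \<phi> (?w o\<^sub>L (id_blinfun - ?P C))"
    unfolding idP by (rule cdual_diff[OF \<phi>c subspace_M w compose_M[OF w PM[OF C]], symmetric])
  finally have "\<forall>\<^sub>F C' in finite_subsets_at_top I. t < cmod (\<phi> (?w o\<^sub>L ?P C') - \<phi> (?w o\<^sub>L ?P C))"
    using z(3) by (intro order_tendstoD(1)[OF tendsto_norm])
  moreover have "\<forall>\<^sub>F C' in finite_subsets_at_top I. finite C' \<and> C \<subseteq> C' \<and> C' \<subseteq> I"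
    unfolding eventually_finite_subsets_at_top using C by blast
  ultimately have "\<forall>\<^sub>F C' in finite_subsets_at_top I. t < cmod (\<phi> (?w o\<^sub>L ?P C') - \<phi> (?w o\<^sub>L ?P C)) \<and>
      finite C' \<and> C \<subseteq> C' \<and> C' \<subseteq> I"
    by (rule eventually_conj)
  then have "\<exists>C'. t < cmod (\<phi> (?w o\<^sub>L ?P C') - \<phi> (?w o\<^sub>L ?P C)) \<and> finite C' \<and> C \<subseteq> C' \<and> C' \<subseteq> I"
    by (rule eventually_happens'[OF finite_subsets_at_top_neq_bot])
  then obtain C' where C': "finite C'" "C \<subseteq> C'" "C' \<subseteq> I" "t < cmod (\<phi> (?w o\<^sub>L ?P C') - \<phi> (?w o\<^sub>L ?P C))"
    by (elim exE conjE)
  let ?v = "z o\<^sub>L ?P (C' - C)"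
  have P': "?P (C' - C) \<in> M" using C' by (intro PM) auto
  have v: "?v \<in> M" by (rule compose_M[OF z(1) P'])
  have "?v - (?Q D o\<^sub>L ?v) = (?w o\<^sub>L ?P C') - (?w o\<^sub>L ?P C)"
    unfolding diff[OF C'(1,2)]
    by (rule blinfun_eqI) (simp add: blinfun.diff_left blinfun.diff_right)
  then have "\<phi> (?w o\<^sub>L ?P C') - \<phi> (?w o\<^sub>L ?P C) = \<phi> ?v - \<phi> (?Q D o\<^sub>L ?v)"
    using cdual_diff[OF \<phi>c subspace_M compose_M[OF w PM[OF C'(1,3)]] compose_M[OF w PM[OF C]]]
      cdual_diff[OF \<phi>c subspace_M v compose_M[OF QM[OF D] v]] by simp
  \<comment> \<open>Second limit, now over \<open>D'\<close>, with the right block already absorbed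
    into \<open>?v\<close>.\<close>
  moreover have "((\<lambda>D'. \<phi> (?Q D' o\<^sub>L ?v) - \<phi> (?Q D o\<^sub>L ?v)) \<longlongrightarrow> \<phi> ?v - \<phi> (?Q D o\<^sub>L ?v)) (finite_subsets_at_top J)"
    by (intro tendsto_intros predual_finite_sums(2)[OF q \<phi>p v])
  ultimately have "\<forall>\<^sub>F D' in finite_subsets_at_top J. t < cmod (\<phi> (?Q D' o\<^sub>L ?v) - \<phi> (?Q D o\<^sub>L ?v))"
    using C'(4) by (intro order_tendstoD(1)[OF tendsto_norm]) auto
  moreover have "\<forall>\<^sub>F D' in finite_subsets_at_top J. finite D' \<and> D \<subseteq> D' \<and> D' \<subseteq> J"
    unfolding eventually_finite_subsets_at_top using D by blast
  ultimately have "\<forall>\<^sub>F D' in finite_subsets_at_top J. t < cmod (\<phi> (?Q D' o\<^sub>L ?v) - \<phi> (?Q D o\<^sub>L ?v)) \<and>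
      finite D' \<and> D \<subseteq> D' \<and> D' \<subseteq> J"
    by (rule eventually_conj)
  then have "\<exists>D'. t < cmod (\<phi> (?Q D' o\<^sub>L ?v) - \<phi> (?Q D o\<^sub>L ?v)) \<and> finite D' \<and> D \<subseteq> D' \<and> D' \<subseteq> J"
    by (rule eventually_happens'[OF finite_subsets_at_top_neq_bot])
  then obtain D' where D': "finite D'" "D \<subseteq> D'" "D' \<subseteq> J" "t < cmod (\<phi> (?Q D' o\<^sub>L ?v) - \<phi> (?Q D o\<^sub>L ?v))"
    by (elim exE conjE)
  have Q': "?Q (D' - D) \<in> M" using D' by (intro QM) auto
  let ?u = "?Q (D' - D) o\<^sub>L z o\<^sub>L ?P (C' - C)"
  have u: "?u \<in> M" by (intro compose_M Q' z P')
  have "?u = (?Q D' o\<^sub>L ?v) - (?Q D o\<^sub>L ?v)"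
    unfolding diff'[OF D'(1,2)] by (rule blinfun_eqI) (simp add: blinfun.diff_left)
  then have large: "t < cmod (\<phi> ?u)"
    using D'(4) cdual_diff[OF \<phi>c subspace_M compose_M[OF QM[OF D'(1,3)] v] compose_M[OF QM[OF D] v]] by simp
  \<comment> \<open>A phase of modulus at most 1, absorbed into \<open>z\<close>, turns the modulus
    into a real part.\<close>
  define c where "c = cnj (sgn (\<phi> ?u))"
  have "c * \<phi> ?u = of_real (cmod (\<phi> ?u))"
    by (cases "\<phi> ?u = 0")
      (simp_all add: c_def sgn_div_norm scaleR_conv_of_real complex_norm_square[symmetric] mult.assoc
        mult.commute[of "cnj z" for z] power2_eq_square)
  moreover have "?Q (D' - D) o\<^sub>L (c *\<^sub>C z) o\<^sub>L ?P (C' - C) = c *\<^sub>C ?u"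
    by (simp add: compose_scaleC_right[OF Q'] blinfun_compose_scaleC_left)
  ultimately have "t < Re (\<phi> (?Q (D' - D) o\<^sub>L (c *\<^sub>C z) o\<^sub>L ?P (C' - C)))"
    using large by (simp add: cdual_scale[OF \<phi>c u])
  moreover have "norm (c *\<^sub>C z) \<le> 1"
    using z(2) by (simp add: norm_scaleC_blinfun c_def norm_sgn)
  ultimately show thesis
    using C' D' \<phi>(1) scale_M[OF z(1)] by (intro that)
qed

text \<open>A uniform strict bound below all corners lets \<open>corner_step\<close> be iterated
  forever; its increments are the disjoint blocks needed for the gliding hump.\<close>

lemma le_wck_measure:
  assumes t: "\<And>C D. finite C \<Longrightarrow> C \<subseteq> I \<Longrightarrow> finite D \<Longrightarrow> D \<subseteq> J \<Longrightarrow> t < corner p q A C D"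
  shows "t \<le> wck_measure (predual M) (predual_norm M) A"
proof (rule field_le_epsilon)
  fix e :: real assume e: "e > 0"
  let ?P = "\<lambda>C. \<Sum>i\<in>C. p i" and ?Q = "\<lambda>D. \<Sum>j\<in>D. q j"
  define good where "good S S' \<phi> z \<longleftrightarrow> \<phi> \<in> A \<and> z \<in> M \<and> norm z \<le> 1 \<and>
      t < Re (\<phi> (?Q (snd S' - snd S) o\<^sub>L z o\<^sub>L ?P (fst S' - fst S)))" for S S' \<phi> z
  define adm where "adm S \<longleftrightarrow> finite (fst S) \<and> fst S \<subseteq> I \<and> finite (snd S) \<and> snd S \<subseteq> J" for S
  \<comment> \<open>The state of the recursion is the pair of finite index sets used so far.\<close>
  have "\<exists>S. \<forall>n. adm (S n) \<and>
      (fst (S n) \<subseteq> fst (S (Suc n)) \<and> snd (S n) \<subseteq> snd (S (Suc n)) \<and> (\<exists>\<phi> z. good (S n) (S (Suc n)) \<phi> z))"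
  proof (rule dependent_nat_choice)
    show "\<exists>S. adm S" by (rule exI[of _ "({}, {})"]) (simp add: adm_def)
  next
    fix S :: "'i set \<times> 'j set" and n :: nat assume S: "adm S"
    then have CD: "finite (fst S)" "fst S \<subseteq> I" "finite (snd S)" "snd S \<subseteq> J" by (auto simp: adm_def)
    obtain C' D' \<phi> z where "finite C'" "fst S \<subseteq> C'" "C' \<subseteq> I" "finite D'" "snd S \<subseteq> D'" "D' \<subseteq> J"
      "\<phi> \<in> A" "z \<in> M" "norm z \<le> 1"
      "t < Re (\<phi> (?Q (D' - snd S) o\<^sub>L z o\<^sub>L ?P (C' - fst S)))"
      by (rule corner_step[OF CD t[OF CD]])
    then show "\<exists>S'. adm S' \<and> (fst S \<subseteq> fst S' \<and> snd S \<subseteq> snd S' \<and> (\<exists>\<phi> z. good S S' \<phi> z))"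
      by (intro exI[of _ "(C', D')"]) (auto simp: adm_def good_def)
  qed
  then obtain S where S: "\<And>n. adm (S n)" "\<And>n. fst (S n) \<subseteq> fst (S (Suc n))"
    "\<And>n. snd (S n) \<subseteq> snd (S (Suc n))" "\<And>n. \<exists>\<phi> z. good (S n) (S (Suc n)) \<phi> z" by blast
  then obtain \<phi> z where good: "\<And>n. good (S n) (S (Suc n)) (\<phi> n) (z n)" by metis
  define E where "E n = fst (S (Suc n)) - fst (S n)" for n
  define G where "G n = snd (S (Suc n)) - snd (S n)" for n
  have E: "finite (E n)" "E n \<subseteq> I" and G: "finite (G n)" "G n \<subseteq> J" for n
    using S(1)[of "Suc n"] by (auto simp: adm_def E_def G_def)
  have disj: "E m \<inter> E n = {} \<and> G m \<inter> G n = {}" if "m \<noteq> n" for m n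
  proof -
    \<comment> \<open>Increments of an increasing sequence of sets are pairwise disjoint.\<close>
    have "fst (S a) \<subseteq> fst (S b)" "snd (S a) \<subseteq> snd (S b)" if "a \<le> b" for a b
      using lift_Suc_mono_le[of "\<lambda>n. fst (S n)" a b] lift_Suc_mono_le[of "\<lambda>n. snd (S n)" a b] S(2,3) that
      by auto
    from this[of "Suc m" n] this[of "Suc n" m] show ?thesis
      using that by (cases m n rule: linorder_cases) (auto simp: E_def G_def)
  qed
  note fp = atomic_resolution_facts[OF p] and fq = atomic_resolution_facts[OF q]
  define x where "x n = ?Q (G n) o\<^sub>L z n o\<^sub>L ?P (E n)" for n
  have zn: "\<phi> n \<in> A" "z n \<in> M" "norm (z n) \<le> 1" "t < Re (\<phi> n (x n))" for n
    using good[of n] by (auto simp: good_def x_def E_def G_def)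
  have xM: "x n \<in> M" for n
    unfolding x_def by (intro compose_M zn fp(2) fq(2) E G)
  have x1: "norm (x n) \<le> 1" for n
  proof -
    have "norm (x n) \<le> norm (?Q (G n) o\<^sub>L z n)"
      unfolding x_def by (rule norm_compose_le_1(2)[OF is_projection_operator_norm[OF fp(3)[OF E]]])
    also have "\<dots> \<le> norm (z n)"
      by (rule norm_compose_le_1(1)[OF is_projection_operator_norm[OF fq(3)[OF G]]])
    finally show ?thesis using zn(3)[of n] by linarith
  qed
  have xsr: "x n h = ?Q (G n) (x n (?P (E n) h))" for n h
    by (simp add: x_def is_projection_idem[OF fp(3)[OF E]] is_projection_idem[OF fq(3)[OF G]])
  have orth: "?P (E m) o\<^sub>L ?P (E n) = 0" "?Q (G m) o\<^sub>L ?Q (G n) = 0" if "m \<noteq> n" for m n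
    using fp(4)[OF E(1) E(1) E(2) E(2), of m n] fq(4)[OF G(1) G(1) G(2) G(2), of m n] disj[OF that]
    by auto
  have block: "\<exists>y\<in>M. norm y \<le> 1 \<and> (\<forall>\<psi>\<in>predual M. (\<lambda>n. c n * \<psi> (x n)) sums \<psi> y)"
    if c: "\<And>n. cmod (c n) \<le> 1" for c :: "nat \<Rightarrow> complex"
  proof -
    show ?thesis
      by (rule block_diagonal_sums[where r = "\<lambda>n. ?P (E n)" and s = "\<lambda>n. ?Q (G n)" and x = x and c = c,
            OF xM x1 xsr fp(3)[OF E] orth(1) fq(3)[OF G] orth(2) c]) blast+
  qed
  have \<phi>: "\<phi> n \<in> predual M" "predual_norm M (\<phi> n) \<le> B" for n
    using zn(1) A by auto
  obtain \<tau> :: "nat \<Rightarrow> nat" where "t - 3 * (e / 3) \<le> norm_setdist (bidual_norm (predual M) (predual_norm M))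
      (cluster_points (bidual_weak_star (predual M) (predual_norm M))
        (\<lambda>n. canonical_embedding (predual M) (predual_norm M) (\<phi> (\<tau> n))))
      (canonical_embedding (predual M) (predual_norm M) ` predual M)"
    \<comment> \<open>The loss of three times the parameter becomes exactly
      \<open>e\<close>.\<close>
    by (rule gliding_hump[where e = "e / 3", OF \<phi> xM x1 block less_imp_le[OF zn(4)]]) (use e in auto)
  also have "\<dots> \<le> wck_measure (predual M) (predual_norm M) A"
    by (rule wck_measure_upper[OF norm_predual A(1,3)]) (use zn(1) in auto)
  finally show "t \<le> wck_measure (predual M) (predual_norm M) A + e" by simp
qed

text \<open>Closes the cycle \<open>r \<le> wck \<le> wk \<le> omega \<le> r\<close>.\<close>

lemma measures_eq_corner:
  defines "r \<equiv> (INF (C, D) \<in> {C. finite C \<and> C \<subseteq> I} \<times> {D. finite D \<and> D \<subseteq> J}. corner p q A C D)"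
  shows "omega_measure (predual M) (predual_norm M) A = r"
    and "wk_measure (predual M) (predual_norm M) A = r"
    and "wck_measure (predual M) (predual_norm M) A = r"
proof -
  let ?F = "{C. finite C \<and> C \<subseteq> I} \<times> {D. finite D \<and> D \<subseteq> J}"
  have ne: "?F \<noteq> {}" by blast
  have omega: "omega_measure (predual M) (predual_norm M) A \<le> r"
    unfolding r_def by (rule cINF_greatest[OF ne]) (auto intro: omega_le_corner)
  \<comment> \<open>The measure \<open>omega\<close> is itself a lower bound of all corners, which
    makes their infimum meaningful.\<close>
  have bdd: "bdd_below ((\<lambda>(C, D). corner p q A C D) ` ?F)"
    by (rule bdd_belowI2[where m = "omega_measure (predual M) (predual_norm M) A"])
      (auto intro: omega_le_corner)
  have "r \<le> wck_measure (predual M) (predual_norm M) A"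
  proof (rule dense_le)
    fix t assume t: "t < r"
    show "t \<le> wck_measure (predual M) (predual_norm M) A"
    proof (rule le_wck_measure)
      fix C D assume "finite C" "C \<subseteq> I" "finite D" "D \<subseteq> J"
      then have "r \<le> corner p q A C D"
        unfolding r_def using cINF_lower[OF bdd, of "(C, D)"] by simp
      with t show "t < corner p q A C D" by simp
    qed
  qed
  with omega wck_le_wk[OF norm_predual A] wk_le_omega[OF norm_predual A]
  show "omega_measure (predual M) (predual_norm M) A = r"
    "wk_measure (predual M) (predual_norm M) A = r"
    "wck_measure (predual M) (predual_norm M) A = r" by linarith+
qed

end

end

theorem theorem2p2:
  fixes M :: "('h::complex_hilbert_space \<Rightarrow>\<^sub>L 'h) set"
    and A :: "(('h \<Rightarrow>\<^sub>L 'h) \<Rightarrow> complex) set"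
  assumes "von_neumann_algebra M"
    and "atomic_algebra M"
    and "A \<subseteq> predual M"
    and "A \<noteq> {}"
    and "\<exists>B. \<forall>\<phi>\<in>A. predual_norm M \<phi> \<le> B"
  shows "omega_measure (predual M) (predual_norm M) A
           = wk_measure (predual M) (predual_norm M) A
       \<and> wk_measure (predual M) (predual_norm M) A
           = wck_measure (predual M) (predual_norm M) A
       \<and> (\<forall>(\<Lambda> :: 'i set) (p :: 'i \<Rightarrow> ('h \<Rightarrow>\<^sub>L 'h)) (J :: 'j set) (q :: 'j \<Rightarrow> ('h \<Rightarrow>\<^sub>L 'h)).
            atomic_resolution M \<Lambda> p \<and> atomic_resolution M J q \<longrightarrow>
            omega_measure (predual M) (predual_norm M) A
              = (INF (C, D) \<in> {C. finite C \<and> C \<subseteq> \<Lambda>} \<times> {D. finite D \<and> D \<subseteq> J}.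
                   SUP \<phi>\<in>A. predual_norm M
                     (bimodule_action M (id_blinfun - (\<Sum>\<alpha>\<in>C. p \<alpha>)) \<phi>
                                        (id_blinfun - (\<Sum>j\<in>D. q j)))))"
proof -
  interpret von_neumann M by unfold_locales (rule assms(1))
  obtain B where B: "\<And>\<phi>. \<phi> \<in> A \<Longrightarrow> predual_norm M \<phi> \<le> B" using assms(5) by blast
  obtain P where P: "atomic_resolution M P (\<lambda>p. p)" using assms(2) by (auto simp: atomic_algebra_def)
  \<comment> \<open>The equality of the three measures comes from a single resolution, indexed by
    itself and used on both sides.\<close>
  note eq = measures_eq_corner[OF P P assms(3,4) B]
  show ?thesis
  proof (intro conjI allI impI)
    show "omega_measure (predual M) (predual_norm M) A = wk_measure (predual M) (predual_norm M) A"
      "wk_measure (predual M) (predual_norm M) A = wck_measure (predual M) (predual_norm M) A"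
      using eq by simp_all
  qed (elim conjE, rule measures_eq_corner(1)[OF _ _ assms(3,4) B])
qed

end
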